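(* Let $q$ be a root of unity, $q\ne\pm1$, $\delta=q+q^{-1}$. Let $w,w',w''$ be infinite link states that differ at only finitely many points, with $s(w)>s(w')>s(w'')$ all finite, and such that $w,w'$ and $w',w''$ form symmetric pairs. Then there are non-split extensions of $TL_\infty(\delta)$ representations $$0\to\mathcal{X}(w')\to\mathcal{P}(w)\to\mathcal{X}(w)\to0,\qquad 0\to\mathcal{X}(w'')\to\mathcal{Q}(w)\to\mathcal{X}(w)\to0,$$ where $\mathcal{P}(w)=\mathcal{X}(w')\oplus\mathcal{X}(w)$ with action $e_k\cdot(v,x)=(e_kv+\tilde e_kx,\ e_kx)$, and $\mathcal{Q}(w)=\mathcal{X}(w'')\oplus\mathcal{X}(w)$ with action $e_k\cdot(v,x)=(e_kv+\tilde e'_k\phi(x),\ e_kx)$.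
   Context: $TL_\infty(\delta)$ is the unital $\mathbb{C}$-algebra generated by $\mathbf{1}$ and $e_i$, $i\in\mathbb{N}=\{1,2,\dots\}$, with relations $e_i^2=\delta e_i$, $e_ie_{i\pm1}e_i=e_i$, $e_ie_j=e_je_i$ for $|i-j|>1$. An infinite link state is a configuration on the points $1,2,3,\dots$ in which each point is either joined to exactly one other point by a cup or is attached to a string, non-intersecting: no two cups cross, and no string point lies strictly between the endpoints of a cup. $s(w)$ is the number of strings of $w$. $TL_\infty(\delta)$ acts on the span of all infinite link states by concatenation: $e_iw=0$ if $i,i+1$ are both strings; $e_iw=\delta w$ if $i,i+1$ are joined; if exactly one of $i,i+1$ is a string and the other is joined to $b$, then $e_iw$ has cup $\{i,i+1\}$ and $b$ a string; if $i$ is joined to $a\neq i+1$ and $i+1$ to $b$, these cups are replaced by $\{i,i+1\},\{a,b\}$. $\mathcal{X}(w)$ is the subrepresentation generated by $w$. Two infinite link states differ at only finitely many points if only finitely many points have different connections in them. A cup joining $k,k+1$ is a simple cup at $k$. Let $l$ be the smallest positive integer with $q^{2l}=1$. Infinite link states $w,z$ differing at only finitely many points with $s(z)<s(w)$ both finite form a symmetric pair if $s(w)+1=kl+d$ and $s(z)+1=kl-d$ for some $k\ge1$, $0<d<l$. In that case there is a homomorphism, unique up to scalar, $0\ne\phi:\mathcal{X}(w)\to\mathcal{X}(z)$, which sends each link state $x$ to a linear combination of link states obtained from $x$ by joining $s(w)-s(z)$ of its strings in pairs by non-crossing cups. For the symmetric pair $w,w'$ let $\phi:\mathcal{X}(w)\to\mathcal{X}(w')$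 be this map and define $\tilde e_k:\mathcal{X}(w)\to\mathcal{X}(w')$ on link states $x$ as follows: if $k,k+1$ are both strings of $x$, then $\tilde e_kx$ is the sum of those terms of $\phi(x)$ (with their coefficients) whose link state has a simple cup at $k$; otherwise $\tilde e_kx=0$. The maps $\tilde e'_k:\mathcal{X}(w')\to\mathcal{X}(w'')$ are defined in the same way from the symmetric pair $w',w''$. *)

theory Defs
  imports Complex_Main "HOL-Library.Poly_Mapping" "HOL-Library.Product_Plus"
begin

section \<open>The algebra \<open>TL\<^sub>\<infinity>(\<delta>)\<close>\<close>

text \<open>
  Points and generators are numbered from \<open>0\<close>, so that the generator \<open>i\<close> acts on the
  points \<open>i\<close> and \<open>i + 1\<close>; the usual numbering from \<open>1\<close> is recovered by a shift.

  With concatenation as the monoid operation on words, the convolution product of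
  \<^theory>\<open>HOL-Library.Poly_Mapping\<close> makes \<open>nat list \<Rightarrow>\<^sub>0 complex\<close> the free unital associative
  algebra on \<open>e 0, e 1, \<dots>\<close>.
\<close>

instantiation list :: (type) monoid_add
begin

definition zero_list :: "'a list" where "zero_list = []"

definition plus_list :: "'a list \<Rightarrow> 'a list \<Rightarrow> 'a list" where "plus_list = (@)"

instance by standard (simp_all add: zero_list_def plus_list_def)

end

type_synonym free_alg = "nat list \<Rightarrow>\<^sub>0 complex"

definition pscale :: "complex \<Rightarrow> ('a \<Rightarrow>\<^sub>0 complex) \<Rightarrow> 'a \<Rightarrow>\<^sub>0 complex" where
  "pscale c = Poly_Mapping.map ((*) c)"

definition gen :: "nat \<Rightarrow> free_alg" where
  "gen i = Poly_Mapping.single [i] 1"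

inductive_set TL_relators :: "complex \<Rightarrow> free_alg set" for \<delta> where
  "gen i * gen i - pscale \<delta> (gen i) \<in> TL_relators \<delta>"
| "gen i * gen (i + 1) * gen i - gen i \<in> TL_relators \<delta>"
| "gen (i + 1) * gen i * gen (i + 1) - gen (i + 1) \<in> TL_relators \<delta>"
| "\<bar>int i - int j\<bar> > 1 \<Longrightarrow> gen i * gen j - gen j * gen i \<in> TL_relators \<delta>"

text \<open>
  The two-sided ideal generated by the relators: \<open>TL\<^sub>\<infinity>(\<delta>)\<close> is the quotient of the free
  algebra by it, and elements of \<open>TL\<^sub>\<infinity>(\<delta>)\<close> are written below through representatives.
\<close>

inductive_set TL_ideal :: "complex \<Rightarrow> free_alg set" for \<delta> where
  relator: "r \<in> TL_relators \<delta> \<Longrightarrow> a * r * b \<in> TL_ideal \<delta>"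
| add: "r \<in> TL_ideal \<delta> \<Longrightarrow> s \<in> TL_ideal \<delta> \<Longrightarrow> r + s \<in> TL_ideal \<delta>"


section \<open>Representations of \<open>TL\<^sub>\<infinity>(\<delta>)\<close>\<close>

record 'v rep =
  space :: "'v set"
  smult :: "complex \<Rightarrow> 'v \<Rightarrow> 'v"
  act :: "free_alg \<Rightarrow> 'v \<Rightarrow> 'v"

definition lin_on :: "('u::ab_group_add, 'a) rep_scheme \<Rightarrow> ('v::ab_group_add, 'b) rep_scheme
    \<Rightarrow> ('u \<Rightarrow> 'v) \<Rightarrow> bool" where
  "lin_on R S f \<longleftrightarrow>
     (\<forall>u\<in>space R. f u \<in> space S) \<and>
     (\<forall>u\<in>space R. \<forall>v\<in>space R. f (u + v) = f u + f v) \<and>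
     (\<forall>c. \<forall>u\<in>space R. f (smult R c u) = smult S c (f u))"

text \<open>
  A unital algebra homomorphism from the free algebra to the endomorphisms of the space,
  vanishing on the ideal, i.e. one from \<open>TL\<^sub>\<infinity>(\<delta>)\<close>.
\<close>

definition TL_rep :: "complex \<Rightarrow> ('v::ab_group_add, 'b) rep_scheme \<Rightarrow> bool" where
  "TL_rep \<delta> R \<longleftrightarrow>
     vector_space (smult R) \<and> module.subspace (smult R) (space R) \<and>
     (\<forall>a. lin_on R R (act R a)) \<and>
     (\<forall>v\<in>space R.
        act R 1 v = v \<and>
        (\<forall>a b. act R (a + b) v = act R a v + act R b v) \<and>
        (\<forall>c a. act R (pscale c a) v = smult R c (act R a v)) \<and>
        (\<forall>a b. act R (a * b) v = act R a (act R b v)) \<and>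
        (\<forall>a\<in>TL_ideal \<delta>. act R a v = 0))"

definition rep_hom :: "('u::ab_group_add, 'a) rep_scheme \<Rightarrow> ('v::ab_group_add, 'b) rep_scheme
    \<Rightarrow> ('u \<Rightarrow> 'v) \<Rightarrow> bool" where
  "rep_hom R S f \<longleftrightarrow> lin_on R S f \<and> (\<forall>a. \<forall>v\<in>space R. f (act R a v) = act S a (f v))"

definition subrep :: "('v::ab_group_add, 'b) rep_scheme \<Rightarrow> 'v set \<Rightarrow> bool" where
  "subrep R U \<longleftrightarrow>
     U \<subseteq> space R \<and> module.subspace (smult R) U \<and> (\<forall>a. \<forall>u\<in>U. act R a u \<in> U)"

definition generated_subrep :: "'v::ab_group_add rep \<Rightarrow> 'v \<Rightarrow> 'v rep" where
  "generated_subrep R v = R\<lparr>space := \<Inter>{U. subrep R U \<and> v \<in> U}\<rparr>"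

definition short_exact :: "complex \<Rightarrow> 'u::ab_group_add rep \<Rightarrow> ('u \<Rightarrow> 'e) \<Rightarrow> 'e::ab_group_add rep
    \<Rightarrow> ('e \<Rightarrow> 'v) \<Rightarrow> 'v::ab_group_add rep \<Rightarrow> bool" where
  "short_exact \<delta> R \<iota> E \<pi> S \<longleftrightarrow>
     TL_rep \<delta> R \<and> TL_rep \<delta> E \<and> TL_rep \<delta> S \<and> rep_hom R E \<iota> \<and> rep_hom E S \<pi> \<and>
     inj_on \<iota> (space R) \<and> \<iota> ` space R = {x\<in>space E. \<pi> x = 0} \<and> \<pi> ` space E = space S"

definition splits :: "'e::ab_group_add rep \<Rightarrow> ('e \<Rightarrow> 'v) \<Rightarrow> 'v::ab_group_add rep \<Rightarrow> bool" where
  "splits E \<pi> S \<longleftrightarrow> (\<exists>\<sigma>. rep_hom S E \<sigma> \<and> (\<forall>v\<in>space S. \<pi> (\<sigma> v) = v))"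

definition nonsplit_extension :: "complex \<Rightarrow> 'u::ab_group_add rep \<Rightarrow> ('u \<Rightarrow> 'e)
    \<Rightarrow> 'e::ab_group_add rep \<Rightarrow> ('e \<Rightarrow> 'v) \<Rightarrow> 'v::ab_group_add rep \<Rightarrow> bool" where
  "nonsplit_extension \<delta> R \<iota> E \<pi> S \<longleftrightarrow> short_exact \<delta> R \<iota> E \<pi> S \<and> \<not> splits E \<pi> S"

text \<open>The action of the free algebra determined by operators \<open>T i\<close> for the generators.\<close>

definition gen_act :: "(complex \<Rightarrow> 'v \<Rightarrow> 'v) \<Rightarrow> (nat \<Rightarrow> 'v \<Rightarrow> 'v) \<Rightarrow> free_alg \<Rightarrow> 'v
    \<Rightarrow> 'v::ab_group_add" where
  "gen_act s T a v = (\<Sum>u\<in>Poly_Mapping.keys a. s (Poly_Mapping.lookup a u) (foldr T u v))"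


section \<open>Infinite link states\<close>

text \<open>
  A link state is encoded by the involution sending an endpoint of a cup to the other
  endpoint; its fixed points are the points attached to strings.
\<close>

definition is_link_state :: "(nat \<Rightarrow> nat) \<Rightarrow> bool" where
  "is_link_state f \<longleftrightarrow>
     (\<forall>i. f (f i) = i) \<and>
     (\<forall>i j. \<not> (i < j \<and> j < f i \<and> f i < f j)) \<and>
     (\<forall>i j. i < j \<and> j < f i \<longrightarrow> f j \<noteq> j)"

typedef link_state = "Collect is_link_state" morphisms partner Link_State
  by (rule exI[of _ id]) (simp add: is_link_state_def)

setup_lifting type_definition_link_state

definition strings :: "link_state \<Rightarrow> nat set" where
  "strings w = {i. partner w i = i}"

definition num_strings :: "link_state \<Rightarrow> nat" where
  "num_strings w = card (strings w)"

definition finitely_differ :: "link_state \<Rightarrow> link_state \<Rightarrow> bool" where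
  "finitely_differ w z \<longleftrightarrow> finite {i. partner w i \<noteq> partner z i}"

definition simple_cup :: "nat \<Rightarrow> link_state \<Rightarrow> bool" where
  "simple_cup k w \<longleftrightarrow> partner w k = k + 1"

definition strings_at :: "nat \<Rightarrow> link_state \<Rightarrow> bool" where
  "strings_at k w \<longleftrightarrow> k \<in> strings w \<and> k + 1 \<in> strings w"

text \<open>
  Join \<open>i, i + 1\<close> by a cup and connect to each other whatever they were connected to before:
  two former partners become joined, and a former partner facing a string becomes a string.
\<close>

definition reconnect :: "nat \<Rightarrow> (nat \<Rightarrow> nat) \<Rightarrow> nat \<Rightarrow> nat" where
  "reconnect i f p =
     (if p = i then i + 1
      else if p = i + 1 then i
      else if p = f i then (if f (i + 1) = i + 1 then p else f (i + 1))
      else if p = f (i + 1) then (if f i = i then p else f i)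
      else f p)"

lemma is_link_state_reconnect:
  assumes "is_link_state f"
  shows "is_link_state (reconnect i f)"
proof -
  have inv: "f (f p) = p" for p
    using assms by (simp add: is_link_state_def)
  have nc: "\<not> (p < r \<and> r < f p \<and> f p < f r)" for p r
    using assms by (simp add: is_link_state_def)
  have ns: "p < r \<Longrightarrow> r < f p \<Longrightarrow> f r \<noteq> r" for p r
    using assms by (simp add: is_link_state_def)
  define g where "g = reconnect i f"
  have inner: "p < f r \<and> f r < f p \<and> f r \<noteq> r" if "p < r" "r < f p" for p r
  proof -
    have "f r \<noteq> p" "f r \<noteq> f p"
      using inv[of r] inv[of p] that by auto
    then show ?thesis
      using nc[of p r] nc[of "f r" p] ns[of p r] inv[of r] that by auto
  qed
  have g_inv: "g (g p) = p" for p
  proof -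
    have "f p = i \<longleftrightarrow> p = f i" "f p = i + 1 \<longleftrightarrow> p = f (i + 1)" "f p = f i \<longleftrightarrow> p = i"
      "f p = f (i + 1) \<longleftrightarrow> p = i + 1"
      using inv by metis+
    moreover have "f i = i + 1 \<longleftrightarrow> f (i + 1) = i"
      using inv by metis
    ultimately show ?thesis
      unfolding g_def reconnect_def using inv[of i] inv[of "i + 1"] inv[of p] by auto
  qed
  have key: "g r \<noteq> r \<and> g r < g p" if pr: "p < r" "r < g p" for p r
  proof -
    define a b where "a = f i" and "b = f (i + 1)"
    have ab: "f i = a" "f (i + 1) = b" "f a = i" "f b = i + 1"
      by (simp_all add: a_def b_def inv)
    have g_eq: "g x = (if x = i then i + 1 else if x = i + 1 then i
        else if x = a then (if b = i + 1 then x else b)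
        else if x = b then (if a = i then x else a) else f x)" for x
      by (simp add: g_def reconnect_def a_def b_def)
    have eqs: "f x = i \<longleftrightarrow> x = a" "f x = i + 1 \<longleftrightarrow> x = b" "f x = a \<longleftrightarrow> x = i" "f x = b \<longleftrightarrow> x = i + 1" for x
      using inv a_def b_def by metis+
    have i1: "i < x \<Longrightarrow> x < a \<Longrightarrow> i < f x \<and> f x < a \<and> f x \<noteq> x" for x
      using inner[of i x] ab by auto
    have i2: "i + 1 < x \<Longrightarrow> x < b \<Longrightarrow> i + 1 < f x \<and> f x < b \<and> f x \<noteq> x" for x
      using inner[of "i + 1" x] ab by auto
    have i3: "a < x \<Longrightarrow> x < i \<Longrightarrow> a < f x \<and> f x < i \<and> f x \<noteq> x" for x
      using inner[of a x] ab by auto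
    have i4: "b < x \<Longrightarrow> x < i + 1 \<Longrightarrow> b < f x \<and> f x < i + 1 \<and> f x \<noteq> x" for x
      using inner[of b x] ab by auto
    have abi: "\<not> (a < b \<and> b < i)"
      using i3[of b] ab by auto
    have ai: "a = i + 1 \<longleftrightarrow> b = i" "a \<noteq> b"
      using ab inv[of i] inv[of "i + 1"] by auto
    consider "p = i" | "p = i + 1" | "p = a" "p \<noteq> i" "p \<noteq> i + 1" | "p = b" "p \<noteq> a" "p \<noteq> i" "p \<noteq> i + 1"
      | "p \<noteq> i" "p \<noteq> i + 1" "p \<noteq> a" "p \<noteq> b" by blast
    then show ?thesis
    proof cases
      case 1 then show ?thesis using pr g_eq[of p] by simp
    next
      case 2 then show ?thesis using pr g_eq[of p] by simp
    next
      case 3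
      have gp: "g p = b" "b \<noteq> i + 1" using pr g_eq[of p] 3 by (auto split: if_splits)
      then have abr: "a < r" "r < b" using pr 3 by auto
      consider "r = i" | "r = i + 1" | "r < i" | "i + 1 < r" by linarith
      then show ?thesis
      proof cases
        case 1 then show ?thesis using g_eq[of r] gp abr by auto
      next
        case 2 then show ?thesis using g_eq[of r] gp abr by auto
      next
        case r: 3 then have "g r = f r" using g_eq[of r] abr by auto
        moreover have "f r < i" "f r \<noteq> r" using i3[of r] r abr by auto
        moreover have "i < b" using abi ai r abr by (metis less_trans linorder_neqE_nat not_add_less1 not_less_iff_gr_or_eq)
        ultimately show ?thesis using gp by auto
      next
        case r: 4 then have "g r = f r" using g_eq[of r] abr by auto
        moreover have "f r < b \<and> f r \<noteq> r" using i2[of r] r abr by auto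
        ultimately show ?thesis using gp by auto
      qed
    next
      case 4
      have gp: "g p = a" "a \<noteq> i" using pr g_eq[of p] 4 by (auto split: if_splits)
      then have abr: "b < r" "r < a" using pr 4 by auto
      consider "r = i" | "r = i + 1" | "r < i" | "i + 1 < r" by linarith
      then show ?thesis
      proof cases
        case 1 then show ?thesis using g_eq[of r] gp abr ai 4 by auto
      next
        case 2 then show ?thesis using g_eq[of r] gp abr by auto
      next
        case r: 3 then have "g r = f r" using g_eq[of r] abr by auto
        moreover have "f r \<noteq> a" "f r \<noteq> i" using eqs[of r] r abr by auto
        moreover have "b < f r" "f r < i + 1" "f r \<noteq> r" using i4[of r] r abr by auto
        moreover have "\<not> (a < f r \<and> f r < i)" using i3[of "f r"] inv[of r] abr by auto
        ultimately show ?thesis using gp by auto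
      next
        case r: 4 then have gr: "g r = f r" using g_eq[of r] abr by auto
        moreover have "i < f r \<and> f r < a \<and> f r \<noteq> r" using i1[of r] r abr by auto
        ultimately show ?thesis using gp by auto
      qed
    next
      case 5
      have gp: "g p = f p" using g_eq[of p] 5 by simp
      have q: "p < f x \<and> f x < f p \<and> f x \<noteq> x" if "p < x" "x < f p" for x
        using inner that by blast
      have pin: "p < r" "r < f p" using pr gp by auto
      have ne: "f p \<noteq> i" "f p \<noteq> i + 1" using 5 eqs[of p] by auto
      have both: "p < i \<and> i + 1 < f p" if "p < i \<and> i < f p \<or> p < i + 1 \<and> i + 1 < f p"
        using that ne 5 by auto
      consider "r = i" | "r = i + 1" | "r = a" "r \<noteq> i" "r \<noteq> i + 1" | "r = b" "r \<noteq> a" "r \<noteq> i" "r \<noteq> i + 1"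
        | "r \<noteq> i" "r \<noteq> i + 1" "r \<noteq> a" "r \<noteq> b" by blast
      then show ?thesis
      proof cases
        case 1 then show ?thesis using g_eq[of r] gp pin both by auto
      next
        case 2 then show ?thesis using g_eq[of r] gp pin both by auto
      next
        case r: 3
        have pii: "p < i \<and> i + 1 < f p" using q[of r] pin both r ab by auto
        then have "b \<noteq> i + 1" using q[of "i + 1"] ab by auto
        then have "g r = b" using g_eq[of r] r by auto
        then show ?thesis using q[of "i + 1"] pii ab gp r ai by auto
      next
        case r: 4
        have pii: "p < i \<and> i + 1 < f p" using q[of r] pin both r ab by auto
        then have "a \<noteq> i" using q[of "i"] ab by auto
        then have "g r = a" using g_eq[of r] r by auto
        then show ?thesis using q[of "i"] pii ab gp r ai by auto
      next
        case r: 5 then have "g r = f r" using g_eq[of r] by auto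
        then show ?thesis using q[of r] pin gp by auto
      qed
    qed
  qed
  show ?thesis
    unfolding is_link_state_def g_def[symmetric] using g_inv key by (metis less_asym)
qed
lift_definition join_at :: "nat \<Rightarrow> link_state \<Rightarrow> link_state" is reconnect
  by (simp add: is_link_state_reconnect)

type_synonym link_space = "link_state \<Rightarrow>\<^sub>0 complex"

abbreviation basis :: "link_state \<Rightarrow> link_space" where
  "basis w \<equiv> Poly_Mapping.single w 1"

definition lin_ext :: "(link_state \<Rightarrow> link_space) \<Rightarrow> link_space \<Rightarrow> link_space" where
  "lin_ext f v = (\<Sum>x\<in>Poly_Mapping.keys v. pscale (Poly_Mapping.lookup v x) (f x))"

definition e_op :: "complex \<Rightarrow> nat \<Rightarrow> link_space \<Rightarrow> link_space" where
  "e_op \<delta> i = lin_ext (\<lambda>w.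
     if strings_at i w then 0
     else if simple_cup i w then pscale \<delta> (basis w)
     else basis (join_at i w))"

definition link_rep :: "complex \<Rightarrow> link_space rep" where
  "link_rep \<delta> = \<lparr>space = UNIV, smult = pscale, act = gen_act pscale (e_op \<delta>)\<rparr>"

definition X_rep :: "complex \<Rightarrow> link_state \<Rightarrow> link_space rep" where
  "X_rep \<delta> w = generated_subrep (link_rep \<delta>) (basis w)"


section \<open>Symmetric pairs and the extensions\<close>

definition root_order :: "complex \<Rightarrow> nat" where
  "root_order q = (LEAST l. 0 < l \<and> q ^ (2 * l) = 1)"

definition symmetric_pair :: "complex \<Rightarrow> link_state \<Rightarrow> link_state \<Rightarrow> bool" where
  "symmetric_pair q w z \<longleftrightarrow>
     finitely_differ w z \<and> finite (strings w) \<and> finite (strings z) \<and>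
     num_strings z < num_strings w \<and>
     (\<exists>k d. 1 \<le> k \<and> 0 < d \<and> d < root_order q \<and>
        num_strings w + 1 = k * root_order q + d \<and>
        num_strings z + 1 = k * root_order q - d)"

text \<open>\<open>z\<close> is obtained from \<open>x\<close> by joining \<open>n\<close> of its strings in pairs; non-crossing because
  \<open>z\<close> is a link state.\<close>

definition joins_strings :: "nat \<Rightarrow> link_state \<Rightarrow> link_state \<Rightarrow> bool" where
  "joins_strings n x z \<longleftrightarrow>
     (\<exists>A\<subseteq>strings x. finite A \<and> card A = n \<and>
        (\<forall>i\<in>A. partner z i \<in> A \<and> partner z i \<noteq> i) \<and>
        (\<forall>i. i \<notin> A \<longrightarrow> partner z i = partner x i))"

definition pair_hom :: "complex \<Rightarrow> link_state \<Rightarrow> link_state \<Rightarrow> (link_space \<Rightarrow> link_space) \<Rightarrow> bool"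
  where
  "pair_hom \<delta> w z \<phi> \<longleftrightarrow>
     rep_hom (X_rep \<delta> w) (X_rep \<delta> z) \<phi> \<and>
     (\<exists>v\<in>space (X_rep \<delta> w). \<phi> v \<noteq> 0) \<and>
     (\<forall>x. basis x \<in> space (X_rep \<delta> w) \<longrightarrow>
        (\<forall>y\<in>Poly_Mapping.keys (\<phi> (basis x)). joins_strings (num_strings w - num_strings z) x y))"

definition simple_cup_part :: "nat \<Rightarrow> link_space \<Rightarrow> link_space" where
  "simple_cup_part k v =
     (\<Sum>y\<in>{y\<in>Poly_Mapping.keys v. simple_cup k y}. Poly_Mapping.single y (Poly_Mapping.lookup v y))"

definition e_tilde :: "(link_space \<Rightarrow> link_space) \<Rightarrow> nat \<Rightarrow> link_space \<Rightarrow> link_space" where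
  "e_tilde \<phi> k = lin_ext (\<lambda>x. if strings_at k x then simple_cup_part k (\<phi> (basis x)) else 0)"

definition twisted_sum :: "complex \<Rightarrow> link_space rep \<Rightarrow> link_space rep
    \<Rightarrow> (nat \<Rightarrow> link_space \<Rightarrow> link_space) \<Rightarrow> (link_space \<times> link_space) rep" where
  "twisted_sum \<delta> R S T =
     (let s = (\<lambda>c (v, x). (pscale c v, pscale c x))
      in \<lparr>space = space R \<times> space S, smult = s,
          act = gen_act s (\<lambda>k (v, x). (e_op \<delta> k v + T k x, e_op \<delta> k x))\<rparr>)"

definition P_rep :: "complex \<Rightarrow> link_state \<Rightarrow> link_state \<Rightarrow> (link_space \<Rightarrow> link_space)
    \<Rightarrow> (link_space \<times> link_space) rep" where
  "P_rep \<delta> w w' \<phi> = twisted_sum \<delta> (X_rep \<delta> w') (X_rep \<delta> w) (e_tilde \<phi>)"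

definition Q_rep :: "complex \<Rightarrow> link_state \<Rightarrow> link_state \<Rightarrow> (link_space \<Rightarrow> link_space)
    \<Rightarrow> (link_space \<Rightarrow> link_space) \<Rightarrow> (link_space \<times> link_space) rep" where
  "Q_rep \<delta> w w'' \<phi> \<phi>' =
     twisted_sum \<delta> (X_rep \<delta> w'') (X_rep \<delta> w) (\<lambda>k x. e_tilde \<phi>' k (\<phi> x))"

end

theory Submission
  imports Defs
begin

text \<open>
  The generator \<open>e k\<close> is an affine function of the loop parameter, and its slope is the projection
  \<open>s k\<close> onto the states with a simple cup at \<open>k\<close>, called \<open>simple_cup_part k\<close>. Since \<open>\<phi>\<close> joins
  strings and keeps cups, the twisting map \<open>e_tilde \<phi> k\<close> is the commutator
  \<open>s k \<circ> \<phi> - \<phi> \<circ> s k\<close> (\<open>e_tilde_commutator\<close>). Both twisted sums are therefore representations because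
  the relations of the algebra, which hold for every loop parameter, may be differentiated
  (\<open>deriv_square\<close>, \<open>deriv_next\<close>, \<open>deriv_commute\<close>, \<open>twisting_e_tilde\<close>, \<open>twisting_comp\<close>).

  A splitting is a linear map \<open>\<sigma>\<close> with \<open>\<sigma> (e k x) = e k (\<sigma> x) + T k x\<close>, where \<open>T\<close> is the
  twisting map. It is tested at one state: the moves between the states of a cyclic module are
  reversible (\<open>reach_sym\<close>), so \<open>\<X>(w)\<close> contains a state \<open>x0\<close> whose strings are exactly the
  first \<open>n = s(w)\<close> points (\<open>ex_strings_left\<close>), and \<open>u = \<phi> x0\<close> is nonzero
  (\<open>nonzero_on_basis\<close>). All \<open>e k\<close> with \<open>k + 1 < n\<close> kill \<open>x0\<close> and \<open>u\<close>. Both \<open>\<phi>\<close> and \<open>\<sigma>\<close>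
  keep the cups of \<open>x0\<close> (\<open>cups_preserved\<close>), so that everything happens on the first
  \<open>n\<close> points.

  There, link states are read as tensors in the \<open>n\<close>-th power of a plane with basis indexed by
  \<open>{0, 1}\<close>, whose coefficient at a set \<open>S\<close> of points is \<open>wt Q z n y S\<close>. The generators
  become caps followed by cups with loop value \<open>Q - z\<close> (\<open>wt_cap\<close>), and the states with
  \<open>d\<close> cups are linearly independent already on sets of \<open>d\<close> points (\<open>F_independent\<close>). A tensor
  killed by all caps is symmetric in the quantum sense, hence has only one free coefficient for
  each number of points (\<open>symmetric_value\<close>). The raising operator (\<open>wt_sum_initial\<close>) and its
  divided powers (\<open>wt_sum_all\<close>) respect the cups and act on symmetric tensors by
  quantum integers and Gaussian binomial coefficients, which is where the root of unity enters.

  For the first extension, \<open>s(w) + 1 = k l + d\<close> and \<open>u\<close> has \<open>d\<close> cups. Writing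
  \<open>v = \<sigma> x0\<close>, the splitting equation \<open>e k v = - s k u\<close> says that \<open>u + \<epsilon> v\<close> is killed
  by the generators with loop parameter \<open>\<delta> + \<epsilon>\<close>, \<open>\<epsilon>\<^sup>2 = 0\<close>. Applied to its tensor at \<open>d - 1\<close>
  points, the raising operator gives zero, since \<open>d - 1\<close> points miss one of \<open>d\<close> cups; it
  also gives the quantum integer \<open>[k l]\<close> times the coefficient at \<open>d\<close> points. This quantum
  integer vanishes at \<open>q\<close>, but only to first order (\<open>dual_geometric_sum\<close>), so the coefficient
  of \<open>u\<close> at \<open>d\<close> points is zero and \<open>u = 0\<close>, a contradiction (\<open>no_first_order_lift\<close>).

  For the second extension, \<open>w'\<close> has \<open>2 d\<close> and \<open>w''\<close> has \<open>2 l\<close> strings fewer than \<open>w\<close>, and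
  \<open>k \<ge> 2\<close>. On sets of \<open>l\<close> points, \<open>\<phi>'\<close> multiplies coefficients by a constant
  \<open>\<gamma> \<noteq> 0\<close> (\<open>scaling\<close>). So \<open>\<gamma> u - \<epsilon> v\<close> has a symmetric
  coefficient function on these sets. It is annihilated by a Gaussian binomial coefficient that
  equals \<open>k\<close> up to a unit (\<open>subset_sum_root_of_unity\<close>), hence it is zero. The
  raising operator then shows that \<open>u\<close> has coefficient zero at \<open>l - 1\<close> points, by the first-order
  zero of \<open>[(k - 1) l]\<close>, and, step by step, at all numbers of points down to \<open>d\<close>, by
  quantum integers that do not vanish. Again \<open>u = 0\<close> (\<open>no_second_lift\<close>).
\<close>

section \<open>Finitely supported functions and the free algebra\<close>

abbreviation supp :: "('a \<Rightarrow>\<^sub>0 complex) \<Rightarrow> 'a set" where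
  "supp \<equiv> Poly_Mapping.keys"

abbreviation coeff :: "('a \<Rightarrow>\<^sub>0 complex) \<Rightarrow> 'a \<Rightarrow> complex" where
  "coeff \<equiv> Poly_Mapping.lookup"

lemma lookup_pscale [simp]: "coeff (pscale c v) x = c * coeff v x"
  unfolding pscale_def by (simp add: Poly_Mapping.map.rep_eq when_def)

lemma pscale_add: "pscale c (u + v) = pscale c u + pscale c v"
  by (rule poly_mapping_eqI) (simp add: lookup_add algebra_simps)

lemma pscale_add_left: "pscale (c + d) v = pscale c v + pscale d v"
  by (rule poly_mapping_eqI) (simp add: lookup_add algebra_simps)

lemma pscale_pscale: "pscale c (pscale d v) = pscale (c * d) v"
  by (rule poly_mapping_eqI) simp

lemma pscale_simps [simp]:
  "pscale 1 v = v" "pscale 0 v = 0" "pscale c 0 = 0"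
  "pscale c (- v) = - pscale c v" "pscale c (u - v) = pscale c u - pscale c v"
  by (rule poly_mapping_eqI, simp add: lookup_minus algebra_simps)+

lemma pscale_single [simp]: "pscale c (Poly_Mapping.single x a) = Poly_Mapping.single x (c * a)"
  by (rule poly_mapping_eqI) (simp add: lookup_single when_def)

lemma vector_space_pscale: "vector_space pscale"
  by unfold_locales (simp_all add: pscale_add pscale_add_left pscale_pscale)

lemma module_pscale: "module pscale"
  by unfold_locales (simp_all add: pscale_add pscale_add_left pscale_pscale)

lemma keys_pscale: "supp (pscale c v) \<subseteq> supp v"
  by (auto simp: in_keys_iff)

lemma lookup_sum_pm: "coeff (sum f A) x = (\<Sum>a\<in>A. coeff (f a) x)"
  by (induction A rule: infinite_finite_induct) (simp_all add: lookup_add)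

lemma lookup_lin_ext:
  "coeff (lin_ext f v) y
     = (\<Sum>x\<in>supp v. coeff v x * coeff (f x) y)"
  by (simp add: lin_ext_def lookup_sum_pm)

lemma sum_keys_superset:
  assumes "finite A" "supp v \<subseteq> A" "\<And>x. h x 0 = 0"
  shows "(\<Sum>x\<in>supp v. h x (coeff v x)) = (\<Sum>x\<in>A. h x (coeff v x))"
  using assms by (intro sum.mono_neutral_left) (auto simp: in_keys_iff)

lemma sum_keys_pscale:
  fixes h :: "'a \<Rightarrow> complex \<Rightarrow> 'b::comm_monoid_add"
  assumes "\<And>x. h x 0 = 0"
  shows "(\<Sum>x\<in>supp (pscale c v). h x (coeff (pscale c v) x))
    = (\<Sum>x\<in>supp v. h x (c * coeff v x))"
  using sum_keys_superset[OF finite_keys keys_pscale, of h c v] assms by simp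

lemma lin_ext_add: "lin_ext f (u + v) = lin_ext f u + lin_ext f v"
  unfolding lin_ext_def
  by (rule setsum_keys_plus_distrib) (simp_all add: pscale_add_left)

lemma lin_ext_pscale: "lin_ext f (pscale c v) = pscale c (lin_ext f v)"
  unfolding lin_ext_def
  by (subst sum_keys_pscale)
     (simp_all add: pscale_pscale[symmetric] module.scale_sum_right[OF module_pscale])

lemma lin_ext_zero [simp]: "lin_ext f 0 = 0"
  by (simp add: lin_ext_def)

lemma lin_ext_basis [simp]: "lin_ext f (basis x) = f x"
  by (simp add: lin_ext_def)

lemma pm_expand: "(v :: 'a \<Rightarrow>\<^sub>0 complex)
  = (\<Sum>x\<in>supp v. pscale (coeff v x) (Poly_Mapping.single x 1))"
  by (rule poly_mapping_eqI) (auto simp: lookup_sum_pm lookup_single when_def in_keys_iff)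

lemma linear_eqI:
  fixes f g :: "('a \<Rightarrow>\<^sub>0 complex) \<Rightarrow> 'v::ab_group_add" and s :: "complex \<Rightarrow> 'v \<Rightarrow> 'v"
  assumes v: "supp v \<subseteq> B"
    and f: "\<And>u v. supp u \<subseteq> B \<Longrightarrow> supp v \<subseteq> B \<Longrightarrow> f (u + v) = f u + f v"
      "\<And>c u. supp u \<subseteq> B \<Longrightarrow> f (pscale c u) = s c (f u)"
    and g: "\<And>u v. supp u \<subseteq> B \<Longrightarrow> supp v \<subseteq> B \<Longrightarrow> g (u + v) = g u + g v"
      "\<And>c u. supp u \<subseteq> B \<Longrightarrow> g (pscale c u) = s c (g u)"
    and eq: "\<And>x. x \<in> B \<Longrightarrow> f (Poly_Mapping.single x 1) = g (Poly_Mapping.single x 1)"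
  shows "f v = g v"
proof -
  have f0: "f 0 = 0" using f(1)[of 0 0] by simp
  have g0: "g 0 = 0" using g(1)[of 0 0] by simp
  let ?t = "\<lambda>x. pscale (coeff v x) (Poly_Mapping.single x 1)"
  have "f (sum ?t A) = g (sum ?t A) \<and> supp (sum ?t A) \<subseteq> B"
    if "finite A" "A \<subseteq> B" for A
    using that
  proof (induction A)
    case empty
    then show ?case by (simp add: f0 g0)
  next
    case (insert x A)
    have k: "supp (?t x) \<subseteq> B" "supp (Poly_Mapping.single x (1::complex)) \<subseteq> B"
      using insert.prems by (auto split: if_splits)
    have "f (?t x) = g (?t x)"
      unfolding f(2)[OF k(2)] g(2)[OF k(2)] using eq[of x] insert.prems by simp
    moreover have "f (sum ?t A) = g (sum ?t A)" "supp (sum ?t A) \<subseteq> B"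
      using insert by blast+
    ultimately have "f (?t x + sum ?t A) = g (?t x + sum ?t A)"
      by (simp only: f(1)[OF k(1)] g(1)[OF k(1)])
    moreover have "supp (?t x + sum ?t A) \<subseteq> B"
      using k insert keys_add[of "?t x" "sum ?t A"] by (auto simp del: pscale_single)
    ultimately show ?case using insert.hyps by (simp del: pscale_single)
  qed
  from this[of "supp v"] v show ?thesis
    unfolding pm_expand[of v, symmetric] by simp
qed

lemma keys_lin_ext:
  "supp (lin_ext f v) \<subseteq> (\<Union>x\<in>supp v. supp (f x))"
proof
  fix y assume "y \<in> supp (lin_ext f v)"
  then have "(\<Sum>x\<in>supp v. coeff v x * coeff (f x) y) \<noteq> 0"
    by (simp add: in_keys_iff lookup_lin_ext)
  then obtain x where "x \<in> supp v" "coeff v x * coeff (f x) y \<noteq> 0"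
    by (rule sum.not_neutral_contains_not_neutral)
  then show "y \<in> (\<Union>x\<in>supp v. supp (f x))"
    by (auto simp: in_keys_iff)
qed

subsection \<open>Representations from generators and relations\<close>

lemma one_free_alg: "(1 :: free_alg) = Poly_Mapping.single [] 1"
  by (simp add: single_one[symmetric] zero_list_def)

text \<open>
  Operators on a subspace that satisfy the relations extend to a representation: the action of
  words is multiplicative by construction, and the ideal is spanned by multiples of relators.
\<close>

locale word_action = vector_space s for s :: "complex \<Rightarrow> 'v \<Rightarrow> 'v::ab_group_add" +
  fixes U :: "'v set" and T :: "nat \<Rightarrow> 'v \<Rightarrow> 'v"
  assumes sub: "subspace U"
    and closed: "v \<in> U \<Longrightarrow> T i v \<in> U"
    and add: "u \<in> U \<Longrightarrow> v \<in> U \<Longrightarrow> T i (u + v) = T i u + T i v"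
    and scale: "v \<in> U \<Longrightarrow> T i (s c v) = s c (T i v)"
begin

lemma word_closed: "v \<in> U \<Longrightarrow> foldr T u v \<in> U"
  by (induction u) (auto intro: closed)

lemma word_add: "v \<in> U \<Longrightarrow> w \<in> U \<Longrightarrow> foldr T u (v + w) = foldr T u v + foldr T u w"
  by (induction u) (auto simp: add word_closed)

lemma word_scale: "v \<in> U \<Longrightarrow> foldr T u (s c v) = s c (foldr T u v)"
  by (induction u) (auto simp: scale word_closed)

lemma word_zero: "foldr T u 0 = 0"
  using word_add[of 0 0 u] subspace_0[OF sub] by simp

lemma act_closed: "v \<in> U \<Longrightarrow> gen_act s T a v \<in> U"
  unfolding gen_act_def by (intro subspace_sum[OF sub] subspace_scale[OF sub] word_closed)

lemma act_add: "v \<in> U \<Longrightarrow> w \<in> U \<Longrightarrow> gen_act s T a (v + w) = gen_act s T a v + gen_act s T a w"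
  unfolding gen_act_def by (simp add: word_add scale_right_distrib sum.distrib)

lemma act_scale: "v \<in> U \<Longrightarrow> gen_act s T a (s c v) = s c (gen_act s T a v)"
  unfolding gen_act_def by (simp add: word_scale scale_sum_right mult.commute)

lemma act_zero: "gen_act s T a 0 = 0"
  unfolding gen_act_def by (simp add: word_zero)

lemma act_sum: "(\<And>x. x \<in> A \<Longrightarrow> h x \<in> U) \<Longrightarrow> gen_act s T a (sum h A) = (\<Sum>x\<in>A. gen_act s T a (h x))"
proof (induction A rule: infinite_finite_induct)
  case (insert x F)
  then show ?case by (simp add: act_add subspace_sum[OF sub])
qed (simp_all add: act_zero)

lemma act_plus: "gen_act s T (a + b) v = gen_act s T a v + gen_act s T b v"
  unfolding gen_act_def by (rule setsum_keys_plus_distrib) (simp_all add: scale_left_distrib)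

lemma act_single: "gen_act s T (Poly_Mapping.single u c) v = s c (foldr T u v)"
  unfolding gen_act_def by auto

lemma act_gen [simp]: "gen_act s T (gen i) v = T i v"
  by (simp add: gen_def act_single)

lemma act_pscale: "gen_act s T (pscale c a) v = s c (gen_act s T a v)"
  unfolding gen_act_def by (subst sum_keys_pscale) (simp_all add: scale_sum_right)

lemma act_0: "gen_act s T 0 v = 0"
  unfolding gen_act_def by simp

lemma act_minus: "gen_act s T (a - b) v = gen_act s T a v - gen_act s T b v"
  using act_plus[of "a - b" b v] by simp

lemma act_sum_left: "gen_act s T (sum h A) v = (\<Sum>x\<in>A. gen_act s T (h x) v)"
  by (induction A rule: infinite_finite_induct) (simp_all add: act_0 act_plus)

lemma act_mult:
  assumes v: "v \<in> U"
  shows "gen_act s T (a * b) v = gen_act s T a (gen_act s T b v)"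
proof -
  have single: "gen_act s T (Poly_Mapping.single u c * Poly_Mapping.single u' c') v
      = gen_act s T (Poly_Mapping.single u c) (gen_act s T (Poly_Mapping.single u' c') v)" for u u' c c'
    using v by (simp add: mult_single act_single plus_list_def word_scale word_closed)
  let ?e = "\<lambda>a x. Poly_Mapping.single x (coeff (a::free_alg) x)"
  have ex: "a = sum (?e a) (supp a)" for a :: free_alg
    using pm_expand[of a, symmetric] by simp
  have "gen_act s T (a * b) v
    = gen_act s T (\<Sum>x\<in>supp a. \<Sum>y\<in>supp b. ?e a x * ?e b y) v"
    using sum_product[of "?e a" "supp a" "?e b" "supp b"]
    unfolding ex[of a, symmetric] ex[of b, symmetric] by simp
  also have "\<dots> = (\<Sum>x\<in>supp a. \<Sum>y\<in>supp b.
      gen_act s T (?e a x) (gen_act s T (?e b y) v))"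
    by (simp add: act_sum_left single)
  also have "\<dots> = (\<Sum>x\<in>supp a. gen_act s T (?e a x) (gen_act s T b v))"
  proof (rule sum.cong[OF refl])
    fix x
    have "(\<Sum>y\<in>supp b. gen_act s T (?e b y) v) = gen_act s T b v"
      by (subst act_sum_left[symmetric]) (simp add: ex[symmetric])
    then show "(\<Sum>y\<in>supp b. gen_act s T (?e a x) (gen_act s T (?e b y) v))
        = gen_act s T (?e a x) (gen_act s T b v)"
      using v by (subst act_sum[symmetric]) (auto intro: act_closed)
  qed
  also have "\<dots> = gen_act s T a (gen_act s T b v)"
    by (subst act_sum_left[symmetric]) (simp add: ex[symmetric])
  finally show ?thesis .
qed

lemma TL_rep:
  assumes "\<And>i v. v \<in> U \<Longrightarrow> T i (T i v) = s \<delta> (T i v)"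
    and "\<And>i v. v \<in> U \<Longrightarrow> T i (T (i + 1) (T i v)) = T i v"
    and "\<And>i v. v \<in> U \<Longrightarrow> T (i + 1) (T i (T (i + 1) v)) = T (i + 1) v"
    and "\<And>i j v. v \<in> U \<Longrightarrow> \<bar>int i - int j\<bar> > 1 \<Longrightarrow> T i (T j v) = T j (T i v)"
  shows "TL_rep \<delta> \<lparr>space = U, smult = s, act = gen_act s T\<rparr>"
proof -
  have rel: "gen_act s T r v = 0" if "r \<in> TL_relators \<delta>" "v \<in> U" for r v
    using that by cases (use assms in \<open>simp_all add: act_minus act_mult act_pscale act_closed closed\<close>)
  have ideal: "gen_act s T a v = 0" if "a \<in> TL_ideal \<delta>" "v \<in> U" for a v
    using that by induction (simp_all add: act_mult act_closed rel act_zero act_plus)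
  show ?thesis
    unfolding TL_rep_def lin_on_def
    by (auto simp: sub vector_space_axioms act_closed act_add act_scale act_plus act_pscale
        act_mult ideal one_free_alg act_single)
qed

end

section \<open>Link states\<close>

lemma is_link_state_partner: "is_link_state (partner y)"
  using partner[of y] by simp

lemma partner_partner [simp]: "partner y (partner y p) = p"
  using is_link_state_partner[of y] by (simp add: is_link_state_def)

lemma partner_eq_iff [simp]: "partner y p = partner y r \<longleftrightarrow> p = r"
  by (metis partner_partner)

lemma below_cup:
  assumes "p < r" "r < partner y p"
  shows "p < partner y r" "partner y r < partner y p" "partner y r \<noteq> r"
proof -
  have nc: "\<not> (i < j \<and> j < partner y i \<and> partner y i < partner y j)" for i j
    using is_link_state_partner[of y] unfolding is_link_state_def by blast
  have ns: "i < j \<Longrightarrow> j < partner y i \<Longrightarrow> partner y j \<noteq> j" for i j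
    using is_link_state_partner[of y] unfolding is_link_state_def by blast
  have "partner y r \<noteq> p" "partner y r \<noteq> partner y p"
    using assms by (metis less_asym partner_partner, metis less_irrefl partner_partner)
  then show "p < partner y r" "partner y r < partner y p" "partner y r \<noteq> r"
    using nc[of p r] nc[of "partner y r" p] ns[of p r] assms
    by (metis linorder_neqE_nat partner_partner)+
qed

lemma link_state_eqI: "(\<And>p. partner x p = partner y p) \<Longrightarrow> x = y"
  using partner_inject by blast

lemma partner_join_at: "partner (join_at i y) p =
     (if p = i then i + 1
      else if p = i + 1 then i
      else if p = partner y i then (if partner y (i + 1) = i + 1 then p else partner y (i + 1))
      else if p = partner y (i + 1) then (if partner y i = i then p else partner y i)
      else partner y p)"
  by (simp add: join_at.rep_eq reconnect_def)

lemma simple_join_at [simp]: "simple_cup i (join_at i y)"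
  by (simp add: simple_cup_def partner_join_at)

lemma strings_iff: "p \<in> strings y \<longleftrightarrow> partner y p = p"
  by (simp add: strings_def)

lemma strings_at_iff: "strings_at i y \<longleftrightarrow> partner y i = i \<and> partner y (i + 1) = i + 1"
  by (simp add: strings_at_def strings_iff)

lemma simple_not_strings [simp]: "simple_cup i y \<Longrightarrow> \<not> strings_at i y"
  by (simp add: simple_cup_def strings_at_iff)

lemma join_at_simple: "simple_cup i y \<Longrightarrow> join_at i y = y"
  using partner_partner[of y i] unfolding simple_cup_def
  by (intro link_state_eqI) (auto simp: partner_join_at)

text \<open>
  The update of partners by a move, with abstract points in place of \<open>k, k + 1\<close>: relations between
  moves at distinct points then follow by pure equality reasoning, without arithmetic.
\<close>

definition rewire :: "nat \<Rightarrow> nat \<Rightarrow> (nat \<Rightarrow> nat) \<Rightarrow> nat \<Rightarrow> nat" where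
  "rewire i i' f p =
     (if p = i then i'
      else if p = i' then i
      else if p = f i then (if f i' = i' then p else f i')
      else if p = f i' then (if f i = i then p else f i)
      else f p)"

lemma partner_join_at_rewire: "partner (join_at i y) = rewire i (i + 1) (partner y)"
  by (simp add: fun_eq_iff partner_join_at rewire_def)

lemma rewire_next:
  assumes inv: "\<And>x. f (f x) = x" and d: "i \<noteq> i'" "i \<noteq> k" "i' \<noteq> k" and i: "f i = i'"
  shows "rewire i' k f i \<noteq> i \<or> rewire i' k f i' \<noteq> i'" "rewire i' k f i \<noteq> i'"
    "rewire i i' (rewire i' k f) p = f p"
    "rewire k i f i \<noteq> i \<or> rewire k i f i' \<noteq> i'" "rewire k i f i \<noteq> i'"
    "rewire i i' (rewire k i f) p = f p"
  using d i inv[of i] inv[of k] inv[of p] unfolding rewire_def by (smt (z3))+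

text \<open>
  A move next to a simple cup can be undone: the combinatorial form of
  \<open>e i * e (i \<plusminus> 1) * e i = e i\<close>.
\<close>

lemma join_next:
  assumes y: "simple_cup i y" and j: "j = i + 1 \<or> i = j + 1"
  shows "\<not> strings_at j y" "\<not> simple_cup j y" "\<not> strings_at i (join_at j y)"
    "\<not> simple_cup i (join_at j y)" "join_at i (join_at j y) = y"
proof -
  have i: "partner y i = i + 1" "partner y (i + 1) = i"
    using y partner_partner[of y i] by (simp_all add: simple_cup_def)
  show "\<not> strings_at j y" "\<not> simple_cup j y"
    using j i partner_partner[of y j] by (auto simp: strings_at_iff simple_cup_def simp del: partner_partner)
  have d: "i \<noteq> i + 1" "i \<noteq> i + 2" "i + 1 \<noteq> i + 2" by auto
  have d': "i \<noteq> i + 1" "i \<noteq> j" "i + 1 \<noteq> j" if "i = j + 1" using that by auto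
  note r = rewire_next[of "partner y" i "i + 1" "i + 2", OF partner_partner d i(1)]
  note r' = rewire_next[of "partner y" i "i + 1" j, OF partner_partner d' i(1)]
  show "\<not> strings_at i (join_at j y)" "\<not> simple_cup i (join_at j y)"
    using j r(1,2) r'(4,5) unfolding strings_at_iff simple_cup_def partner_join_at_rewire
    by (auto simp del: One_nat_def simp: add.assoc)
  show "join_at i (join_at j y) = y"
  proof (rule link_state_eqI)
    fix p
    show "partner (join_at i (join_at j y)) p = partner y p"
      using j
    proof
      assume "j = i + 1"
      then show ?thesis
        using r(3)[of p] unfolding partner_join_at_rewire by (simp add: add.assoc)
    next
      assume "i = j + 1"
      then show ?thesis
        using r'(6)[of p] unfolding partner_join_at_rewire by simp
    qed
  qed
qed

lemma rewire_commute:
  assumes inv: "\<And>x. f (f x) = x"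
    and d: "i \<noteq> i'" "i \<noteq> j" "i \<noteq> j'" "i' \<noteq> j" "i' \<noteq> j'" "j \<noteq> j'"
    and s: "f i \<noteq> i \<or> f i' \<noteq> i'" "f j \<noteq> j \<or> f j' \<noteq> j'"
  shows "rewire i i' (rewire j j' f) p = rewire j j' (rewire i i' f) p"
proof -
  obtain a a' b b' where f: "f i = a" "f i' = a'" "f j = b" "f j' = b'" by blast
  then have fi: "f a = i" "f a' = i'" "f b = j" "f b' = j'" using inv by blast+
  show ?thesis
    using d s unfolding rewire_def f
    using f fi by (smt (z3))
qed

lemma rewire_simple_commute:
  assumes inv: "\<And>x. f (f x) = x"
    and d: "i \<noteq> i'" "i \<noteq> j" "i \<noteq> j'" "i' \<noteq> j" "i' \<noteq> j'" "j \<noteq> j'"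
  shows "f i \<noteq> i' \<Longrightarrow> rewire j j' f i = i' \<Longrightarrow> rewire i i' f j = j'"
    and "f i = i' \<Longrightarrow> rewire j j' f i = i'"
    and "f i = i \<Longrightarrow> f i' = i' \<Longrightarrow> f j \<noteq> j \<or> f j' \<noteq> j' \<Longrightarrow> rewire j j' f i = i \<and> rewire j j' f i' = i'"
    and "f i \<noteq> i \<or> f i' \<noteq> i' \<Longrightarrow> rewire j j' f i = i \<Longrightarrow> rewire j j' f i' = i' \<Longrightarrow>
      rewire i i' f j = j \<and> rewire i i' f j' = j'"
  using d inv[of i] inv[of i'] inv[of j] inv[of j'] unfolding rewire_def by (smt (z3))+

lemma join_commute:
  assumes "\<bar>int i - int j\<bar> > 1" "\<not> strings_at i y" "\<not> strings_at j y"
  shows "join_at i (join_at j y) = join_at j (join_at i y)"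
proof (rule link_state_eqI)
  fix p
  show "partner (join_at i (join_at j y)) p = partner (join_at j (join_at i y)) p"
    unfolding partner_join_at_rewire
    by (rule rewire_commute) (use assms in \<open>auto simp: strings_at_iff\<close>)
qed

context
  fixes i j :: nat and y :: link_state
  assumes far: "\<bar>int i - int j\<bar> > 1"
begin

lemma far_neq: "i \<noteq> i + 1" "i \<noteq> j" "i \<noteq> j + 1" "i + 1 \<noteq> j" "i + 1 \<noteq> j + 1" "j \<noteq> j + 1"
  using far by auto

lemmas far_rewire = rewire_simple_commute[of "partner y" i "i + 1" j "j + 1", OF partner_partner far_neq]

lemma simple_commute: "\<not> simple_cup i y \<Longrightarrow> simple_cup i (join_at j y) \<Longrightarrow> simple_cup j (join_at i y)"
  using far_rewire(1) unfolding simple_cup_def partner_join_at_rewire by blast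

lemma far_simple: "simple_cup i y \<Longrightarrow> simple_cup i (join_at j y)"
  using far_rewire(2) unfolding simple_cup_def partner_join_at_rewire by blast

lemma far_strings: "strings_at i y \<Longrightarrow> \<not> strings_at j y \<Longrightarrow> strings_at i (join_at j y)"
  using far_rewire(3) unfolding strings_at_iff partner_join_at_rewire by blast

lemma strings_commute: "\<not> strings_at i y \<Longrightarrow> strings_at i (join_at j y) \<Longrightarrow> strings_at j (join_at i y)"
  using far_rewire(4) unfolding strings_at_iff partner_join_at_rewire by blast

end

section \<open>The action on link states\<close>

definition e_state :: "complex \<Rightarrow> nat \<Rightarrow> link_state \<Rightarrow> link_space" where
  "e_state \<delta> i w = (if strings_at i w then 0
     else if simple_cup i w then pscale \<delta> (basis w)
     else basis (join_at i w))"

lemma e_op_lin_ext: "e_op \<delta> i = lin_ext (e_state \<delta> i)"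
  unfolding e_op_def e_state_def ..

lemma e_op_basis: "e_op \<delta> i (basis w) = e_state \<delta> i w"
  by (simp add: e_op_lin_ext)

lemma e_op_add: "e_op \<delta> i (u + v) = e_op \<delta> i u + e_op \<delta> i v"
  by (simp add: e_op_lin_ext lin_ext_add)

lemma e_op_pscale: "e_op \<delta> i (pscale c v) = pscale c (e_op \<delta> i v)"
  by (simp add: e_op_lin_ext lin_ext_pscale)

lemma e_op_zero [simp]: "e_op \<delta> i 0 = 0"
  by (simp add: e_op_lin_ext)

lemma e_op_minus: "e_op \<delta> i (u - v) = e_op \<delta> i u - e_op \<delta> i v"
  using e_op_add[of \<delta> i "u - v" v] by simp

lemma link_space_eqI:
  assumes "\<And>u v. f (u + v) = f u + f v" "\<And>c u. f (pscale c u) = pscale c (f u)"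
    and "\<And>u v. g (u + v) = g u + g v" "\<And>c u. g (pscale c u) = pscale c (g u)"
    and "\<And>x. f (basis x) = g (basis x)"
  shows "f v = (g v :: link_space)"
  by (rule linear_eqI[where s = pscale and B = UNIV]) (use assms in auto)

lemma e_op_eqs:
  "strings_at i w \<Longrightarrow> e_op \<delta> i (basis w) = 0"
  "simple_cup i w \<Longrightarrow> e_op \<delta> i (basis w) = pscale \<delta> (basis w)"
  "\<not> strings_at i w \<Longrightarrow> \<not> simple_cup i w \<Longrightarrow> e_op \<delta> i (basis w) = basis (join_at i w)"
  by (auto simp: e_op_basis e_state_def)

lemma e_op_square: "e_op \<delta> i (e_op \<delta> i v) = pscale \<delta> (e_op \<delta> i v)"
proof (rule link_space_eqI[where f = "\<lambda>v. e_op \<delta> i (e_op \<delta> i v)" and g = "\<lambda>v. pscale \<delta> (e_op \<delta> i v)"])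
  fix w
  show "e_op \<delta> i (e_op \<delta> i (basis w)) = pscale \<delta> (e_op \<delta> i (basis w))"
    by (cases "strings_at i w"; cases "simple_cup i w") (simp_all add: e_op_eqs e_op_pscale del: pscale_single)
qed (simp_all add: e_op_add e_op_pscale pscale_add pscale_pscale mult.commute)

lemma e_op_next_simple:
  assumes "simple_cup i w" "j = i + 1 \<or> i = j + 1"
  shows "e_op \<delta> i (e_op \<delta> j (basis w)) = basis w"
  using join_next[OF assms] by (simp add: e_op_eqs)

lemma e_op_next:
  assumes "j = i + 1 \<or> i = j + 1"
  shows "e_op \<delta> i (e_op \<delta> j (e_op \<delta> i v)) = e_op \<delta> i v"
proof (rule link_space_eqI[where f = "\<lambda>v. e_op \<delta> i (e_op \<delta> j (e_op \<delta> i v))"])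
  fix w
  show "e_op \<delta> i (e_op \<delta> j (e_op \<delta> i (basis w))) = e_op \<delta> i (basis w)"
    by (cases "strings_at i w"; cases "simple_cup i w")
      (simp_all add: e_op_eqs e_op_pscale e_op_next_simple[OF _ assms] del: pscale_single)
qed (simp_all add: e_op_add e_op_pscale)

lemma e_op_commute_aux:
  assumes ij: "\<bar>int i - int j\<bar> > 1" and i: "strings_at i w \<or> simple_cup i w"
  shows "e_op \<delta> i (e_op \<delta> j (basis w)) = e_op \<delta> j (e_op \<delta> i (basis w))"
proof -
  consider "strings_at j w" | "simple_cup j w" | "\<not> strings_at j w" "\<not> simple_cup j w" by blast
  then show ?thesis
  proof cases
    case 3
    then have "strings_at i w \<Longrightarrow> strings_at i (join_at j w)" "simple_cup i w \<Longrightarrow> simple_cup i (join_at j w)"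
      using far_strings[OF ij] far_simple[OF ij] by blast+
    then show ?thesis
      using 3 i by (auto simp: e_op_eqs e_op_pscale simp del: pscale_single)
  qed (use i in \<open>auto simp: e_op_eqs e_op_pscale simp del: pscale_single\<close>)
qed

lemma e_op_commute:
  assumes ij: "\<bar>int i - int j\<bar> > 1"
  shows "e_op \<delta> i (e_op \<delta> j v) = e_op \<delta> j (e_op \<delta> i v)"
proof (rule link_space_eqI[where f = "\<lambda>v. e_op \<delta> i (e_op \<delta> j v)" and g = "\<lambda>v. e_op \<delta> j (e_op \<delta> i v)"])
  fix w
  have ji: "\<bar>int j - int i\<bar> > 1" using ij by simp
  show "e_op \<delta> i (e_op \<delta> j (basis w)) = e_op \<delta> j (e_op \<delta> i (basis w))"
  proof (cases "strings_at i w \<or> simple_cup i w \<or> strings_at j w \<or> simple_cup j w")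
    case True
    then show ?thesis
      using e_op_commute_aux[OF ij] e_op_commute_aux[OF ji] by metis
  next
    case False
    then have n: "\<not> strings_at i w" "\<not> simple_cup i w" "\<not> strings_at j w" "\<not> simple_cup j w"
      by auto
    have c: "strings_at i (join_at j w) \<longleftrightarrow> strings_at j (join_at i w)"
      "simple_cup i (join_at j w) \<longleftrightarrow> simple_cup j (join_at i w)"
      using strings_commute[OF ij n(1)] strings_commute[OF ji n(3)]
        simple_commute[OF ij n(2)] simple_commute[OF ji n(4)] by blast+
    have j: "join_at i (join_at j w) = join_at j (join_at i w)"
      by (rule join_commute[OF ij n(1,3)])
    consider "simple_cup i (join_at j w)" | "strings_at i (join_at j w)"
      | "\<not> simple_cup i (join_at j w)" "\<not> strings_at i (join_at j w)" by blast
    then show ?thesis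
    proof cases
      case 1
      then have "join_at j w = join_at i w"
        using c j join_at_simple by metis
      then show ?thesis using n 1 c by (simp add: e_op_eqs)
    qed (use n c j in \<open>simp_all add: e_op_eqs\<close>)
  qed
qed (simp_all add: e_op_add e_op_pscale)

subsection \<open>The derivative in the loop parameter\<close>

lemma lookup_simple_cup_part:
  "coeff (simple_cup_part k v) y = (if simple_cup k y then coeff v y else 0)"
  unfolding simple_cup_part_def
  by (auto simp: lookup_sum_pm lookup_single when_def in_keys_iff)

lemma simple_cup_part_add: "simple_cup_part k (u + v) = simple_cup_part k u + simple_cup_part k v"
  by (rule poly_mapping_eqI) (simp add: lookup_simple_cup_part lookup_add)

lemma simple_cup_part_pscale: "simple_cup_part k (pscale c v) = pscale c (simple_cup_part k v)"
  by (rule poly_mapping_eqI) (simp add: lookup_simple_cup_part)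

lemma simple_cup_part_basis: "simple_cup_part k (basis w) = (if simple_cup k w then basis w else 0)"
  by (rule poly_mapping_eqI) (simp add: lookup_simple_cup_part lookup_single when_def)

lemma simple_cup_part_zero [simp]: "simple_cup_part k 0 = 0"
  by (rule poly_mapping_eqI) (simp add: lookup_simple_cup_part)

lemma simple_cup_part_minus: "simple_cup_part k (u - v) = simple_cup_part k u - simple_cup_part k v"
  by (rule poly_mapping_eqI) (simp add: lookup_simple_cup_part lookup_minus)

text \<open>
  The operator \<open>e i\<close> is affine in the loop parameter with slope the projection onto the states
  with a simple cup at \<open>i\<close>, so the relations for all parameters can be differentiated.
\<close>

lemma e_op_shift: "e_op (\<delta> + h) i v = e_op \<delta> i v + pscale h (simple_cup_part i v)"
  by (rule link_space_eqI[where f = "e_op (\<delta> + h) i"])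
    (simp_all add: e_op_add e_op_pscale simple_cup_part_add simple_cup_part_pscale pscale_add
      e_op_basis e_state_def simple_cup_part_basis pscale_pscale pscale_add_left mult.commute
      del: pscale_single)

lemma simple_cup_part_idem [simp]: "simple_cup_part i (simple_cup_part i v) = simple_cup_part i v"
  by (rule poly_mapping_eqI) (simp add: lookup_simple_cup_part)

lemma double_eq: "v + v = w + w \<Longrightarrow> v = (w :: 'a \<Rightarrow>\<^sub>0 complex)"
  by (rule poly_mapping_eqI) (metis lookup_add mult_2 mult_cancel_left zero_neq_numeral)

lemma deriv_square:
  "simple_cup_part i (e_op \<delta> i v) + e_op \<delta> i (simple_cup_part i v)
     = pscale \<delta> (simple_cup_part i v) + e_op \<delta> i v"
proof -
  have "e_op (\<delta> + 1) i (e_op (\<delta> + 1) i v) = pscale (\<delta> + 1) (e_op (\<delta> + 1) i v)"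
    by (rule e_op_square)
  then show ?thesis
    using e_op_square[of \<delta> i v] unfolding e_op_shift
    by (simp add: e_op_add e_op_pscale simple_cup_part_add pscale_add pscale_add_left algebra_simps)
qed

lemma deriv_commute:
  assumes ij: "\<bar>int i - int j\<bar> > 1"
  shows "simple_cup_part i (e_op \<delta> j v) + e_op \<delta> i (simple_cup_part j v)
     = simple_cup_part j (e_op \<delta> i v) + e_op \<delta> j (simple_cup_part i v)"
proof -
  have "e_op (\<delta> + 1) i (e_op (\<delta> + 1) j v) = e_op (\<delta> + 1) j (e_op (\<delta> + 1) i v)"
    by (rule e_op_commute[OF ij])
  moreover have "simple_cup_part i (simple_cup_part j v) = simple_cup_part j (simple_cup_part i v)"
    by (rule poly_mapping_eqI) (simp add: lookup_simple_cup_part)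
  ultimately show ?thesis
    using e_op_commute[OF ij, of \<delta> v] unfolding e_op_shift
    by (simp add: e_op_add e_op_pscale simple_cup_part_add simple_cup_part_pscale algebra_simps)
qed

lemma deriv_next:
  assumes ij: "j = i + 1 \<or> i = j + 1"
  shows "simple_cup_part i (e_op \<delta> j (e_op \<delta> i v)) + e_op \<delta> i (simple_cup_part j (e_op \<delta> i v))
     + e_op \<delta> i (e_op \<delta> j (simple_cup_part i v)) = simple_cup_part i v"
proof -
  let ?s = "simple_cup_part" and ?e = "e_op \<delta>"
  let ?a = "?s i (?e j (?e i v)) + ?e i (?s j (?e i v)) + ?e i (?e j (?s i v))"
  let ?b = "?s i (?s j (?e i v)) + ?s i (?e j (?s i v)) + ?e i (?s j (?s i v))"
  \<comment> \<open>no state has overlapping simple cups\<close>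
  have disj: "?s i (?s j u) = 0" for u
  proof (rule poly_mapping_eqI)
    fix y
    show "coeff (?s i (?s j u)) y = coeff 0 y"
      using ij partner_partner[of y i] partner_partner[of y j]
      by (auto simp: lookup_simple_cup_part simple_cup_def simp del: partner_partner)
  qed
  have p: "?a + ?b = ?s i v"
    using e_op_next[OF ij, of "\<delta> + 1" v] e_op_next[OF ij, of \<delta> v] unfolding e_op_shift
    by (simp add: e_op_add e_op_pscale simple_cup_part_add simple_cup_part_pscale disj algebra_simps)
  \<comment> \<open>comparing the shifts by \<open>1\<close> and \<open>-1\<close> eliminates the quadratic term \<open>?b\<close>\<close>
  have shift: "e_op (\<delta> + (-1)) k u = ?e k u - ?s k u" for k u
    unfolding e_op_shift by (simp add: module.scale_minus_left[OF module_pscale])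
  have m: "?a - ?b = ?s i v"
    using e_op_next[OF ij, of "\<delta> + (-1)" v] e_op_next[OF ij, of \<delta> v] unfolding shift
    by (simp add: e_op_minus e_op_add simple_cup_part_minus simple_cup_part_add disj algebra_simps)
  have "(?a + ?b) + (?a - ?b) = ?s i v + ?s i v"
    unfolding p m ..
  then have "?a + ?a = ?s i v + ?s i v" by simp
  then show ?thesis by (rule double_eq)
qed

section \<open>Cyclic modules of link states\<close>

inductive_set reach :: "link_state \<Rightarrow> link_state set" for w where
  start: "w \<in> reach w"
| step: "x \<in> reach w \<Longrightarrow> \<not> strings_at k x \<Longrightarrow> join_at k x \<in> reach w"

definition xspace :: "link_state \<Rightarrow> link_space set" where
  "xspace w = {v. supp v \<subseteq> reach w}"

lemma basis_in_xspace [simp]: "basis x \<in> xspace w \<longleftrightarrow> x \<in> reach w"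
  by (simp add: xspace_def)

lemma xspace_add: "u \<in> xspace w \<Longrightarrow> v \<in> xspace w \<Longrightarrow> u + v \<in> xspace w"
  using keys_add[of u v] by (auto simp: xspace_def)

lemma xspace_pscale: "v \<in> xspace w \<Longrightarrow> pscale c v \<in> xspace w"
  using keys_pscale[of c v] by (auto simp: xspace_def)

lemma xspace_zero [simp]: "0 \<in> xspace w"
  by (simp add: xspace_def)

lemma xspace_subspace: "module.subspace pscale (xspace w)"
  by (simp add: module.subspace_def[OF module_pscale] xspace_add xspace_pscale)

lemma xspace_diff: "u \<in> xspace w \<Longrightarrow> v \<in> xspace w \<Longrightarrow> u - v \<in> xspace w"
  by (rule module.subspace_diff[OF module_pscale xspace_subspace])

lemma xspace_e_op:
  assumes "v \<in> xspace w"
  shows "e_op \<delta> k v \<in> xspace w"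
proof -
  have "supp (e_state \<delta> k x) \<subseteq> reach w" if "x \<in> reach w" for x
    using that reach.step[OF that, of k] by (simp add: e_state_def)
  then have "(\<Union>x\<in>supp v. supp (e_state \<delta> k x)) \<subseteq> reach w"
    using assms unfolding xspace_def by blast
  then show ?thesis
    using keys_lin_ext[of "e_state \<delta> k" v] by (simp add: xspace_def e_op_lin_ext)
qed

lemma keys_simple_cup_part: "supp (simple_cup_part k v) = {y \<in> supp v. simple_cup k y}"
  by (auto simp: in_keys_iff lookup_simple_cup_part split: if_splits)

lemma xspace_simple_cup_part: "v \<in> xspace w \<Longrightarrow> simple_cup_part k v \<in> xspace w"
  by (auto simp: xspace_def keys_simple_cup_part)

interpretation link_action: word_action pscale "xspace w" "e_op \<delta>" for w \<delta>
  by (intro word_action.intro vector_space_pscale word_action_axioms.intro)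
    (simp_all add: xspace_subspace xspace_e_op e_op_add e_op_pscale)

text \<open>
  A generator sends a state to a multiple of a state, so the submodule has a basis of states. A
  vanishing loop parameter does no harm: a loop is closed only where the state stays the same.
\<close>

lemma X_rep_eq: "X_rep \<delta> w = \<lparr>space = xspace w, smult = pscale, act = gen_act pscale (e_op \<delta>)\<rparr>"
proof -
  have "subrep (link_rep \<delta>) (xspace w) \<and> basis w \<in> xspace w"
    by (simp add: subrep_def link_rep_def xspace_subspace link_action.act_closed reach.start)
  moreover have "xspace w \<subseteq> U" if U: "subrep (link_rep \<delta>) U" "basis w \<in> U" for U
  proof
    have sub: "module.subspace pscale U" and act: "\<And>a u. u \<in> U \<Longrightarrow> gen_act pscale (e_op \<delta>) a u \<in> U"
      using U(1) by (auto simp: subrep_def link_rep_def)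
    have "basis x \<in> U" if "x \<in> reach w" for x
      using that
    proof induction
      case (step x k)
      then show ?case
        using act[OF step.IH, of "gen k"]
        by (cases "simple_cup k x") (simp_all add: e_op_eqs join_at_simple)
    qed (rule U(2))
    then show "v \<in> U" if "v \<in> xspace w" for v
      using that unfolding xspace_def
      by (subst pm_expand[of v])
        (auto intro!: module.subspace_sum[OF module_pscale sub] module.subspace_scale[OF module_pscale sub]
          simp del: pscale_single)
  qed
  ultimately have "\<Inter>{U. subrep (link_rep \<delta>) U \<and> basis w \<in> U} = xspace w"
    by (intro antisym Inter_lower Inter_greatest) auto
  then show ?thesis
    by (simp add: X_rep_def generated_subrep_def link_rep_def)
qed

lemma TL_rep_X_rep: "TL_rep \<delta> (X_rep \<delta> w)"
  unfolding X_rep_eq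
  by (rule link_action.TL_rep)
    (use e_op_next[of "Suc i" i for i] in \<open>simp_all add: e_op_square e_op_next e_op_commute\<close>)

lemma xspace_eqI:
  assumes "v \<in> xspace w"
    and "\<And>u v. u \<in> xspace w \<Longrightarrow> v \<in> xspace w \<Longrightarrow> f (u + v) = f u + f v"
      "\<And>c u. u \<in> xspace w \<Longrightarrow> f (pscale c u) = pscale c (f u)"
      "\<And>u v. u \<in> xspace w \<Longrightarrow> v \<in> xspace w \<Longrightarrow> g (u + v) = g u + g v"
      "\<And>c u. u \<in> xspace w \<Longrightarrow> g (pscale c u) = pscale c (g u)"
    and "\<And>x. x \<in> reach w \<Longrightarrow> f (basis x) = g (basis x)"
  shows "f v = (g v :: link_space)"
  by (rule linear_eqI[where s = pscale and B = "reach w"]) (use assms in \<open>auto simp: xspace_def\<close>)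

locale link_hom =
  fixes \<delta> :: complex and w z :: link_state and \<phi> :: "link_space \<Rightarrow> link_space"
  assumes maps: "v \<in> xspace w \<Longrightarrow> \<phi> v \<in> xspace z"
    and add: "u \<in> xspace w \<Longrightarrow> v \<in> xspace w \<Longrightarrow> \<phi> (u + v) = \<phi> u + \<phi> v"
    and scale: "v \<in> xspace w \<Longrightarrow> \<phi> (pscale c v) = pscale c (\<phi> v)"
    and comm: "v \<in> xspace w \<Longrightarrow> \<phi> (e_op \<delta> k v) = e_op \<delta> k (\<phi> v)"
begin

lemma zero [simp]: "\<phi> 0 = 0"
  using scale[of 0 0] by simp

end

locale joining_hom = link_hom +
  fixes n :: nat
  assumes joins: "x \<in> reach w \<Longrightarrow> y \<in> supp (\<phi> (basis x)) \<Longrightarrow> joins_strings n x y"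

lemma rep_hom_X_rep:
  "rep_hom (X_rep \<delta> w) (X_rep \<delta> z) \<phi> \<Longrightarrow> link_hom \<delta> w z \<phi>"
proof unfold_locales
  assume h: "rep_hom (X_rep \<delta> w) (X_rep \<delta> z) \<phi>"
  then show "\<phi> (e_op \<delta> k v) = e_op \<delta> k (\<phi> v)" if "v \<in> xspace w" for k v
    using that link_action.act_gen unfolding rep_hom_def X_rep_eq by (metis rep.select_convs(1,3))
qed (simp_all add: rep_hom_def lin_on_def X_rep_eq)

lemma pair_hom_joining:
  "pair_hom \<delta> w z \<phi> \<Longrightarrow> joining_hom \<delta> w z \<phi> (num_strings w - num_strings z)"
  by (auto simp: pair_hom_def joining_hom_def joining_hom_axioms_def X_rep_eq intro: rep_hom_X_rep)

lemma joined_partner: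
  assumes "joins_strings n x y" "partner x p \<noteq> p"
  shows "partner y p = partner x p"
  using assms unfolding joins_strings_def strings_def by blast

context joining_hom
begin

lemma e_tilde_add: "e_tilde \<phi> k (u + v) = e_tilde \<phi> k u + e_tilde \<phi> k v"
  unfolding e_tilde_def by (rule lin_ext_add)

lemma e_tilde_pscale: "e_tilde \<phi> k (pscale c v) = pscale c (e_tilde \<phi> k v)"
  unfolding e_tilde_def by (rule lin_ext_pscale)

lemma e_tilde_basis: "e_tilde \<phi> k (basis x) = (if strings_at k x then simple_cup_part k (\<phi> (basis x)) else 0)"
  by (simp add: e_tilde_def)

text \<open>
  Outside the states with strings at \<open>k, k + 1\<close>, a simple cup at \<open>k\<close> is present in all terms of
  the image precisely if it is present in the state, so the commutator vanishes there; on the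
  remaining states, only its first term survives.
\<close>

lemma e_tilde_commutator:
  assumes "v \<in> xspace w"
  shows "e_tilde \<phi> k v = simple_cup_part k (\<phi> v) - \<phi> (simple_cup_part k v)"
proof (rule xspace_eqI[OF assms])
  fix x assume x: "x \<in> reach w"
  show "e_tilde \<phi> k (basis x) = simple_cup_part k (\<phi> (basis x)) - \<phi> (simple_cup_part k (basis x))"
  proof (cases "strings_at k x")
    case True
    then have "\<not> simple_cup k x" by (auto simp: strings_at_iff simple_cup_def)
    then show ?thesis using True by (simp add: e_tilde_basis simple_cup_part_basis)
  next
    case False
    have "simple_cup k y \<longleftrightarrow> simple_cup k x" if "y \<in> supp (\<phi> (basis x))" for y
      using joined_partner[OF joins[OF x that]] False unfolding simple_cup_def strings_at_iff
      by (metis Suc_eq_plus1 n_not_Suc_n partner_partner)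
    then have "simple_cup_part k (\<phi> (basis x)) = (if simple_cup k x then \<phi> (basis x) else 0)"
      by (intro poly_mapping_eqI) (auto simp: lookup_simple_cup_part in_keys_iff)
    then show ?thesis using False by (simp add: e_tilde_basis simple_cup_part_basis)
  qed
qed (simp_all add: e_tilde_add e_tilde_pscale simple_cup_part_add simple_cup_part_pscale add scale
    xspace_simple_cup_part)

end

section \<open>Extensions from twisting maps\<close>

text \<open>
  These are the off-diagonal parts of the relations for the operators
  \<open>(v, x) \<mapsto> (e k v + T k x, e k x)\<close>; the diagonal parts are the relations for \<open>e k\<close>.
\<close>

locale twisting =
  fixes \<delta> :: complex and w z :: link_state and T :: "nat \<Rightarrow> link_space \<Rightarrow> link_space"
  assumes T_maps: "v \<in> xspace w \<Longrightarrow> T k v \<in> xspace z"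
    and T_add: "u \<in> xspace w \<Longrightarrow> v \<in> xspace w \<Longrightarrow> T k (u + v) = T k u + T k v"
    and T_scale: "v \<in> xspace w \<Longrightarrow> T k (pscale c v) = pscale c (T k v)"
    and T_square: "v \<in> xspace w \<Longrightarrow> T k (e_op \<delta> k v) + e_op \<delta> k (T k v) = pscale \<delta> (T k v)"
    and T_next: "v \<in> xspace w \<Longrightarrow> j = i + 1 \<or> i = j + 1 \<Longrightarrow>
      T i (e_op \<delta> j (e_op \<delta> i v)) + e_op \<delta> i (T j (e_op \<delta> i v)) + e_op \<delta> i (e_op \<delta> j (T i v)) = T i v"
    and T_commute: "v \<in> xspace w \<Longrightarrow> \<bar>int i - int j\<bar> > 1 \<Longrightarrow>
      T i (e_op \<delta> j v) + e_op \<delta> i (T j v) = T j (e_op \<delta> i v) + e_op \<delta> j (T i v)"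

lemma (in joining_hom) twisting_e_tilde: "twisting \<delta> w z (e_tilde \<phi>)"
proof
  fix u v :: link_space and c k
  assume v: "v \<in> xspace w"
  show "e_tilde \<phi> k v \<in> xspace z"
    by (simp add: v e_tilde_commutator xspace_diff xspace_simple_cup_part maps)
  let ?s = "simple_cup_part" and ?e = "e_op \<delta>"
  note mem = v xspace_e_op xspace_simple_cup_part
  have t: "e_tilde \<phi> k x = ?s k (\<phi> x) - \<phi> (?s k x)" if "x \<in> xspace w" for k x
    using that by (rule e_tilde_commutator)
  have c: "\<phi> (?e k x) = ?e k (\<phi> x)" if "x \<in> xspace w" for k x
    using that by (rule comm)
  have d: "(a - a') + (b - b') = (a + b) - (a' + b')" for a a' b b' :: link_space
    by simp
  show "e_tilde \<phi> k (?e k v) + ?e k (e_tilde \<phi> k v) = pscale \<delta> (e_tilde \<phi> k v)"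
  proof -
    have "\<phi> (?s k (?e k v)) + \<phi> (?e k (?s k v)) = \<phi> (?s k (?e k v) + ?e k (?s k v))"
      by (simp only: add mem)
    also have "\<dots> = pscale \<delta> (\<phi> (?s k v)) + ?e k (\<phi> v)"
      by (simp only: deriv_square add scale c mem xspace_pscale)
    finally have "\<phi> (?s k (?e k v)) + ?e k (\<phi> (?s k v)) = pscale \<delta> (\<phi> (?s k v)) + ?e k (\<phi> v)"
      by (simp only: c mem)
    then show ?thesis
      unfolding t[OF v] t[OF xspace_e_op[OF v]] c[OF v] e_op_minus d deriv_square by simp
  qed
  fix i j :: nat
  show "e_tilde \<phi> i (?e j (?e i v)) + ?e i (e_tilde \<phi> j (?e i v))
      + ?e i (?e j (e_tilde \<phi> i v)) = e_tilde \<phi> i v" if "j = i + 1 \<or> i = j + 1"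
  proof -
    have "\<phi> (?s i (?e j (?e i v))) + \<phi> (?e i (?s j (?e i v))) + \<phi> (?e i (?e j (?s i v)))
        = \<phi> (?s i (?e j (?e i v)) + ?e i (?s j (?e i v)) + ?e i (?e j (?s i v)))"
      by (simp only: add mem xspace_add)
    also have "\<dots> = \<phi> (?s i v)"
      unfolding deriv_next[OF that] ..
    finally have "\<phi> (?s i (?e j (?e i v))) + ?e i (\<phi> (?s j (?e i v))) + ?e i (?e j (\<phi> (?s i v))) = \<phi> (?s i v)"
      by (simp only: c mem)
    then show ?thesis
      unfolding t[OF v] t[OF xspace_e_op[OF v]] t[OF xspace_e_op[OF xspace_e_op[OF v]]]
        c[OF v] c[OF xspace_e_op[OF v]] e_op_minus d deriv_next[OF that] by simp
  qed
  show "e_tilde \<phi> i (?e j v) + ?e i (e_tilde \<phi> j v) = e_tilde \<phi> j (?e i v) + ?e j (e_tilde \<phi> i v)"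
    if "\<bar>int i - int j\<bar> > 1"
  proof -
    have "\<phi> (?s i (?e j v)) + \<phi> (?e i (?s j v)) = \<phi> (?s i (?e j v) + ?e i (?s j v))"
      by (simp only: add mem)
    also have "\<dots> = \<phi> (?s j (?e i v)) + \<phi> (?e j (?s i v))"
      unfolding deriv_commute[OF that] by (simp only: add mem)
    finally have "\<phi> (?s i (?e j v)) + ?e i (\<phi> (?s j v)) = \<phi> (?s j (?e i v)) + ?e j (\<phi> (?s i v))"
      by (simp only: c mem)
    then show ?thesis
      unfolding t[OF v] t[OF xspace_e_op[OF v]] c[OF v] e_op_minus d deriv_commute[OF that] by simp
  qed
qed (simp_all add: e_tilde_add e_tilde_pscale)

lemma (in link_hom) twisting_comp:
  assumes "twisting \<delta> z y T"
  shows "twisting \<delta> w y (\<lambda>k v. T k (\<phi> v))"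
proof -
  interpret t: twisting \<delta> z y T by fact
  show ?thesis
    by unfold_locales (simp_all add: maps add scale comm xspace_e_op t.T_maps t.T_add t.T_scale
        t.T_square t.T_next t.T_commute)
qed

definition pair_scale :: "complex \<Rightarrow> link_space \<times> link_space \<Rightarrow> link_space \<times> link_space" where
  "pair_scale c = (\<lambda>(v, x). (pscale c v, pscale c x))"

lemma pair_scale_simp [simp]: "pair_scale c (v, x) = (pscale c v, pscale c x)"
  by (simp add: pair_scale_def)

lemma vector_space_pair_scale: "vector_space pair_scale"
  by unfold_locales (auto simp: pair_scale_def pscale_add pscale_add_left pscale_pscale)

lemma module_pair_scale: "module pair_scale"
  by unfold_locales (auto simp: pair_scale_def pscale_add pscale_add_left pscale_pscale)

context twisting
begin

definition E :: "(link_space \<times> link_space) rep" where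
  "E = twisted_sum \<delta> (X_rep \<delta> z) (X_rep \<delta> w) T"

definition step_op :: "nat \<Rightarrow> link_space \<times> link_space \<Rightarrow> link_space \<times> link_space" where
  "step_op = (\<lambda>k (v, x). (e_op \<delta> k v + T k x, e_op \<delta> k x))"

lemma step_op_simp [simp]: "step_op k (v, x) = (e_op \<delta> k v + T k x, e_op \<delta> k x)"
  by (simp add: step_op_def)

lemma E_eq: "E = \<lparr>space = xspace z \<times> xspace w, smult = pair_scale, act = gen_act pair_scale step_op\<rparr>"
proof -
  have "pair_scale = (\<lambda>c (v, x). (pscale c v, pscale c x))"
    by (simp add: fun_eq_iff)
  then show ?thesis
    by (simp add: E_def twisted_sum_def X_rep_eq step_op_def Let_def)
qed

lemma T_zero [simp]: "T k 0 = 0"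
  using T_scale[of 0 k 0] by simp

sublocale word_action pair_scale "xspace z \<times> xspace w" step_op
proof (intro word_action.intro vector_space_pair_scale word_action_axioms.intro)
  show "module.subspace pair_scale (xspace z \<times> xspace w)"
    by (auto simp: module.subspace_def[OF module_pair_scale] zero_prod_def xspace_add xspace_pscale)
qed (auto simp: xspace_add xspace_e_op T_maps T_add T_scale e_op_add e_op_pscale pscale_add algebra_simps)

lemma TL_rep_E: "TL_rep \<delta> E"
  unfolding E_eq
proof (rule TL_rep)
  fix i j :: nat and p :: "link_space \<times> link_space"
  assume "p \<in> xspace z \<times> xspace w"
  then obtain v x where p: "p = (v, x)" "v \<in> xspace z" "x \<in> xspace w" by auto
  show "step_op i (step_op i p) = pair_scale \<delta> (step_op i p)"
    using T_square[OF p(3), of i] by (simp add: p e_op_square e_op_add pscale_add algebra_simps)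
  have nxt: "step_op i (step_op j (step_op i p)) = step_op i p" if "j = i + 1 \<or> i = j + 1" for i j
    using T_next[OF p(3) that] e_op_next[OF that] by (simp add: p e_op_add algebra_simps)
  show "step_op i (step_op (i + 1) (step_op i p)) = step_op i p"
    "step_op (i + 1) (step_op i (step_op (i + 1) p)) = step_op (i + 1) p"
    by (rule nxt, simp)+
  show "step_op i (step_op j p) = step_op j (step_op i p)" if "\<bar>int i - int j\<bar> > 1"
    using T_commute[OF p(3) that] e_op_commute[OF that] by (simp add: p e_op_add algebra_simps)
qed

lemma short_exact_E: "short_exact \<delta> (X_rep \<delta> z) (\<lambda>v. (v, 0)) E snd (X_rep \<delta> w)"
proof -
  have word: "foldr step_op u (v, 0) = (foldr (e_op \<delta>) u v, 0)" for u v
    by (induction u) simp_all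
  have sum: "(\<Sum>x\<in>A. (f x, 0)) = (sum f A, 0)" for A :: "nat list set" and f :: "nat list \<Rightarrow> link_space"
    by (induction A rule: infinite_finite_induct) (simp_all add: zero_prod_def)
  have \<iota>: "gen_act pair_scale step_op a (v, 0) = (gen_act pscale (e_op \<delta>) a v, 0)" for a v
    by (simp add: gen_act_def word sum)
  have snd: "snd (foldr step_op u p) = foldr (e_op \<delta>) u (snd p)" for u p
    by (induction u) (simp_all add: step_op_def case_prod_unfold)
  have \<pi>: "snd (gen_act pair_scale step_op a p) = gen_act pscale (e_op \<delta>) a (snd p)" for a p
    by (simp add: gen_act_def snd_sum pair_scale_def case_prod_unfold snd)
  show ?thesis
    unfolding short_exact_def rep_hom_def lin_on_def using TL_rep_X_rep TL_rep_E
    by (auto simp: E_eq X_rep_eq \<iota> \<pi> inj_on_def image_iff pair_scale_def case_prod_unfold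
        intro: xspace_zero)
qed

text \<open>The map \<open>\<sigma>\<close> is the first component of a section.\<close>

lemma splits_E:
  assumes "splits E snd (X_rep \<delta> w)"
  shows "\<exists>\<sigma>. \<sigma> 0 = 0 \<and>
    (\<forall>v\<in>xspace w. \<sigma> v \<in> xspace z \<and> (\<forall>k. \<sigma> (e_op \<delta> k v) = e_op \<delta> k (\<sigma> v) + T k v))"
proof -
  obtain \<tau> where \<tau>: "rep_hom (X_rep \<delta> w) E \<tau>" "\<And>v. v \<in> xspace w \<Longrightarrow> snd (\<tau> v) = v"
    using assms by (auto simp: splits_def X_rep_eq)
  have m: "\<tau> v \<in> xspace z \<times> xspace w" if "v \<in> xspace w" for v
    using \<tau>(1) that by (auto simp: rep_hom_def lin_on_def E_eq X_rep_eq)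
  have h: "\<tau> (gen_act pscale (e_op \<delta>) a v) = gen_act pair_scale step_op a (\<tau> v)"
    if "v \<in> xspace w" for a v
    using \<tau>(1) that by (simp add: rep_hom_def E_eq X_rep_eq)
  have a: "\<tau> (e_op \<delta> k v) = step_op k (\<tau> v)" if "v \<in> xspace w" for k v
    using h[OF that, of "gen k"] by simp
  have "\<tau> (0 + 0) = \<tau> 0 + \<tau> 0"
    using \<tau>(1) xspace_zero[of w] unfolding rep_hom_def lin_on_def X_rep_eq rep.select_convs by blast
  then have \<tau>0: "\<tau> 0 = 0" by simp
  show ?thesis
  proof (intro exI[of _ "fst \<circ> \<tau>"] conjI ballI allI)
    show "(fst \<circ> \<tau>) 0 = 0"
      by (simp add: \<tau>0)
    show "(fst \<circ> \<tau>) v \<in> xspace z" if "v \<in> xspace w" for v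
      using m[OF that] by auto
    show "(fst \<circ> \<tau>) (e_op \<delta> k v) = e_op \<delta> k ((fst \<circ> \<tau>) v) + T k v" if "v \<in> xspace w" for v k
      using a[OF that] \<tau>(2)[OF that] by (simp add: step_op_def case_prod_unfold)
  qed
qed

end

section \<open>Left endpoints and normal forms\<close>

definition lefts :: "link_state \<Rightarrow> nat set" where
  "lefts y = {p. p < partner y p}"

lemma lefts_iff: "p \<in> lefts y \<longleftrightarrow> p < partner y p"
  by (simp add: lefts_def)

text \<open>
  As in a sequence of brackets, the left endpoints determine the cups: where \<open>y\<close> closes the cup of
  \<open>a\<close> later than \<open>x\<close> does, the closing point of \<open>x\<close> lies below the cup of \<open>y\<close>, and its partner in
  \<open>y\<close> opens a shorter cup with the same disagreement.
\<close>

lemma partner_left: "a \<in> lefts x \<Longrightarrow> lefts x = lefts y \<Longrightarrow> \<not> partner x a < partner y a"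
proof (induction "partner x a - a" arbitrary: a rule: less_induct)
  case less
  show ?case
  proof
    assume lt: "partner x a < partner y a"
    define j where "j = partner x a"
    have aj: "a < j" "j < partner y a" using less.prems(1) lt by (auto simp: j_def lefts_iff)
    have "j \<notin> lefts x" using aj by (simp add: lefts_iff j_def)
    then have "\<not> j < partner y j" using less.prems(2) by (simp add: lefts_iff set_eq_iff)
    define c where "c = partner y j"
    have c: "a < c" "c < j"
      using below_cup[OF aj] \<open>\<not> j < partner y j\<close> by (auto simp: c_def)
    have cl: "c \<in> lefts x" using c less.prems(2) by (auto simp: lefts_iff c_def)
    have "partner x c < j"
      using below_cup[of a c x] c by (simp add: j_def)
    then have "partner x c < partner y c" by (simp add: c_def)
    moreover have "partner x c - c < partner x a - a"
      using c aj \<open>partner x c < j\<close> cl by (simp add: j_def[symmetric] lefts_iff)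
    ultimately show False
      using less.hyps[OF _ cl less.prems(2)] by blast
  qed
qed

lemma lefts_inject:
  assumes "lefts x = lefts y"
  shows "x = y"
proof (rule link_state_eqI)
  fix p
  have l: "partner x a = partner y a" if "a \<in> lefts x" for a
    using partner_left[OF that assms] partner_left[of a y x, OF _ assms[symmetric]] that assms by simp
  consider "p < partner x p" | "partner x p < p" | "partner x p = p" by linarith
  then show "partner x p = partner y p"
  proof cases
    case 1
    then show ?thesis using l by (simp add: lefts_iff)
  next
    case 2
    then have "partner x (partner x p) = partner y (partner x p)"
      by (intro l) (simp add: lefts_iff)
    then show ?thesis by (metis partner_partner)
  next
    case 3
    then have "\<not> p < partner y p" using assms by (metis lefts_iff less_irrefl)
    moreover have "\<not> partner y p < p"
    proof
      assume "partner y p < p"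
      then have "partner y p \<in> lefts x" using assms by (simp add: lefts_iff)
      from l[OF this] show False using 3 \<open>partner y p < p\<close>
        by (metis less_irrefl partner_partner)
    qed
    ultimately show ?thesis using 3 by simp
  qed
qed

lemma simple_cup_lefts:
  assumes "a \<in> lefts y" "a + 1 \<notin> lefts y"
  shows "simple_cup a y"
proof (rule ccontr)
  assume "\<not> simple_cup a y"
  then have "a < a + 1" "a + 1 < partner y a"
    using assms(1) by (auto simp: simple_cup_def lefts_iff)
  from below_cup[OF this] assms(2) show False
    by (auto simp: lefts_iff)
qed

definition closed_below :: "nat \<Rightarrow> link_state \<Rightarrow> bool" where
  "closed_below n y \<longleftrightarrow> (\<forall>p<n. partner y p < n)"

lemma closed_belowD: "closed_below n y \<Longrightarrow> p < n \<Longrightarrow> partner y p < n"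
  by (simp add: closed_below_def)

text \<open>
  The largest point joined to one of the points up to \<open>M\<close> works: a cup leaving beyond it would cross the
  cup that ends there.
\<close>

lemma ex_closed_below: "\<exists>n>M. closed_below n y"
proof -
  let ?m = "Max (insert M (partner y ` {..M}))"
  have m: "M \<le> ?m" by (rule Max_ge) auto
  have mp: "partner y p \<le> ?m" if "p \<le> M" for p
    using that by (intro Max_ge) auto
  have "partner y r \<le> ?m" if "r \<le> ?m" for r
  proof (cases "r \<le> M")
    case False
    then have "?m \<noteq> M" using that by linarith
    moreover have "?m \<in> insert M (partner y ` {..M})" by (rule Max_in) auto
    ultimately have "?m \<in> partner y ` {..M}" by blast
    then obtain p where p: "p \<le> M" "?m = partner y p" by (metis atMost_iff imageE)
    show ?thesis
    proof (cases "r = partner y p")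
      case True
      then show ?thesis using p m by simp
    next
      case neq: False
      have "p < r" "r < partner y p" using False that p neq by linarith+
      from below_cup(2)[OF this] p show ?thesis by simp
    qed
  qed (rule mp)
  then have "closed_below (Suc ?m) y" by (simp add: closed_below_def less_Suc_eq_le)
  then show ?thesis using m less_Suc_eq_le by blast
qed

lemma closed_below_join_at: "closed_below n y \<Longrightarrow> k + 1 < n \<Longrightarrow> closed_below n (join_at k y)"
  by (auto simp: closed_below_def partner_join_at)

lemma join_at_beyond:
  assumes "closed_below n y" "k + 1 < n" "n \<le> p"
  shows "partner (join_at k y) p = partner y p"
  using assms closed_belowD[OF assms(1), of k] closed_belowD[OF assms(1), of "k + 1"]
  by (auto simp: partner_join_at)

lemma card_swap: "finite A \<Longrightarrow> k \<in> A \<Longrightarrow> b \<notin> A \<Longrightarrow> card (insert b (A - {k})) = card A"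
  by (metis Diff_iff card.remove card_insert_disjoint finite_Diff)

lemma rewire_fixed:
  assumes inv: "\<And>x. f (f x) = x" and d: "i \<noteq> i'"
  shows "f i = i \<Longrightarrow> f i' \<noteq> i' \<Longrightarrow> rewire i i' f p = p \<longleftrightarrow> p = f i' \<or> f p = p \<and> p \<noteq> i"
    "f i \<noteq> i \<Longrightarrow> f i' = i' \<Longrightarrow> rewire i i' f p = p \<longleftrightarrow> p = f i \<or> f p = p \<and> p \<noteq> i'"
    "f i \<noteq> i \<Longrightarrow> f i' \<noteq> i' \<Longrightarrow> rewire i i' f p = p \<longleftrightarrow> f p = p"
  using d inv[of i] inv[of i'] inv[of p] unfolding rewire_def by (smt (z3))+

lemma strings_join_at:
  assumes "\<not> strings_at k x"
  shows "strings (join_at k x) =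
    (if k \<in> strings x then insert (partner x (k + 1)) (strings x - {k})
     else if k + 1 \<in> strings x then insert (partner x k) (strings x - {k + 1}) else strings x)"
proof -
  have "k \<noteq> k + 1" by simp
  note r = rewire_fixed[of "partner x" k "k + 1", OF partner_partner this, folded partner_join_at_rewire]
  show ?thesis
    using assms r unfolding strings_at_iff set_eq_iff by (auto simp: strings_iff)
qed

text \<open>A move displaces at most one string, to the other end of a cup that it meets.\<close>

lemma card_strings_join_at:
  assumes x: "\<not> strings_at k x" and A: "finite (strings x \<inter> A)" "k \<in> A" "k + 1 \<in> A"
    "partner x k \<in> A" "partner x (k + 1) \<in> A"
  shows "finite (strings (join_at k x) \<inter> A)" "card (strings (join_at k x) \<inter> A) = card (strings x \<inter> A)"
proof -
  have i: "insert b B \<inter> A = insert b (B \<inter> A)" if "b \<in> A" for b B using that by auto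
  have d: "(B - {b}) \<inter> A = (B \<inter> A) - {b}" for b B by auto
  have "k \<in> strings x \<Longrightarrow> partner x (k + 1) \<notin> strings x"
    using x by (metis partner_partner strings_iff strings_at_iff)
  moreover have "k + 1 \<in> strings x \<Longrightarrow> partner x k \<notin> strings x"
    using x by (metis partner_partner strings_iff strings_at_iff)
  ultimately have "k \<in> strings x \<Longrightarrow>
      card (insert (partner x (k + 1)) (strings x \<inter> A - {k})) = card (strings x \<inter> A)"
    "k + 1 \<in> strings x \<Longrightarrow>
      card (insert (partner x k) (strings x \<inter> A - {k + 1})) = card (strings x \<inter> A)"
    using A by (auto intro!: card_swap simp del: card_insert_disjoint)
  then show "finite (strings (join_at k x) \<inter> A)" "card (strings (join_at k x) \<inter> A) = card (strings x \<inter> A)"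
    unfolding strings_join_at[OF x] using A by (auto simp only: i d finite_insert finite_Diff split: if_splits)
qed

lemma reach_strings:
  assumes "x \<in> reach w" "finite (strings w)"
  shows "finite (strings x) \<and> num_strings x = num_strings w"
  using assms
proof induction
  case (step x k)
  then show ?case using card_strings_join_at[of k x UNIV] by (simp add: num_strings_def)
qed (simp add: num_strings_def)

lemma reach_trans: "y \<in> reach x \<Longrightarrow> x \<in> reach w \<Longrightarrow> y \<in> reach w"
  by (induction rule: reach.induct) (auto intro: reach.step)

text \<open>
  A simple cup followed by a string or a right endpoint can be moved one step to the right by an
  invertible move. If this is impossible below \<open>n\<close>, the strings come first and are followed by simple
  cups only.
\<close>

definition normal_below :: "nat \<Rightarrow> link_state \<Rightarrow> bool" where
  "normal_below n y \<longleftrightarrow> (\<forall>k. simple_cup k y \<longrightarrow> k + 2 < n \<longrightarrow> k + 2 \<in> lefts y)"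

lemma lefts_move:
  assumes "simple_cup k y" "k + 2 \<notin> lefts y"
  shows "lefts (join_at (k + 1) y) = insert (k + 1) (lefts y - {k})"
proof (rule set_eqI)
  fix p
  have k: "partner y k = k + 1" "partner y (k + 1) = k"
    using assms(1) partner_partner[of y k] by (auto simp: simple_cup_def)
  have b: "partner y (k + 2) \<le> k + 2" using assms(2) by (simp add: lefts_iff)
  moreover have "partner y (k + 2) \<noteq> k" "partner y (k + 2) \<noteq> k + 1"
    using k partner_partner[of y "k + 2"] by (auto simp del: partner_partner)
  ultimately have b: "partner y (k + 2) < k \<or> partner y (k + 2) = k + 2" by linarith
  consider "p = k" | "p = k + 1" | "p = k + 2" | "p = partner y (k + 2)" "p \<notin> {k, k + 1, k + 2}"
    | "p \<noteq> partner y (k + 2)" "p \<notin> {k, k + 1, k + 2}" by blast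
  then show "p \<in> lefts (join_at (k + 1) y) \<longleftrightarrow> p \<in> insert (k + 1) (lefts y - {k})"
    by cases (use k b in \<open>auto simp: lefts_iff partner_join_at\<close>)
qed

text \<open>
  Every move to the right decreases the sum of the distances of left endpoints to the bound.
\<close>

lemma normalize_induct [consumes 1, case_names normal move]:
  assumes "closed_below n y"
    and "\<And>y. closed_below n y \<Longrightarrow> normal_below n y \<Longrightarrow> P y"
    and "\<And>y k. closed_below n y \<Longrightarrow> simple_cup k y \<Longrightarrow> k + 2 < n \<Longrightarrow> k + 2 \<notin> lefts y \<Longrightarrow>
      P (join_at (k + 1) y) \<Longrightarrow> P y"
  shows "P y"
  using assms(1)
proof (induction "\<Sum>p\<in>lefts y \<inter> {..<n}. n - p" arbitrary: y rule: less_induct)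
  case less
  show ?case
  proof (cases "normal_below n y")
    case False
    then obtain k where k: "simple_cup k y" "k + 2 < n" "k + 2 \<notin> lefts y"
      by (auto simp: normal_below_def)
    let ?A = "lefts y \<inter> {..<n}"
    have kl: "k \<in> ?A" "k + 1 \<notin> lefts y"
      using k(1,2) partner_partner[of y k] by (auto simp: simple_cup_def lefts_iff simp del: partner_partner)
    have "lefts (join_at (k + 1) y) \<inter> {..<n} = insert (k + 1) (?A - {k})"
      using lefts_move[OF k(1,3)] k(2) by auto
    then have "(\<Sum>p\<in>lefts (join_at (k + 1) y) \<inter> {..<n}. n - p) = (n - (k + 1)) + (\<Sum>p\<in>?A - {k}. n - p)"
      using kl by simp
    also have "\<dots> < (n - k) + (\<Sum>p\<in>?A - {k}. n - p)" using k(2) by simp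
    also have "\<dots> = (\<Sum>p\<in>?A. n - p)" using kl by (simp add: sum.remove)
    finally have "P (join_at (k + 1) y)"
      using less.hyps closed_below_join_at[OF less.prems, of "k + 1"] k(2) by simp
    then show ?thesis using assms(3) less.prems k by blast
  qed (use assms(2) less.prems in blast)
qed

lemma normal_below_simple:
  assumes c: "closed_below n y" and nb: "normal_below n y"
  shows "a \<in> lefts y \<Longrightarrow> a < n \<Longrightarrow> simple_cup a y"
proof (induction "n - a" arbitrary: a rule: less_induct)
  case less
  show ?case
  proof (rule ccontr)
    assume ns: "\<not> simple_cup a y"
    define b where "b = partner y a"
    have b: "a + 1 < b" "b < n"
      using ns less.prems closed_belowD[OF c] by (auto simp: b_def lefts_iff simple_cup_def)
    have in_cup: "a < b - 1" "b - 1 < partner y a" using b by (auto simp: b_def[symmetric])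
    define e where "e = partner y (b - 1)"
    have e: "a < e" "e < b" "e \<noteq> b - 1"
      using below_cup[OF in_cup] by (auto simp: e_def b_def)
    then have "e < b - 1" by linarith
    then have "e \<in> lefts y" by (simp add: lefts_iff e_def)
    then have "simple_cup e y" using less.hyps[of e] e b less.prems by auto
    then have "b = e + 2" using b by (simp add: simple_cup_def e_def)
    then have "b \<in> lefts y" using nb \<open>simple_cup e y\<close> b by (auto simp: normal_below_def)
    then show False using b by (simp add: lefts_iff b_def)
  qed
qed

lemma right_simple:
  assumes "closed_below n y" "normal_below n y" "p < n" "partner y p < p"
  shows "simple_cup (partner y p) y" "partner y p + 1 = p"
proof -
  have "partner y p \<in> lefts y" using assms(4) by (simp add: lefts_iff)
  then show s: "simple_cup (partner y p) y"
    using normal_below_simple[OF assms(1,2)] assms(3,4) by simp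
  then show "partner y p + 1 = p" by (simp add: simple_cup_def)
qed

lemma normal_below_strings:
  assumes c: "closed_below n y" and nb: "normal_below n y"
  shows "strings y \<inter> {..<n} = {..<card (strings y \<inter> {..<n})}"
proof -
  have pred: "p \<in> strings y" if "Suc p \<in> strings y" "Suc p < n" for p
  proof (rule ccontr)
    assume ns: "p \<notin> strings y"
    show False
    proof (cases "p < partner y p")
      case True
      then have "simple_cup p y" using normal_below_simple[OF c nb] that by (simp add: lefts_iff)
      then show False using that(1) partner_partner[of y p]
        by (simp add: simple_cup_def strings_iff del: partner_partner)
    next
      case False
      then have r: "partner y p < p" using ns by (simp add: strings_iff)
      note s = right_simple[OF c nb _ r]
      have e: "partner y p + 2 = Suc p" using s(2) that(2) by simp
      then have "Suc p \<in> lefts y"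
        using nb s(1) that(2) by (metis Suc_lessD normal_below_def)
      then show False using that(1) by (simp add: lefts_iff strings_iff)
    qed
  qed
  let ?S = "strings y \<inter> {..<n}"
  have down: "r \<in> ?S" if "p \<in> ?S" "r \<le> p" for p r
    using that(2,1) by (induction rule: inc_induct) (auto intro: pred)
  have "?S = {..<m}" if "m = (LEAST r. r \<notin> ?S)" for m
  proof -
    have "n \<notin> ?S" by simp
    then have m: "m \<notin> ?S" unfolding that by (rule LeastI)
    have "r \<in> ?S" if "r < m" for r using that not_less_Least \<open>m = _\<close> by blast
    moreover have "r < m" if "r \<in> ?S" for r using down[OF that, of m] m by (meson not_less)
    ultimately show ?thesis by auto
  qed
  then obtain m where "?S = {..<m}" by blast
  then show ?thesis by simp
qed

lemma normal_below_lefts: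
  assumes c: "closed_below n y" and nb: "normal_below n y" and m: "m = card (strings y \<inter> {..<n})"
  shows "lefts y \<inter> {..<n} = {p. m \<le> p \<and> p < n \<and> even (p - m)}"
proof -
  have str: "p \<in> strings y \<longleftrightarrow> p < m" if "p < n" for p
    using normal_below_strings[OF c nb] m that by auto
  have ev: "p \<in> lefts y \<longleftrightarrow> even (p - m)" if "m \<le> p" "p < n" for p
    using that
  proof (induction p rule: nat_induct_at_least)
    case base
    have "\<not> partner y m < m"
      using str[of "partner y m"] closed_belowD[OF c base] str[of m] base
      by (auto simp: strings_iff)
    then show ?case using str[of m] base by (auto simp: strings_iff lefts_iff)
  next
    case (Suc p)
    have ns: "p \<notin> strings y" using str Suc by auto
    show ?case
    proof (cases "p \<in> lefts y")
      case True
      then have "simple_cup p y" using normal_below_simple[OF c nb] Suc by simp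
      then have "partner y (Suc p) = p" using partner_partner[of y p] by (simp add: simple_cup_def del: partner_partner)
      then show ?thesis using True Suc by (auto simp: lefts_iff Suc_diff_le)
    next
      case False
      then have r: "partner y p < p" using ns by (simp add: strings_iff lefts_iff)
      note s = right_simple[OF c nb _ r]
      have e: "partner y p + 2 = Suc p" using s(2) Suc.prems by simp
      then have "Suc p \<in> lefts y"
        using nb s(1) Suc.prems by (metis Suc_lessD normal_below_def)
      then show ?thesis using False Suc by (auto simp: Suc_diff_le)
    qed
  qed
  have "m \<le> p" if "p \<in> lefts y" "p < n" for p
    using that str[of p] by (auto simp: lefts_iff strings_iff)
  then show ?thesis using ev by auto
qed

lemma normal_below_unique:
  assumes "closed_below n x" "normal_below n x" "closed_below n y" "normal_below n y"
    and beyond: "\<And>p. n \<le> p \<Longrightarrow> partner x p = partner y p"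
    and "card (strings x \<inter> {..<n}) = card (strings y \<inter> {..<n})"
  shows "x = y"
proof (rule lefts_inject)
  have "lefts x \<inter> {..<n} = lefts y \<inter> {..<n}"
    using normal_below_lefts[OF assms(1,2) refl] normal_below_lefts[OF assms(3,4) refl] assms(6) by simp
  then have "p \<in> lefts x \<longleftrightarrow> p \<in> lefts y" if "p < n" for p
    using that by (simp add: set_eq_iff) blast
  moreover have "p \<in> lefts x \<longleftrightarrow> p \<in> lefts y" if "\<not> p < n" for p
    using beyond[of p] that by (simp add: lefts_iff)
  ultimately show "lefts x = lefts y" by blast
qed

lemma ex_normal_form:
  assumes "closed_below n y"
  shows "\<exists>z. closed_below n z \<and> normal_below n z \<and> z \<in> reach y \<and> y \<in> reach z \<and>
    (\<forall>p\<ge>n. partner z p = partner y p) \<and> card (strings z \<inter> {..<n}) = card (strings y \<inter> {..<n})"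
  using assms
proof (induction rule: normalize_induct)
  case (normal y)
  then show ?case using reach.start by blast
next
  case (move y k)
  let ?y = "join_at (k + 1) y"
  note nx = join_next[OF move(2), of "k + 1"]
  have "?y \<in> reach y" using nx reach.step[OF reach.start] by blast
  moreover have "y \<in> reach ?y" using nx reach.step[OF reach.start, of k ?y] by simp
  moreover have "card (strings ?y \<inter> {..<n}) = card (strings y \<inter> {..<n})"
    using nx move by (intro card_strings_join_at) (auto intro: closed_belowD)
  moreover have "\<forall>p\<ge>n. partner ?y p = partner y p"
    using join_at_beyond[OF move(1), of "k + 1"] move(3) by simp
  ultimately show ?case using move(5) reach_trans by metis
qed

text \<open>
  Moves preserve the number of strings below \<open>n\<close> and the points beyond \<open>n\<close>. These determine the
  normal form, which is reached reversibly from both sides.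
\<close>

lemma reach_sym_step:
  assumes "\<not> strings_at k x"
  shows "x \<in> reach (join_at k x)"
proof -
  obtain n where n: "k + 1 < n" "closed_below n x" using ex_closed_below by blast
  let ?y = "join_at k x"
  have y: "closed_below n ?y" "\<forall>p\<ge>n. partner ?y p = partner x p"
    "card (strings ?y \<inter> {..<n}) = card (strings x \<inter> {..<n})"
    using closed_below_join_at[OF n(2,1)] join_at_beyond[OF n(2,1)]
      card_strings_join_at(2)[OF assms, of "{..<n}"] closed_belowD[OF n(2)] n(1) by simp_all
  obtain x' where x': "closed_below n x'" "normal_below n x'" "x \<in> reach x'"
    "\<forall>p\<ge>n. partner x' p = partner x p" "card (strings x' \<inter> {..<n}) = card (strings x \<inter> {..<n})"
    using ex_normal_form[OF n(2)] by blast
  obtain y' where y': "closed_below n y'" "normal_below n y'" "y' \<in> reach ?y"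
    "\<forall>p\<ge>n. partner y' p = partner ?y p" "card (strings y' \<inter> {..<n}) = card (strings ?y \<inter> {..<n})"
    using ex_normal_form[OF y(1)] by blast
  have "x' = y'" using x' y' y by (intro normal_below_unique[of n]) auto
  then show ?thesis using x' y' reach_trans by blast
qed

lemma reach_sym: "x \<in> reach w \<Longrightarrow> w \<in> reach x"
  by (induction rule: reach.induct) (auto intro: reach.start reach_sym_step reach_trans)

lemma ex_strings_left:
  assumes "finite (strings w)"
  shows "\<exists>x\<in>reach w. strings x = {..<num_strings w}"
proof -
  obtain n where n: "Max (insert 0 (strings w)) < n" "closed_below n w" using ex_closed_below by blast
  obtain x where x: "closed_below n x" "normal_below n x" "x \<in> reach w"
    "\<forall>p\<ge>n. partner x p = partner w p"
    using ex_normal_form[OF n(2)] by blast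
  have w: "p < n" if "p \<in> strings w" for p
    using that n(1) assms by (meson Max_ge finite_insert insertCI le_less_trans)
  have "p < n" if "p \<in> strings x" for p
    using that x(4) w[of p] by (metis linorder_not_less strings_iff)
  then have "strings x \<inter> {..<n} = strings x" by auto
  then show ?thesis
    using normal_below_strings[OF x(1,2)] reach_strings[OF x(3) assms] x(3) by (auto simp: num_strings_def)
qed

lemma card_lefts:
  assumes c: "closed_below n y"
  shows "n = card (strings y \<inter> {..<n}) + 2 * card (lefts y \<inter> {..<n})"
proof -
  let ?L = "lefts y \<inter> {..<n}" and ?R = "{p. p < n \<and> partner y p < p}"
  have "partner y ` ?L = ?R"
  proof (rule set_eqI)
    fix p
    show "p \<in> partner y ` ?L \<longleftrightarrow> p \<in> ?R"
      using closed_belowD[OF c] by (auto simp: lefts_iff image_iff intro!: bexI[of _ "partner y p"])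
  qed
  moreover have "inj (partner y)" by (rule injI) simp
  ultimately have R: "card ?R = card ?L"
    by (metis card_image inj_on_subset subset_UNIV)
  have "{..<n} = (strings y \<inter> {..<n}) \<union> (?L \<union> ?R)" by (auto simp: strings_iff lefts_iff)
  then have "n = card ((strings y \<inter> {..<n}) \<union> (?L \<union> ?R))" by simp
  also have "\<dots> = card (strings y \<inter> {..<n}) + (card ?L + card ?R)"
    by (subst card_Un_disjoint; (subst card_Un_disjoint)?) (auto simp: strings_iff lefts_iff)
  finally show ?thesis using R by simp
qed

section \<open>Weights of point sets\<close>

text \<open>
  A state is read as a tensor on the points below \<open>n\<close> with coefficient \<open>wt Q z n y S\<close> at the basis
  tensor of \<open>S\<close>. A cup has coefficient \<open>1\<close> at its left and \<open>Q\<close> at its right endpoint. The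
  strings carry the sum over all sets of strings of the basis tensors weighted by \<open>z\<close> to the sum of
  the ranks, which for \<open>Q * z = - 1\<close> is the tensor killed by the caps between neighbouring strings.
\<close>

definition rank :: "link_state \<Rightarrow> nat \<Rightarrow> nat" where
  "rank y p = card (strings y \<inter> {..<p})"

definition loc :: "'r::comm_ring_1 \<Rightarrow> 'r \<Rightarrow> link_state \<Rightarrow> nat set \<Rightarrow> nat \<Rightarrow> 'r" where
  "loc Q z y S p =
     (if partner y p = p then (if p \<in> S then z ^ rank y p else 1)
      else if p \<in> S \<longleftrightarrow> partner y p \<in> S then 0
      else if p \<in> S \<and> partner y p < p then Q else 1)"

definition wt :: "'r::comm_ring_1 \<Rightarrow> 'r \<Rightarrow> nat \<Rightarrow> link_state \<Rightarrow> nat set \<Rightarrow> 'r" where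
  "wt Q z n y S = (\<Prod>p<n. loc Q z y S p)"

lemma wt_zero:
  assumes "p < n" "partner y p \<noteq> p" "p \<in> S \<longleftrightarrow> partner y p \<in> S"
  shows "wt Q z n y S = 0"
proof -
  have "loc Q z y S p = 0" using assms(2,3) by (simp add: loc_def)
  then show ?thesis
    unfolding wt_def using assms(1) by (intro prod_zero bexI[of _ p]) simp_all
qed

lemma wt_split: "finite M \<Longrightarrow> M \<subseteq> {..<n} \<Longrightarrow> wt Q z n y S = prod (loc Q z y S) M * prod (loc Q z y S) ({..<n} - M)"
  unfolding wt_def using prod.subset_diff[of M "{..<n}" "loc Q z y S"] by (simp add: mult.commute)

lemma loc_cong:
  assumes "p \<in> S \<longleftrightarrow> p \<in> S'" "partner y p \<in> S \<longleftrightarrow> partner y p \<in> S'" "partner x p = partner y p"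
    and "partner y p = p \<Longrightarrow> rank x p = rank y p"
  shows "loc Q z x S' p = loc Q z y S p"
proof (cases "partner y p = p")
  case True
  then show ?thesis using assms(1) assms(4)[OF True] unfolding loc_def assms(3) by simp
next
  case False
  then show ?thesis unfolding loc_def assms(1,2,3) by simp
qed

lemma wt_insert_string:
  assumes "p < n" "partner y p = p" "p \<notin> S"
  shows "wt Q z n y (insert p S) = z ^ rank y p * wt Q z n y S"
proof -
  have "partner y r \<noteq> p" if "r \<noteq> p" for r
    using that assms(2) by (metis partner_partner)
  then have "prod (loc Q z y (insert p S)) ({..<n} - {p}) = prod (loc Q z y S) ({..<n} - {p})"
    by (intro prod.cong loc_cong) auto
  then show ?thesis
    using assms wt_split[of "{p}" n Q z y] by (simp add: loc_def)
qed

lemma wt_toggle: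
  assumes y: "simple_cup k y" and k: "k + 1 < n" "k \<notin> S" "k + 1 \<notin> S"
  shows "wt Q z n y (insert (k + 1) S) = Q * wt Q z n y (insert k S)"
proof -
  have p: "partner y k = k + 1" "partner y (k + 1) = k"
    using y partner_partner[of y k] by (auto simp: simple_cup_def simp del: partner_partner)
  then have "partner y r \<noteq> k" "partner y r \<noteq> k + 1" if "r \<noteq> k" "r \<noteq> k + 1" for r
    using that by (metis partner_partner)+
  then have "prod (loc Q z y (insert (k + 1) S)) ({..<n} - {k, k + 1}) = prod (loc Q z y (insert k S)) ({..<n} - {k, k + 1})"
    by (intro prod.cong loc_cong) auto
  moreover have "prod (loc Q z y (insert (k + 1) S)) {k, k + 1} = Q * prod (loc Q z y (insert k S)) {k, k + 1}"
    using p k by (simp add: loc_def)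
  ultimately show ?thesis
    using k by (subst (1 2) wt_split[of "{k, k + 1}"]) (simp_all only: mult.assoc, auto)
qed

text \<open>
  A string lies under no cup, so a string displaced by the move cannot pass the string at \<open>p\<close>.
\<close>

lemma rank_join_at:
  assumes y: "\<not> strings_at k y" and p: "partner y p = p" "p \<noteq> k" "p \<noteq> k + 1"
  shows "rank (join_at k y) p = rank y p"
proof -
  have out: "p < partner y r \<longleftrightarrow> p < r" "p \<noteq> partner y r" if "r = k \<or> r = k + 1" for r
    using below_cup[of r p y] below_cup[of "partner y r" p y] that p
    by (metis linorder_neqE_nat partner_partner)+
  show ?thesis
  proof (cases "p < k")
    case True
    have "strings (join_at k y) \<inter> {..<p} = strings y \<inter> {..<p}"
      using True out[of k] out[of "k + 1"] by (auto simp: strings_join_at[OF y])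
    then show ?thesis by (simp add: rank_def)
  next
    case False
    then have "k + 1 < p" using p by simp
    then show ?thesis
      unfolding rank_def using out[of k] out[of "k + 1"]
      by (intro card_strings_join_at y) auto
  qed
qed

lemma below_cup_no_strings:
  assumes "a < partner y a"
  shows "strings y \<inter> {a..partner y a} = {}"
proof -
  have False if "p \<in> strings y" "a \<le> p" "p \<le> partner y a" for p
  proof -
    have "partner y p = p" using that by (simp add: strings_iff)
    then have "p \<noteq> a" "p \<noteq> partner y a" using assms by (metis less_irrefl partner_partner)+
    then show False using below_cup(3)[of a p y] that \<open>partner y p = p\<close> by simp
  qed
  then show ?thesis by auto
qed

text \<open>
  Capping the points \<open>k, k + 1\<close> of the weight function of a state gives the weight function of
  the state acted upon: the coefficients of cups and caps satisfy the zigzag identity, and a closed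
  loop evaluates to \<open>Q - z\<close>.
\<close>

lemma wt_cap:
  fixes Q z :: "'r::comm_ring_1"
  assumes Qz: "Q * z = - 1" and c: "closed_below n y" and k: "k + 1 < n" "k \<notin> S" "k + 1 \<notin> S"
  shows "strings_at k y \<Longrightarrow> wt Q z n y (insert (k + 1) S) - z * wt Q z n y (insert k S) = 0"
    and "simple_cup k y \<Longrightarrow> wt Q z n y (insert (k + 1) S) - z * wt Q z n y (insert k S)
      = (Q - z) * wt Q z n y (insert k S)"
    and "\<not> strings_at k y \<Longrightarrow> \<not> simple_cup k y \<Longrightarrow>
      wt Q z n y (insert (k + 1) S) - z * wt Q z n y (insert k S) = wt Q z n (join_at k y) (insert k S)"
proof -
  assume s: "strings_at k y"
  then have "strings y \<inter> {..<k + 1} = insert k (strings y \<inter> {..<k})"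
    by (auto simp: strings_at_iff strings_iff)
  then have "rank y (k + 1) = Suc (rank y k)" by (simp add: rank_def)
  then show "wt Q z n y (insert (k + 1) S) - z * wt Q z n y (insert k S) = 0"
    using s k by (simp add: strings_at_iff wt_insert_string)
next
  assume "simple_cup k y"
  then show "wt Q z n y (insert (k + 1) S) - z * wt Q z n y (insert k S) = (Q - z) * wt Q z n y (insert k S)"
    using wt_toggle[OF _ k] by (simp add: algebra_simps)
next
  assume ns: "\<not> strings_at k y" "\<not> simple_cup k y"
  define a b where "a = partner y k" and "b = partner y (k + 1)"
  define x where "x = join_at k y"
  let ?M = "{k, k + 1, a, b}"
  have ab: "partner y a = k" "partner y b = k + 1" "partner y k = a" "partner y (k + 1) = b"
    by (simp_all add: a_def b_def)
  have lt: "a < n" "b < n" using c k by (simp_all add: a_def b_def closed_belowD)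
  have ne: "a \<noteq> k + 1" "b \<noteq> k" "a \<noteq> b"
    using ns ab partner_partner[of y b] by (auto simp: simple_cup_def simp del: partner_partner)
  have M: "finite ?M" "?M \<subseteq> {..<n}" using k lt by auto
  have x_eq: "partner x p = (if p = k then k + 1 else if p = k + 1 then k
      else if p = a then (if b = k + 1 then p else b)
      else if p = b then (if a = k then p else a) else partner y p)" for p
    by (simp only: x_def partner_join_at a_def b_def)
  have xp: "partner x k = k + 1" "partner x (k + 1) = k"
    "partner x a = (if a = k then k + 1 else if b = k + 1 then a else b)"
    "partner x b = (if b = k + 1 then k else if a = k then b else a)"
    using ne by (auto simp: x_eq)
  have out: "partner y p \<noteq> k" "partner y p \<noteq> k + 1" "partner x p = partner y p" if "p \<notin> ?M" for p
  proof -
    show "partner y p \<noteq> k" "partner y p \<noteq> k + 1"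
      using that unfolding a_def b_def by (metis insertCI partner_partner)+
    show "partner x p = partner y p"
      using that by (simp add: x_eq)
  qed
  have r1: "prod (loc Q z y (insert (k + 1) S)) ({..<n} - ?M) = prod (loc Q z y (insert k S)) ({..<n} - ?M)"
    using out by (intro prod.cong loc_cong) auto
  have r2: "prod (loc Q z x (insert k S)) ({..<n} - ?M) = prod (loc Q z y (insert k S)) ({..<n} - ?M)"
  proof (rule prod.cong[OF refl])
    fix p assume p: "p \<in> {..<n} - ?M"
    then have "rank x p = rank y p" if "partner y p = p"
      unfolding x_def using rank_join_at[OF ns(1) that] by auto
    with p show "loc Q z x (insert k S) p = loc Q z y (insert k S) p"
      using out(3)[of p] by (intro loc_cong) blast+
  qed
  have m: "prod (loc Q z y (insert (k + 1) S)) ?M - z * prod (loc Q z y (insert k S)) ?M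
      = prod (loc Q z x (insert k S)) ?M"
  proof -
    have zQ: "z * Q = - 1" "z * (Q * u) = - u" "Q * (z * u) = - u" "z * (u * Q) = - u" for u
    proof -
      show "z * Q = - 1" using Qz by (simp add: mult.commute)
      then show "z * (Q * u) = - u" "Q * (z * u) = - u" "z * (u * Q) = - u"
        by (simp_all add: mult.assoc[symmetric] Qz mult.left_commute[of z u] mult.commute[of u])
    qed
    consider (s1) "a = k" "k + 1 < b" | (s2) "b = k + 1" "a < k" | (c1) "a < k" "k + 1 < b"
      | (c2) "b < a" "a < k" | (c3) "k + 1 < b" "b < a"
    proof -
      consider "a = k" | "a < k" | "k < a" by linarith
      then show thesis
      proof cases
        case 1
        then have "b \<noteq> k + 1" using ns(1) ab by (auto simp: strings_at_iff)
        moreover have "\<not> b < k" using below_cup(3)[of b k y] ab 1 by auto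
        ultimately show thesis using s1[OF 1] ne by linarith
      next
        case 2
        have "\<not> (a < b \<and> b < k)" using below_cup(2)[of a b y] ab by auto
        then show thesis using s2 c1 c2 2 ne by linarith
      next
        case 3
        then have "k + 1 < a" using ne by linarith
        then show thesis using below_cup[of k "k + 1" y] ab c3 by auto
      qed
    qed
    then show ?thesis
    proof cases
      case s1
      have "strings y \<inter> {k + 1..b} = {}"
        using below_cup_no_strings[of "k + 1" y] s1 ab by simp
      then have "strings y \<inter> {..<b} = insert k (strings y \<inter> {..<k})"
        using s1 ab by (fastforce simp: strings_iff)
      moreover have "strings x \<inter> {..<b} = (strings y \<inter> {..<b}) - {k}"
        using s1 strings_join_at[OF ns(1)] ab by (auto simp: x_def strings_iff)
      ultimately have "strings x \<inter> {..<b} = strings y \<inter> {..<k}" by auto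
      then have "rank x b = rank y k" by (simp add: rank_def)
      moreover have "?M = {k, k + 1, b}" using s1 by auto
      ultimately show ?thesis
        using s1 ab xp k by (auto simp: loc_def zQ)
    next
      case s2
      have "strings y \<inter> {a..k} = {}"
        using below_cup_no_strings[of a y] s2 ab by simp
      then have "strings y \<inter> {..<k + 1} = strings y \<inter> {..<a}"
        using s2 by fastforce
      moreover have "strings x \<inter> {..<a} = strings y \<inter> {..<a}"
        using s2 strings_join_at[OF ns(1)] ab by (auto simp: x_def strings_iff)
      ultimately have "strings x \<inter> {..<a} = strings y \<inter> {..<k + 1}" by simp
      then have "rank x a = rank y (k + 1)" by (simp add: rank_def)
      moreover have "?M = {k, k + 1, a}" using s2 by auto
      ultimately show ?thesis
        using s2 ab xp k by (auto simp: loc_def zQ)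
    next
      case c1
      then show ?thesis using ab xp k by (auto simp: loc_def zQ)
    next
      case c2
      then show ?thesis using ab xp k by (auto simp: loc_def zQ)
    next
      case c3
      then show ?thesis using ab xp k by (auto simp: loc_def zQ)
    qed
  qed
  show "wt Q z n y (insert (k + 1) S) - z * wt Q z n y (insert k S) = wt Q z n (join_at k y) (insert k S)"
    unfolding wt_split[OF M] x_def[symmetric] r1 r2 m[symmetric] by (simp add: algebra_simps)
qed

text \<open>
  Summing the weights against \<open>z ^ \<Sum>S\<close> is the pairing with a divided power of the raising
  operator, which kills every cup: the two sets meeting a simple cup once cancel.
\<close>

lemma wt_sum_all:
  fixes Q z :: "'r::comm_ring_1"
  assumes Qz: "Q * z = - 1" and y: "simple_cup k y" and k: "k + 1 < n"
  shows "(\<Sum>S | S \<subseteq> {..<n} \<and> card S = c. z ^ \<Sum>S * wt Q z n y S) = 0"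
proof -
  let ?A = "{S. S \<subseteq> {..<n} \<and> card S = c}" and ?t = "\<lambda>S. z ^ \<Sum>S * wt Q z n y S"
  let ?B = "{S \<in> ?A. k \<in> S \<and> k + 1 \<notin> S}" and ?C = "{S \<in> ?A. k \<notin> S \<and> k + 1 \<in> S}"
  have p: "partner y k = k + 1" using y by (simp add: simple_cup_def)
  have fin: "finite S" if "S \<in> ?A" for S using that finite_subset by blast
  have "finite ?A" by (rule finite_subset[of _ "Pow {..<n}"]) auto
  have "sum ?t ?A = sum ?t (?B \<union> ?C)"
  proof (rule sum.mono_neutral_right[OF \<open>finite ?A\<close>])
    show "\<forall>S\<in>?A - (?B \<union> ?C). ?t S = 0"
    proof
      fix S assume "S \<in> ?A - (?B \<union> ?C)"
      then have "k \<in> S \<longleftrightarrow> partner y k \<in> S" unfolding p by blast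
      then have "wt Q z n y S = 0" by (rule wt_zero[rotated 2]) (use k p in simp_all)
      then show "?t S = 0" by simp
    qed
  qed auto
  also have "\<dots> = sum ?t ?B + sum ?t ?C"
    using \<open>finite ?A\<close> by (intro sum.union_disjoint) auto
  also have "sum ?t ?C = (\<Sum>S\<in>?B. - ?t S)"
  proof (rule sum.reindex_bij_witness[where i = "\<lambda>S. insert (k + 1) (S - {k})" and j = "\<lambda>S. insert k (S - {k + 1})"])
    fix S assume S: "S \<in> ?C"
    then have f: "finite S" using fin by blast
    define R where "R = S - {k + 1}"
    have R: "S = insert (k + 1) R" "k \<notin> R" "k + 1 \<notin> R" "finite R"
      using S f by (auto simp: R_def)
    show "insert (k + 1) (insert k (S - {k + 1}) - {k}) = S" using S by auto
    have "card (insert k (S - {k + 1})) = card S"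
      using card_swap[of S "k + 1" k] S f by simp
    then show "insert k (S - {k + 1}) \<in> ?B" using S k by auto
    define m W where "m = \<Sum>(insert k R)" and "W = wt Q z n y (insert k R)"
    have "\<Sum>S = Suc m" unfolding m_def R(1) using R(2-4) by simp
    moreover have "wt Q z n y S = Q * W" unfolding W_def R(1) by (rule wt_toggle[OF y k R(2,3)])
    ultimately have "?t S = z ^ m * (Q * z) * W" by (simp add: mult_ac)
    also have "\<dots> = - ?t (insert k R)" by (simp add: Qz m_def W_def)
    finally have "- ?t (insert k R) = ?t S" by simp
    then show "- ?t (insert k (S - {k + 1})) = ?t S" by (simp add: R_def)
  next
    fix S assume S: "S \<in> ?B"
    then have f: "finite S" using fin by blast
    show "insert k (insert (k + 1) (S - {k}) - {k + 1}) = S" using S by auto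
    have "card (insert (k + 1) (S - {k})) = card S"
      using card_swap[of S k "k + 1"] S f by simp
    then show "insert (k + 1) (S - {k}) \<in> ?C" using S k by auto
  qed
  finally show ?thesis by (simp add: sum_negf)
qed

lemma ex_simple_cup:
  assumes c: "closed_below n y" and a: "a \<in> lefts y" "a < n"
  shows "\<exists>k. simple_cup k y \<and> k + 1 < n"
proof -
  define b where "b = Max (lefts y \<inter> {..<n})"
  have b: "b \<in> lefts y \<inter> {..<n}" unfolding b_def using a by (intro Max_in) auto
  have "b + 1 < n" using b closed_belowD[OF c, of b] by (auto simp: lefts_iff)
  moreover have "b + 1 \<notin> lefts y"
  proof
    assume "b + 1 \<in> lefts y"
    then have "b + 1 \<le> b" unfolding b_def using \<open>b + 1 < n\<close> b_def by (intro Max_ge) auto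
    then show False by simp
  qed
  ultimately show ?thesis using simple_cup_lefts b by blast
qed

lemma downset_eq:
  assumes f: "finite S" and down: "\<And>p. Suc p \<in> S \<Longrightarrow> p \<in> S"
  shows "S = {..<card S}"
proof -
  define m where "m = (LEAST a. a \<notin> S)"
  have m: "m \<notin> S" unfolding m_def using ex_new_if_finite[OF infinite_UNIV_nat f] by (rule LeastI_ex)
  have "p \<notin> S" if "m \<le> p" for p
    using that m down by (induction p rule: dec_induct) auto
  moreover have "r \<in> S" if "r < m" for r
    using that not_less_Least unfolding m_def by blast
  ultimately have "S = {..<m}" by (auto simp: not_le[symmetric])
  then show ?thesis by simp
qed

text \<open>
  The left side is the raising operator evaluated at an initial segment. A cup inside the segment makes
  both sides zero. For a cup beyond it, all terms vanish except for a simple cup, whose two endpoints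
  contribute opposite terms. Otherwise each cup begins in the segment and ends beyond it, hence
  the strings beyond the segment come last, and their weights form a geometric sum.
\<close>

lemma wt_sum_initial:
  fixes Q z :: "'r::comm_ring_1"
  assumes Qz: "Q * z = - 1" and c: "closed_below n y" and d: "d = card (lefts y \<inter> {..<n})" and "\<tau> \<le> n"
  shows "(\<Sum>p = \<tau>..<n. z ^ p * wt Q z n y (insert p {..<\<tau>}))
    = z ^ (2 * \<tau>) * (\<Sum>r<n - d - \<tau>. z ^ (2 * r)) * wt Q z n y {..<\<tau>}"
proof -
  let ?w = "\<lambda>p. wt Q z n y (insert p {..<\<tau>})"
  consider (full) a where "a < \<tau>" "partner y a \<noteq> a" "partner y a < \<tau>"
    | (missed) a where "\<tau> \<le> a" "a < partner y a" "a < n"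
    | (hit) "\<And>p. p < n \<Longrightarrow> partner y p \<noteq> p \<Longrightarrow> p < \<tau> \<longleftrightarrow> \<not> partner y p < \<tau>"
  proof -
    have "\<exists>a. a < \<tau> \<and> partner y a \<noteq> a \<and> partner y a < \<tau> \<or> \<tau> \<le> a \<and> a < partner y a \<and> a < n"
      if "p < n" "partner y p \<noteq> p" "\<not> (p < \<tau> \<longleftrightarrow> \<not> partner y p < \<tau>)" for p
    proof (cases "p < \<tau>")
      case True
      then show ?thesis using that by blast
    next
      case False
      then have f: "\<tau> \<le> p" "\<tau> \<le> partner y p" using that(3) by linarith+
      show ?thesis
      proof (cases "p < partner y p")
        case True
        then show ?thesis using f that(1) by blast
      next
        case False
        then have "partner y p < p" using that(2) by linarith
        then show ?thesis using f that(1) by (intro exI[of _ "partner y p"]) simp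
      qed
    qed
    then show thesis using full missed hit by blast
  qed
  then show ?thesis
  proof cases
    case full
    have "wt Q z n y S = 0" if "{..<\<tau>} \<subseteq> S" for S
      using wt_zero[of a n y S Q z] full that \<open>\<tau> \<le> n\<close> by auto
    then have "?w p = 0" "wt Q z n y {..<\<tau>} = 0" for p by auto
    then show ?thesis by simp
  next
    case missed
    have na: "partner y a < n" using missed closed_belowD[OF c] by blast
    have rhs: "wt Q z n y {..<\<tau>} = 0"
      using wt_zero[of a n y "{..<\<tau>}" Q z] missed by auto
    have other: "?w p = 0" if "p \<noteq> a" "p \<noteq> partner y a" for p
      using wt_zero[of a n y "insert p {..<\<tau>}" Q z] missed that by auto
    have "(\<Sum>p = \<tau>..<n. z ^ p * ?w p) = 0"
    proof (cases "partner y a = a + 1")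
      case True
      have "simple_cup a y" using True by (simp add: simple_cup_def)
      then have t: "?w (a + 1) = Q * ?w a"
        using missed na True by (intro wt_toggle) auto
      have "(\<Sum>p = \<tau>..<n. z ^ p * ?w p) = (\<Sum>p\<in>{a, a + 1}. z ^ p * ?w p)"
        using missed na True other by (intro sum.mono_neutral_right) auto
      also have "\<dots> = z ^ a * ?w a + z ^ (a + 1) * ?w (a + 1)" by simp
      also have "\<dots> = z ^ a * ?w a + z ^ a * (Q * z) * ?w a" unfolding t by (simp add: mult_ac)
      also have "\<dots> = 0" by (simp add: Qz)
      finally show ?thesis .
    next
      case False
      define e where "e = a + 1"
      have e: "a < e" "e < partner y a" using False missed by (auto simp: e_def)
      note be = below_cup[OF e]
      have "?w p = 0" for p
      proof (cases "p = a \<or> p = partner y a")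
        case True
        have "e < n" "partner y e \<noteq> e" using e na be by auto
        moreover have "e \<notin> insert p {..<\<tau>}" "partner y e \<notin> insert p {..<\<tau>}"
          using True e be missed by auto
        ultimately show ?thesis using wt_zero[of e n y "insert p {..<\<tau>}" Q z] by blast
      qed (use other in blast)
      then show ?thesis by simp
    qed
    then show ?thesis using rhs by simp
  next
    case hit
    let ?L = "lefts y \<inter> {..<n}" and ?N = "{p. \<tau> \<le> p \<and> p < n \<and> partner y p \<noteq> p}"
    have L: "a < \<tau>" "\<tau> \<le> partner y a" "partner y a < n" if "a \<in> ?L" for a
      using that hit[of a] closed_belowD[OF c, of a] by (auto simp: lefts_iff)
    have "d \<le> \<tau>"
      unfolding d using card_mono[of "{..<\<tau>}" ?L] L(1) by (simp add: subset_iff)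
    have "partner y ` ?L = ?N"
    proof (intro equalityI subsetI)
      fix p assume "p \<in> partner y ` ?L"
      then show "p \<in> ?N" using L by (auto simp: lefts_iff)
    next
      fix p assume p: "p \<in> ?N"
      then have "partner y p < \<tau>" using hit[of p] by auto
      then have "partner y p \<in> ?L" using p by (auto simp: lefts_iff)
      then show "p \<in> partner y ` ?L" by (metis imageI partner_partner)
    qed
    moreover have "inj_on (partner y) ?L" by (rule inj_onI) simp
    ultimately have cN: "card ?N = d" unfolding d by (metis card_image)
    have "p \<in> {..<\<tau>} \<union> ?N" if "Suc p \<in> {..<\<tau>} \<union> ?N" for p
    proof (cases "p < \<tau>")
      case False
      then have sp: "\<tau> \<le> p" "Suc p < n" "partner y (Suc p) \<noteq> Suc p" using that by auto
      then have "partner y (Suc p) < \<tau>" using hit[of "Suc p"] by auto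
      then have "partner y p \<noteq> p" using below_cup(3)[of "partner y (Suc p)" p y] sp by simp
      then show ?thesis using sp by simp
    qed simp
    then have "{..<\<tau>} \<union> ?N = {..<card ({..<\<tau>} \<union> ?N)}" by (intro downset_eq) auto
    also have "card ({..<\<tau>} \<union> ?N) = \<tau> + d"
      using cN by (subst card_Un_disjoint) auto
    finally have N: "{..<\<tau>} \<union> ?N = {..<\<tau> + d}" .
    have str: "partner y p = p \<longleftrightarrow> p \<in> {d + \<tau>..<n}" if "\<tau> \<le> p" "p < n" for p
    proof -
      have "p \<in> {..<\<tau>} \<union> ?N \<longleftrightarrow> p < \<tau> + d" unfolding N by simp
      then show ?thesis using that by auto
    qed
    have "{..<\<tau>} \<union> ?N \<subseteq> {..<n}" using \<open>\<tau> \<le> n\<close> by auto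
    then have dn: "\<tau> + d \<le> n" unfolding N by simp
    have rank: "rank y p = p - 2 * d" if p: "d + \<tau> \<le> p" "p \<le> n" for p
    proof -
      have u: "strings y \<inter> {..<n} = strings y \<inter> {..<p} \<union> {p..<n}"
      proof (rule set_eqI)
        fix r
        show "r \<in> strings y \<inter> {..<n} \<longleftrightarrow> r \<in> strings y \<inter> {..<p} \<union> {p..<n}"
          using str[of r] p by (cases "r < p") (auto simp: strings_iff)
      qed
      have "card (strings y \<inter> {..<p} \<union> {p..<n}) = card (strings y \<inter> {..<p}) + card {p..<n}"
        by (rule card_Un_disjoint) auto
      then have "card (strings y \<inter> {..<n}) = rank y p + (n - p)"
        unfolding u rank_def by simp
      then show ?thesis using card_lefts[OF c] d p by simp
    qed
    have w: "?w p = (if partner y p = p then z ^ rank y p * wt Q z n y {..<\<tau>} else 0)"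
      if "\<tau> \<le> p" "p < n" for p
    proof (cases "partner y p = p")
      case True
      then show ?thesis using wt_insert_string[of p n y "{..<\<tau>}" Q z] that by simp
    next
      case False
      then have "partner y p < \<tau>" using hit[of p] that by auto
      then show ?thesis using wt_zero[of p n y "insert p {..<\<tau>}" Q z] False that by auto
    qed
    have "(\<Sum>p = \<tau>..<n. z ^ p * ?w p) = (\<Sum>p = d + \<tau>..<n. z ^ p * (z ^ (p - 2 * d) * wt Q z n y {..<\<tau>}))"
    proof (rule sum.mono_neutral_cong_right)
      show "\<forall>p\<in>{\<tau>..<n} - {d + \<tau>..<n}. z ^ p * ?w p = 0"
        "\<And>p. p \<in> {d + \<tau>..<n} \<Longrightarrow> z ^ p * ?w p = z ^ p * (z ^ (p - 2 * d) * wt Q z n y {..<\<tau>})"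
        by (auto simp: w rank str)
    qed auto
    also have "\<dots> = (\<Sum>r<n - d - \<tau>. z ^ (d + \<tau> + r) * (z ^ (\<tau> - d + r) * wt Q z n y {..<\<tau>}))"
      by (rule sum.reindex_bij_witness[where i = "\<lambda>r. d + \<tau> + r" and j = "\<lambda>p. p - (d + \<tau>)"])
        (use \<open>d \<le> \<tau>\<close> in \<open>auto simp: mult_2\<close>)
    also have "\<dots> = (\<Sum>r<n - d - \<tau>. z ^ (2 * \<tau>) * z ^ (2 * r) * wt Q z n y {..<\<tau>})"
    proof (rule sum.cong[OF refl])
      fix r
      have "z ^ (d + \<tau> + r) * z ^ (\<tau> - d + r) = z ^ (2 * \<tau>) * z ^ (2 * r)"
        unfolding power_add[symmetric] using \<open>d \<le> \<tau>\<close> by (intro arg_cong[of _ _ "(^) z"]) simp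
      then show "z ^ (d + \<tau> + r) * (z ^ (\<tau> - d + r) * wt Q z n y {..<\<tau>}) = z ^ (2 * \<tau>) * z ^ (2 * r) * wt Q z n y {..<\<tau>}"
        by (simp only: mult.assoc[symmetric])
    qed
    finally show ?thesis by (simp only: sum_distrib_left sum_distrib_right)
  qed
qed

text \<open>
  Shifting the points of \<open>S\<close> to the left one step at a time ends at the initial segment, and each step
  costs a factor \<open>z\<close>.
\<close>

lemma symmetric_value:
  fixes H :: "nat set \<Rightarrow> 'r::comm_ring_1"
  assumes cap: "\<And>S k. k + 1 < n \<Longrightarrow> S \<subseteq> {..<n} \<Longrightarrow> k \<notin> S \<Longrightarrow> k + 1 \<notin> S \<Longrightarrow> card (insert k S) = c \<Longrightarrow>
      H (insert (k + 1) S) = z * H (insert k S)"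
    and "S \<subseteq> {..<n}" "card S = c"
  shows "z ^ \<Sum>{..<c} * H S = z ^ \<Sum>S * H {..<c}"
  using assms(2,3)
proof (induction "\<Sum>S" arbitrary: S rule: less_induct)
  case less
  have f: "finite S" using less.prems(1) finite_subset by blast
  show ?case
  proof (cases "\<exists>p. Suc p \<in> S \<and> p \<notin> S")
    case True
    then obtain k where k: "Suc k \<in> S" "k \<notin> S" by blast
    define R where "R = S - {k + 1}"
    have R: "S = insert (k + 1) R" "k \<notin> R" "k + 1 \<notin> R" "finite R" "R \<subseteq> {..<n}"
      using k f less.prems by (auto simp: R_def)
    have cR: "card (insert k R) = c" using R less.prems(2) by simp
    have s: "\<Sum>S = Suc (\<Sum>(insert k R))" using R by simp
    have "z ^ \<Sum>{..<c} * H (insert k R) = z ^ \<Sum>(insert k R) * H {..<c}"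
      using less.hyps[of "insert k R"] s cR R less.prems(1) by auto
    moreover have "H S = z * H (insert k R)"
      unfolding R(1) using less.prems(1) R cR by (intro cap) auto
    ultimately show ?thesis
      unfolding s by (simp add: mult.left_commute mult.assoc)
  next
    case False
    then have "S = {..<card S}" using downset_eq[OF f] by blast
    then show ?thesis using less.prems(2) by simp
  qed
qed

lemma wt_replace:
  assumes nz: "wt Q z n y S \<noteq> 0"
  defines "g \<equiv> \<lambda>a. if a \<in> S then a else partner y a"
  shows "g ` (lefts y \<inter> {..<n}) \<subseteq> S" "inj_on g (lefts y \<inter> {..<n})"
proof -
  have hit: "p \<in> S \<longleftrightarrow> partner y p \<notin> S" if "p < n" "partner y p \<noteq> p" for p
    using wt_zero[OF that] nz by blast
  show "g ` (lefts y \<inter> {..<n}) \<subseteq> S" using hit by (auto simp: g_def lefts_iff)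
  show "inj_on g (lefts y \<inter> {..<n})"
  proof (rule inj_onI)
    fix a b assume ab: "a \<in> lefts y \<inter> {..<n}" "b \<in> lefts y \<inter> {..<n}" "g a = g b"
    have "a \<noteq> partner y b" "b \<noteq> partner y a"
      using ab by (auto simp: lefts_iff)
    then show "a = b" using ab(3) by (auto simp: g_def split: if_splits)
  qed
qed

lemma wt_few_points:
  assumes "finite S" "card S < card (lefts y \<inter> {..<n})"
  shows "wt Q z n y S = 0"
proof (rule ccontr)
  assume "wt Q z n y S \<noteq> 0"
  from card_inj_on_le[OF wt_replace(2,1)[OF this] assms(1)] assms(2) show False by simp
qed

text \<open>
  Nonzero weight at a set with as many points as there are cups forces the set to contain exactly one
  endpoint of each cup and no string, and the left endpoints have the smallest sum. This is the
  triangularity behind linear independence.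
\<close>

lemma wt_support:
  assumes c: "closed_below n y" and S: "S \<subseteq> {..<n}" "card S = card (lefts y \<inter> {..<n})"
    and nz: "wt Q z n y S \<noteq> 0"
  shows "\<Sum>(lefts y \<inter> {..<n}) \<le> \<Sum>S" "\<Sum>(lefts y \<inter> {..<n}) = \<Sum>S \<Longrightarrow> S = lefts y \<inter> {..<n}"
proof -
  let ?L = "lefts y \<inter> {..<n}"
  define g where "g = (\<lambda>a. if a \<in> S then a else partner y a)"
  note gS = wt_replace(1)[OF nz, folded g_def] and inj = wt_replace(2)[OF nz, folded g_def]
  have f: "finite S" using S(1) finite_subset by blast
  have img: "g ` ?L = S"
    using f gS by (rule card_subset_eq) (simp add: card_image[OF inj] S(2))
  have le: "a \<le> g a" if "a \<in> ?L" for a using that by (auto simp: g_def lefts_iff)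
  have sum: "\<Sum>S = sum g ?L"
    unfolding img[symmetric] by (simp add: sum.reindex[OF inj])
  show "\<Sum>?L \<le> \<Sum>S" unfolding sum using le by (rule sum_mono)
  assume eq: "\<Sum>?L = \<Sum>S"
  have "g a = a" if "a \<in> ?L" for a
  proof (rule ccontr)
    assume "g a \<noteq> a"
    then have "a < g a" using le[OF that] by simp
    then have "\<Sum>?L < sum g ?L" using le that by (intro sum_strict_mono_ex1) auto
    then show False using eq sum by simp
  qed
  then have "g ` ?L = ?L" by simp
  then show "S = ?L" using img by simp
qed

lemma wt_lefts:
  assumes c: "closed_below n y"
  shows "wt Q z n y (lefts y \<inter> {..<n}) = 1"
  unfolding wt_def
proof (intro prod.neutral ballI)
  fix p assume p: "p \<in> {..<n}"
  then have "partner y p < n" using closed_belowD[OF c] by blast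
  then show "loc Q z y (lefts y \<inter> {..<n}) p = 1"
    using p by (auto simp: loc_def lefts_iff)
qed

section \<open>Weight functions of vectors\<close>

text \<open>
  The ring homomorphism \<open>h\<close> allows \<open>Q\<close> to be deformed: it is the identity of the complex numbers or
  their inclusion into the dual numbers.
\<close>

locale weighting =
  fixes h :: "complex \<Rightarrow> 'r::comm_ring_1" and Q z :: 'r and n :: nat
  assumes Qz: "Q * z = - 1"
    and h_add: "h (a + b) = h a + h b" and h_mult: "h (a * b) = h a * h b" and h_one: "h 1 = 1"
begin

lemma h_zero: "h 0 = 0"
  using h_add[of 0 0] by simp

definition F :: "link_space \<Rightarrow> nat set \<Rightarrow> 'r" where
  "F v S = (\<Sum>y\<in>supp v. h (coeff v y) * wt Q z n y S)"

lemma F_add: "F (u + v) S = F u S + F v S"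
  unfolding F_def by (rule setsum_keys_plus_distrib) (simp_all add: h_zero h_add ring_distribs)

lemma F_pscale: "F (pscale c v) S = h c * F v S"
  unfolding F_def by (subst sum_keys_pscale) (simp_all add: h_zero h_mult sum_distrib_left mult.assoc)

lemma F_zero: "F 0 S = 0"
  by (simp add: F_def)

lemma F_minus: "F (u - v) S = F u S - F v S"
  using F_add[of "u - v" v S] by simp

lemma F_basis: "F (basis y) S = wt Q z n y S"
  by (simp add: F_def h_one)

lemma F_sum: "F (\<Sum>x\<in>A. f x) S = (\<Sum>x\<in>A. F (f x) S)"
  by (induction A rule: infinite_finite_induct) (simp_all add: F_zero F_add)

text \<open>The loop weight \<open>Q - z\<close> may differ from \<open>\<delta>\<close>, and then the derivative of the action enters.\<close>

lemma F_cap: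
  assumes c: "\<And>y. y \<in> supp v \<Longrightarrow> closed_below n y" and k: "k + 1 < n" "k \<notin> S" "k + 1 \<notin> S"
  shows "F v (insert (k + 1) S) - z * F v (insert k S)
    = F (e_op \<delta> k v) (insert k S) + (Q - z - h \<delta>) * F (simple_cup_part k v) (insert k S)"
proof -
  let ?D = "\<lambda>v. F v (insert (k + 1) S) - z * F v (insert k S)"
  let ?G = "\<lambda>v. F (e_op \<delta> k v) (insert k S) + (Q - z - h \<delta>) * F (simple_cup_part k v) (insert k S)"
  show ?thesis
  proof (rule linear_eqI[where s = "\<lambda>c. (*) (h c)" and B = "supp v" and f = ?D and g = ?G and v = v])
    fix y assume "y \<in> supp v"
    then show "?D (basis y) = ?G (basis y)"
    proof -
      note cap = wt_cap[OF Qz c[OF \<open>y \<in> _\<close>] k]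
      consider "strings_at k y" "\<not> simple_cup k y" | "simple_cup k y"
        | "\<not> strings_at k y" "\<not> simple_cup k y"
        using simple_not_strings by blast
      then show ?thesis
      proof cases
        case 1
        then show ?thesis using cap(1) by (simp add: F_zero F_basis e_op_eqs simple_cup_part_basis)
      next
        case 2
        then show ?thesis
          using cap(2) by (simp add: F_zero F_basis e_op_eqs simple_cup_part_basis F_pscale ring_distribs del: pscale_single)
      next
        case 3
        then show ?thesis using cap(3) by (simp add: F_zero F_basis e_op_eqs simple_cup_part_basis)
      qed
    qed
  qed (simp_all add: F_add F_pscale e_op_add e_op_pscale simple_cup_part_add simple_cup_part_pscale ring_distribs mult.left_commute)
qed

lemma F_sum_all:
  assumes "\<And>y. y \<in> supp v \<Longrightarrow> \<exists>k. simple_cup k y \<and> k + 1 < n"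
  shows "(\<Sum>S | S \<subseteq> {..<n} \<and> card S = c. z ^ \<Sum>S * F v S) = 0"
proof -
  have "(\<Sum>S | S \<subseteq> {..<n} \<and> card S = c. z ^ \<Sum>S * F v S)
    = (\<Sum>y\<in>supp v. \<Sum>S | S \<subseteq> {..<n} \<and> card S = c. h (coeff v y) * (z ^ \<Sum>S * wt Q z n y S))"
    unfolding F_def sum_distrib_left by (subst sum.swap) (simp add: mult.left_commute)
  also have "\<dots> = 0"
  proof (rule sum.neutral, rule ballI)
    fix y assume "y \<in> supp v"
    then obtain k where "simple_cup k y" "k + 1 < n" using assms by blast
    from wt_sum_all[OF Qz this]
    show "(\<Sum>S | S \<subseteq> {..<n} \<and> card S = c. h (coeff v y) * (z ^ \<Sum>S * wt Q z n y S)) = 0"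
      by (simp add: sum_distrib_left[symmetric])
  qed
  finally show ?thesis .
qed

lemma F_sum_initial:
  assumes c: "\<And>y. y \<in> supp v \<Longrightarrow> closed_below n y \<and> card (lefts y \<inter> {..<n}) = d" and "\<tau> \<le> n"
  shows "(\<Sum>p = \<tau>..<n. z ^ p * F v (insert p {..<\<tau>}))
    = z ^ (2 * \<tau>) * (\<Sum>r<n - d - \<tau>. z ^ (2 * r)) * F v {..<\<tau>}"
proof -
  have "(\<Sum>p = \<tau>..<n. z ^ p * F v (insert p {..<\<tau>}))
    = (\<Sum>y\<in>supp v. h (coeff v y) * (\<Sum>p = \<tau>..<n. z ^ p * wt Q z n y (insert p {..<\<tau>})))"
    unfolding F_def sum_distrib_left by (subst sum.swap) (simp add: mult.left_commute)
  also have "\<dots> = (\<Sum>y\<in>supp v. z ^ (2 * \<tau>) * (\<Sum>r<n - d - \<tau>. z ^ (2 * r)) * (h (coeff v y) * wt Q z n y {..<\<tau>}))"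
    using wt_sum_initial[OF Qz _ _ \<open>\<tau> \<le> n\<close>] c by (intro sum.cong) (simp_all add: mult_ac)
  also have "\<dots> = z ^ (2 * \<tau>) * (\<Sum>r<n - d - \<tau>. z ^ (2 * r)) * F v {..<\<tau>}"
    unfolding F_def by (rule sum_distrib_left[symmetric])
  finally show ?thesis .
qed

text \<open>
  At the left endpoints of the state for which these have the smallest sum, no other state of \<open>v\<close>
  has a nonzero weight.
\<close>

lemma F_independent:
  assumes c: "\<And>y. y \<in> supp v \<Longrightarrow> closed_below n y \<and> card (lefts y \<inter> {..<n}) = d"
    and beyond: "\<And>x y p. x \<in> supp v \<Longrightarrow> y \<in> supp v \<Longrightarrow> n \<le> p \<Longrightarrow> partner x p = partner y p"
    and h: "\<And>a. h a = 0 \<Longrightarrow> a = 0"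
    and F: "\<And>S. S \<subseteq> {..<n} \<Longrightarrow> card S = d \<Longrightarrow> F v S = 0"
  shows "v = 0"
proof (rule ccontr)
  assume "v \<noteq> 0"
  define \<mu> where "\<mu> y = \<Sum>(lefts y \<inter> {..<n})" for y
  have "supp v \<noteq> {}" using \<open>v \<noteq> 0\<close> by simp
  then obtain y where y: "y \<in> supp v" "\<And>x. x \<in> supp v \<Longrightarrow> \<mu> y \<le> \<mu> x"
    using ex_min_if_finite[of "\<mu> ` supp v"] by (fastforce simp: not_less)
  let ?L = "lefts y \<inter> {..<n}"
  have "wt Q z n x ?L = 0" if x: "x \<in> supp v" "x \<noteq> y" for x
  proof (rule ccontr)
    assume nz: "wt Q z n x ?L \<noteq> 0"
    have cd: "card ?L = card (lefts x \<inter> {..<n})" using c[OF x(1)] c[OF y(1)] by simp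
    have cx: "closed_below n x" using c[OF x(1)] by blast
    have "\<mu> x \<le> \<mu> y" using wt_support(1)[OF cx _ cd nz] by (simp add: \<mu>_def)
    then have "\<mu> x = \<mu> y" using y(2)[OF x(1)] by simp
    then have e: "?L = lefts x \<inter> {..<n}" using wt_support(2)[OF cx _ cd nz] by (simp add: \<mu>_def)
    have "p \<in> lefts y \<longleftrightarrow> p \<in> lefts x" for p
    proof (cases "p < n")
      case True
      then show ?thesis using e by blast
    next
      case False
      then show ?thesis using beyond[OF x(1) y(1), of p] by (simp add: lefts_iff)
    qed
    then have "lefts y = lefts x" by blast
    then show False using lefts_inject x(2) by blast
  qed
  then have "F v ?L = h (coeff v y) * wt Q z n y ?L"
    unfolding F_def using y(1) by (subst sum.remove[OF _ y(1)]) auto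
  also have "\<dots> = h (coeff v y)" using wt_lefts[of n y Q z] c[OF y(1)] by simp
  finally have "h (coeff v y) = 0" using F[of ?L] c[OF y(1)] by simp
  then show False using h y(1) by (simp add: in_keys_iff)
qed

end

section \<open>Sums at a root of unity\<close>

text \<open>Gaussian binomial coefficients up to a power of \<open>x\<close>.\<close>

definition subset_sum :: "'r::comm_ring_1 \<Rightarrow> nat \<Rightarrow> nat \<Rightarrow> 'r" where
  "subset_sum x n c = (\<Sum>S | S \<subseteq> {..<n} \<and> card S = c. x ^ \<Sum>S)"

lemma subset_sum_0: "subset_sum x n 0 = 1"
proof -
  have e: "{S. S \<subseteq> {..<n} \<and> card S = 0} = {{}}" by (auto dest: finite_subset)
  show ?thesis unfolding subset_sum_def e by simp
qed

lemma subset_sum_0_Suc: "subset_sum x 0 (Suc c) = 0"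
proof -
  have e: "{S. S \<subseteq> {..<0::nat} \<and> card S = Suc c} = {}" by auto
  show ?thesis unfolding subset_sum_def e by simp
qed

lemma subset_sum_Suc: "subset_sum x (Suc n) (Suc c) = subset_sum x n (Suc c) + x ^ n * subset_sum x n c"
proof -
  let ?A = "{S. S \<subseteq> {..<n} \<and> card S = Suc c}" and ?B = "{S. S \<subseteq> {..<n} \<and> card S = c}"
  have f: "finite ?A" "finite ?B" by (rule finite_subset[of _ "Pow {..<n}"], auto)+
  have fin: "finite S" "n \<notin> S" if "S \<in> ?B" for S using that finite_subset by blast+
  have "{S. S \<subseteq> {..<Suc n} \<and> card S = Suc c} = ?A \<union> insert n ` ?B"
  proof (intro equalityI subsetI)
    fix S assume S: "S \<in> {S. S \<subseteq> {..<Suc n} \<and> card S = Suc c}"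
    then have fS: "finite S" using finite_subset by blast
    show "S \<in> ?A \<union> insert n ` ?B"
    proof (cases "n \<in> S")
      case True
      then have "S = insert n (S - {n})" "S - {n} \<in> ?B" using S fS by (auto simp: less_Suc_eq)
      then show ?thesis by blast
    next
      case False
      then show ?thesis using S by (auto simp: less_Suc_eq subset_iff)
    qed
  next
    fix S assume "S \<in> ?A \<union> insert n ` ?B"
    then show "S \<in> {S. S \<subseteq> {..<Suc n} \<and> card S = Suc c}"
    proof
      assume "S \<in> ?A"
      then show ?thesis by (auto intro: less_SucI)
    next
      assume "S \<in> insert n ` ?B"
      then obtain R where R: "S = insert n R" "R \<in> ?B" by blast
      then have "card S = Suc c" using fin[OF R(2)] by simp
      then show ?thesis using R by (auto intro: less_SucI)
    qed
  qed
  then have "subset_sum x (Suc n) (Suc c) = (\<Sum>S\<in>?A \<union> insert n ` ?B. x ^ \<Sum>S)"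
    unfolding subset_sum_def by (rule arg_cong)
  also have "\<dots> = subset_sum x n (Suc c) + (\<Sum>S\<in>insert n ` ?B. x ^ \<Sum>S)"
  proof -
    have "?A \<inter> insert n ` ?B = {}" by auto
    then show ?thesis
      unfolding subset_sum_def using f by (intro sum.union_disjoint finite_imageI)
  qed
  also have "(\<Sum>S\<in>insert n ` ?B. x ^ \<Sum>S) = (\<Sum>S\<in>?B. x ^ \<Sum>(insert n S))"
  proof -
    have "inj_on (insert n) ?B"
    proof (rule inj_onI)
      fix S R assume S: "S \<in> ?B" "R \<in> ?B" "insert n S = insert n R"
      then show "S = R" using insert_ident[OF fin(2)[OF S(1)] fin(2)[OF S(2)]] by blast
    qed
    then show ?thesis by (simp only: sum.reindex o_def)
  qed
  also have "\<dots> = (\<Sum>S\<in>?B. x ^ n * x ^ \<Sum>S)"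
  proof (rule sum.cong[OF refl])
    fix S assume "S \<in> ?B"
    then have "\<Sum>(insert n S) = n + \<Sum>S" using fin[of S] by simp
    then show "x ^ \<Sum>(insert n S) = x ^ n * x ^ \<Sum>S" by (simp only: power_add)
  qed
  also have "\<dots> = x ^ n * subset_sum x n c"
    unfolding subset_sum_def by (rule sum_distrib_left[symmetric])
  finally show ?thesis .
qed

lemma subset_sum_step:
  "(1 - x ^ Suc c) * subset_sum x n (Suc c) = (x ^ c - x ^ n) * subset_sum x n c"
proof (induction n arbitrary: c)
  case 0
  then show ?case by (cases c) (simp_all add: subset_sum_0 subset_sum_0_Suc)
next
  case (Suc n)
  show ?case
  proof (cases c)
    case 0
    have "(1 - x) * (subset_sum x n 1 + x ^ n) = (1 - x) * subset_sum x n 1 + (1 - x) * x ^ n"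
      by (rule distrib_left)
    also have "\<dots> = (1 - x ^ n) + (1 - x) * x ^ n"
      using Suc[of 0] by (simp add: subset_sum_0)
    finally show ?thesis using 0 by (simp add: subset_sum_Suc subset_sum_0 left_diff_distrib)
  next
    case (Suc e)
    let ?g = "subset_sum x n"
    have i: "(1 - x ^ Suc c) * ?g (Suc c) = (x ^ c - x ^ n) * ?g c"
      "(1 - x ^ c) * ?g c = (x ^ e - x ^ n) * ?g e"
      using Suc.IH[of c] Suc.IH[of e] Suc by simp_all
    have "(1 - x ^ Suc c) * subset_sum x (Suc n) (Suc c)
      = (1 - x ^ Suc c) * ?g (Suc c) + x ^ n * (1 - x ^ Suc c) * ?g c"
      by (simp add: subset_sum_Suc algebra_simps)
    also have "\<dots> = (x ^ c - x ^ Suc n) * ?g c + x ^ Suc n * ((1 - x ^ c) * ?g c)"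
      unfolding i(1) by (simp add: algebra_simps)
    also have "\<dots> = (x ^ c - x ^ Suc n) * (?g c + x ^ n * ?g e)"
      unfolding i(2) using Suc by (simp add: algebra_simps)
    also have "?g c + x ^ n * ?g e = subset_sum x (Suc n) c"
      using Suc by (simp add: subset_sum_Suc)
    finally show ?thesis .
  qed
qed

text \<open>
  A case of the Lucas congruence: the recursion in \<open>n\<close> has period \<open>l\<close> in its coefficients, and a full period
  changes nothing for fewer than \<open>l\<close> points and adds a constant for \<open>l\<close> points.
\<close>

lemma subset_sum_root_of_unity:
  fixes x :: complex
  assumes l: "0 < l" "x ^ l = 1" "\<And>c. 0 < c \<Longrightarrow> c < l \<Longrightarrow> x ^ c \<noteq> 1" and "b < l"
  shows "subset_sum x (k * l + b) l = of_nat k * x ^ \<Sum>{..<l}"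
proof -
  let ?g = "subset_sum x"
  have full: "?g l l = x ^ \<Sum>{..<l}"
  proof -
    have e: "{S. S \<subseteq> {..<l} \<and> card S = l} = {{..<l}}"
    proof (intro equalityI subsetI)
      fix S assume "S \<in> {S. S \<subseteq> {..<l} \<and> card S = l}"
      then have "S \<subseteq> {..<l}" "card S = card {..<l}" by simp_all
      then show "S \<in> {{..<l}}" using card_subset_eq finite_lessThan by blast
    qed simp
    show ?thesis unfolding subset_sum_def e by simp
  qed
  have small: "?g l (Suc c) = 0" if "Suc c < l" for c
    using that
  proof (induction c)
    case 0
    then show ?case using subset_sum_step[of x 0 l] l(2) l(3)[of 1] by (simp add: subset_sum_0)
  next
    case (Suc c)
    then show ?case using subset_sum_step[of x "Suc c" l] l(3)[of "Suc (Suc c)"] by simp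
  qed
  have zero: "?g n c = 0" if "n < c" for n c
  proof -
    have e: "{S. S \<subseteq> {..<n} \<and> card S = c} = {}"
    proof -
      have "card S \<noteq> c" if "S \<subseteq> {..<n}" for S
        using card_mono[OF finite_lessThan that] \<open>n < c\<close> by simp
      then show ?thesis by blast
    qed
    show ?thesis unfolding subset_sum_def e by simp
  qed
  have shift: "(\<forall>c<l. ?g (l + n) c = ?g n c) \<and> ?g (l + n) l = ?g n l + x ^ \<Sum>{..<l}" for n
  proof (induction n)
    case 0
    have "?g l c = ?g 0 c" if "c < l" for c
      using that small by (cases c) (simp_all add: subset_sum_0 subset_sum_0_Suc)
    moreover have "?g 0 l = 0" using zero l(1) by simp
    ultimately show ?case using full by simp
  next
    case (Suc n)
    have "x ^ (l + n) = x ^ n" using l(2) by (simp add: power_add)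
    then have e: "?g (l + Suc n) (Suc c) = ?g (l + n) (Suc c) + x ^ n * ?g (l + n) c" for c
      using subset_sum_Suc[of x "l + n" c] by simp
    note IH = Suc.IH
    have "?g (l + Suc n) c = ?g (Suc n) c" if "c < l" for c
    proof (cases c)
      case (Suc c')
      then have "?g (l + n) (Suc c') = ?g n (Suc c')" "?g (l + n) c' = ?g n c'"
        using conjunct1[OF IH] that Suc_lessD[of c' l] by blast+
      then show ?thesis by (simp only: Suc e subset_sum_Suc)
    qed (simp add: subset_sum_0)
    moreover have "?g (l + Suc n) l = ?g (Suc n) l + x ^ \<Sum>{..<l}"
    proof -
      obtain c where c: "l = Suc c" using l(1) by (cases l) auto
      have "?g (l + Suc n) l = ?g (l + n) l + x ^ n * ?g (l + n) c"
        using e[of c] by (simp only: c[symmetric])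
      moreover have "?g (Suc n) l = ?g n l + x ^ n * ?g n c"
        using subset_sum_Suc[of x n c] by (simp only: c[symmetric])
      moreover have "?g (l + n) l = ?g n l + x ^ \<Sum>{..<l}" "?g (l + n) c = ?g n c"
        using Suc.IH c by (blast, blast)
      ultimately have "?g (l + Suc n) l = (?g n l + x ^ \<Sum>{..<l}) + x ^ n * ?g n c"
        "?g (Suc n) l = ?g n l + x ^ n * ?g n c" by (simp_all only:)
      then show ?thesis by simp
    qed
    ultimately show ?case by blast
  qed
  show ?thesis
  proof (induction k)
    case 0
    then show ?case using zero \<open>b < l\<close> by simp
  next
    case (Suc k)
    have "Suc k * l + b = l + (k * l + b)" by simp
    then have "?g (Suc k * l + b) l = ?g (k * l + b) l + x ^ \<Sum>{..<l}"
      using shift[of "k * l + b"] by (simp only:)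
    also have "\<dots> = of_nat (Suc k) * x ^ \<Sum>{..<l}"
      unfolding Suc.IH of_nat_Suc by (simp only: distrib_right mult_1 add.commute)
    finally show ?case .
  qed
qed

section \<open>Dual numbers\<close>

text \<open>
  The first-order deformations: \<open>Dual a b\<close> is \<open>a + b \<epsilon>\<close> with \<open>\<epsilon>\<^sup>2 = 0\<close>.
\<close>

datatype dual = Dual (std: complex) (eps: complex)

lemma dual_eqI: "std a = std b \<Longrightarrow> eps a = eps b \<Longrightarrow> a = b"
  by (cases a, cases b) simp

instantiation dual :: comm_ring_1
begin

definition "0 = Dual 0 0"
definition "1 = Dual 1 0"
definition "a + b = Dual (std a + std b) (eps a + eps b)"
definition "a - b = Dual (std a - std b) (eps a - eps b)"
definition "- a = Dual (- std a) (- eps a)"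
definition "a * b = Dual (std a * std b) (std a * eps b + eps a * std b)"

instance
proof
  fix a b c :: dual
  note defs = zero_dual_def one_dual_def plus_dual_def minus_dual_def uminus_dual_def times_dual_def
  show "a * b * c = a * (b * c)" by (simp add: defs ring_distribs mult.assoc)
  show "a * b = b * a" by (simp add: defs mult.commute add.commute)
  show "1 * a = a" "a + b + c = a + (b + c)" "a + b = b + a" "0 + a = a" "- a + a = 0" "a - b = a + - b"
    "(0 :: dual) \<noteq> 1"
    by (simp_all add: defs add.assoc add.commute)
  show "(a + b) * c = a * c + b * c" by (simp add: defs ring_distribs)
qed

end

lemma dual_simps [simp]:
  "std 0 = 0" "eps 0 = 0" "std 1 = 1" "eps 1 = 0"
  "std (a + b) = std a + std b" "eps (a + b) = eps a + eps b"
  "std (a - b) = std a - std b" "eps (a - b) = eps a - eps b"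
  "std (- a) = - std a" "eps (- a) = - eps a"
  "std (a * b) = std a * std b" "eps (a * b) = std a * eps b + eps a * std b"
  by (simp_all add: zero_dual_def one_dual_def plus_dual_def minus_dual_def uminus_dual_def times_dual_def)

lemma std_power [simp]: "std (a ^ m) = std a ^ m"
  by (induction m) simp_all

lemma eps_power: "eps (a ^ m) = of_nat m * std a ^ (m - 1) * eps a"
proof (induction m)
  case (Suc m)
  then show ?case by (cases m) (simp_all add: algebra_simps)
qed simp

lemma std_sum [simp]: "std (sum f A) = (\<Sum>x\<in>A. std (f x))"
  by (induction A rule: infinite_finite_induct) simp_all

lemma std_prod [simp]: "std (prod f A) = (\<Prod>x\<in>A. std (f x))"
  by (induction A rule: infinite_finite_induct) simp_all

lemma std_wt [simp]: "std (wt Q z n y S) = wt (std Q) (std z) n y S"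
proof -
  have "std (loc Q z y S p) = loc (std Q) (std z) y S p" for p
    unfolding loc_def
    by (cases "partner y p = p"; cases "p \<in> S"; cases "partner y p \<in> S"; cases "partner y p < p") simp_all
  then show ?thesis by (simp add: wt_def)
qed

lemma dual_mult_eq_0: "a * b = 0 \<Longrightarrow> std a \<noteq> 0 \<Longrightarrow> b = (0 :: dual)"
proof -
  assume ab: "a * b = 0" and a: "std a \<noteq> 0"
  have "std a * std b = 0" using arg_cong[OF ab, of std] by simp
  then have b: "std b = 0" using a by simp
  then have "std a * eps b = 0" using arg_cong[OF ab, of eps] by simp
  then show "b = 0" using a b by (intro dual_eqI) simp_all
qed

lemma dual_mult_eps: "a * b = 0 \<Longrightarrow> std a = 0 \<Longrightarrow> eps a \<noteq> 0 \<Longrightarrow> std (b :: dual) = 0"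
  by (drule arg_cong[of _ _ eps]) simp

text \<open>
  In \<open>1 - w ^ m = (1 - w) * (\<Sum>r<m. w ^ r)\<close>, the left side has a simple zero at a root of unity and the first
  factor is a unit.
\<close>

lemma dual_geometric_sum:
  assumes "std w ^ m = 1" "std w \<noteq> 1" "eps w \<noteq> 0" "0 < m"
  shows "std (\<Sum>r<m. w ^ r) = 0" "eps (\<Sum>r<m. w ^ r) \<noteq> 0"
proof -
  let ?G = "\<Sum>r<m. w ^ r"
  have e: "1 - w ^ m = (1 - w) * ?G" by (rule one_diff_power_eq)
  show s: "std ?G = 0"
    using arg_cong[OF e, of std] assms(1,2) by simp
  have "std w \<noteq> 0" using assms(1,4) by (metis power_0_left less_irrefl zero_neq_one)
  then have "eps (1 - w ^ m) \<noteq> 0"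
    using assms(3,4) by (simp add: eps_power)
  moreover have "eps (1 - w ^ m) = (1 - std w) * eps ?G"
    unfolding e using s by simp
  ultimately show "eps ?G \<noteq> 0" by auto
qed

section \<open>Homomorphisms on basis states\<close>

lemma (in link_hom) zero_spreads:
  assumes x: "x \<in> reach w" "\<phi> (basis x) = 0" and y: "y \<in> reach x"
  shows "\<phi> (basis y) = 0"
  using y
proof induction
  case (step y k)
  then have "y \<in> reach w" using x(1) reach_trans by blast
  then show ?case
    using step comm[of "basis y" k] by (cases "simple_cup k y") (simp_all add: join_at_simple e_op_eqs)
qed (rule x(2))

text \<open>By reversibility of the moves, killing one state means killing all.\<close>

lemma (in link_hom) nonzero_on_basis:
  assumes v: "v \<in> xspace w" "\<phi> v \<noteq> 0" and x: "x \<in> reach w"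
  shows "\<phi> (basis x) \<noteq> 0"
proof
  assume "\<phi> (basis x) = 0"
  then have z: "\<phi> (basis y) = 0" if "y \<in> reach w" for y
    using zero_spreads[OF x] reach_trans[OF that] reach_sym[OF x] by blast
  have "\<phi> v = 0"
    using xspace_eqI[of v w \<phi> "\<lambda>_. 0", OF v(1) add scale] z by simp
  then show False using v(2) by simp
qed

lemma keys_e_op:
  assumes "y \<in> supp (e_op \<delta> k v)"
  shows "simple_cup k y"
proof -
  obtain x where x: "y \<in> supp (e_state \<delta> k x)"
    using assms keys_lin_ext[of "e_state \<delta> k" v] unfolding e_op_lin_ext by blast
  show ?thesis
    using x keys_pscale[of \<delta> "basis x"]
    by (cases "strings_at k x"; cases "simple_cup k x") (auto simp: e_state_def simp del: pscale_single)
qed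

lemma join_at_inject:
  assumes "join_at a x = join_at a y" "partner x (a + 1) = c" "partner y (a + 1) = c" "c \<noteq> a" "c \<noteq> a + 1"
  shows "x = y"
proof (rule link_state_eqI)
  have eq: "partner (join_at a x) p = partner (join_at a y) p" for p using assms(1) by simp
  have c: "partner x c = a + 1" "partner y c = a + 1" using assms(2,3) by (metis partner_partner)+
  have n: "partner x a \<noteq> c" "partner y a \<noteq> c" "partner x a \<noteq> a + 1" "partner y a \<noteq> a + 1"
    using c assms(2-5) by (metis Suc_eq_plus1 n_not_Suc_n partner_partner)+
  have "(if partner x a = a then c else partner x a) = (if partner y a = a then c else partner y a)"
    using eq[of c] assms(2-5) n by (simp add: partner_join_at)
  then have a: "partner x a = partner y a" using n by (simp split: if_splits)
  then have t: "partner x (partner x a) = partner y (partner x a)" by (metis partner_partner)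
  fix p
  show "partner x p = partner y p"
  proof (cases "p = a \<or> p = a + 1 \<or> p = c \<or> p = partner x a")
    case True
    then show ?thesis using a t c assms(2,3) by metis
  next
    case False
    then show ?thesis using eq[of p] a assms(2,3) by (simp add: partner_join_at)
  qed
qed

text \<open>
  This is applied to a section \<open>\<sigma>\<close>, which commutes with the moves that do not act on two strings. A
  state with a simple cup at \<open>a\<close> is obtained by such a move at \<open>a\<close>, hence so are all terms of its
  image. Under a longer cup, the cup starting at \<open>a + 1\<close> is kept by induction; therefore the move at \<open>a\<close> is
  injective on the terms of the image, and it leaves a shorter cup ending at \<open>b\<close>.
\<close>

lemma cups_preserved:
  assumes \<sigma>: "\<And>v k. v \<in> xspace w \<Longrightarrow> \<sigma> (e_op \<delta> k v) = e_op \<delta> k (\<sigma> v) + T k v"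
    and T: "\<And>x k. x \<in> reach w \<Longrightarrow> \<not> strings_at k x \<Longrightarrow> T k (basis x) = 0"
  shows "x \<in> reach w \<Longrightarrow> a < b \<Longrightarrow> partner x a = b \<Longrightarrow> y \<in> supp (\<sigma> (basis x)) \<Longrightarrow> partner y a = b"
proof (induction "b - a" arbitrary: a b x y rule: less_induct)
  case less
  have mv: "\<sigma> (basis (join_at k x)) = e_op \<delta> k (\<sigma> (basis x))"
    if "x \<in> reach w" "\<not> strings_at k x" "\<not> simple_cup k x" for k x
    using \<sigma>[of "basis x" k] T[OF that(1,2)] that by (simp add: e_op_eqs)
  show ?case
  proof (cases "b = a + 1")
    case True
    then have s: "simple_cup a x" using less.prems(3) by (simp add: simple_cup_def)
    note nx = join_next[OF s disjI1[OF refl]]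
    have "join_at (a + 1) x \<in> reach w" using less.prems(1) nx(1) by (rule reach.step)
    from mv[OF this nx(3,4)] have "\<sigma> (basis x) = e_op \<delta> a (\<sigma> (basis (join_at (a + 1) x)))"
      by (simp only: nx(5))
    then have "simple_cup a y" using less.prems(4) keys_e_op by metis
    then show ?thesis using True by (simp add: simple_cup_def)
  next
    case False
    define c where "c = partner x (a + 1)"
    have ab: "a < a + 1" "a + 1 < partner x a" using False less.prems(2,3) by auto
    have c: "a + 1 < c" "c < b" using below_cup[OF ab] less.prems(3) by (auto simp: c_def)
    have ns: "\<not> strings_at a x" "\<not> simple_cup a x"
      using less.prems(2,3) False by (auto simp: strings_at_iff simple_cup_def)
    define x' where "x' = join_at a x"
    have x': "x' \<in> reach w" unfolding x'_def using less.prems(1) ns(1) by (rule reach.step)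
    have "partner x' c = b"
      using c less.prems(2,3) unfolding x'_def partner_join_at c_def[symmetric] by simp
    then have k2: "partner y c = b" if "y \<in> supp (\<sigma> (basis x'))" for y
      using less.hyps[of b c x' y] c that x' by simp
    have k1: "partner y (a + 1) = c" if "y \<in> supp (\<sigma> (basis x))" for y
      using less.hyps[of c "a + 1" x y] c that less.prems(1) c_def by simp
    let ?v = "\<sigma> (basis x)"
    have st: "e_state \<delta> a u = basis (join_at a u)" if "u \<in> supp ?v" for u
    proof -
      have "partner u (a + 1) \<noteq> a + 1" "partner u (a + 1) \<noteq> a" using k1[OF that] c by auto
      then have "\<not> strings_at a u" "\<not> simple_cup a u"
        by (auto simp: strings_at_iff simple_cup_def) (metis Suc_eq_plus1 partner_partner)
      then show ?thesis by (simp add: e_state_def)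
    qed
    have "coeff (e_op \<delta> a ?v) (join_at a y)
      = (\<Sum>u\<in>supp ?v. if u = y then coeff ?v u else 0)"
      unfolding e_op_lin_ext lookup_lin_ext
    proof (rule sum.cong[OF refl])
      fix u assume u: "u \<in> supp ?v"
      have "join_at a u = join_at a y \<longleftrightarrow> u = y"
        using join_at_inject[of a u y c] k1[OF u] k1[OF less.prems(4)] c by auto
      then show "coeff ?v u * coeff (e_state \<delta> a u) (join_at a y)
          = (if u = y then coeff ?v u else 0)"
        by (simp add: st[OF u] lookup_single when_def)
    qed
    also have "\<dots> = coeff ?v y" using less.prems(4) by simp
    finally have "join_at a y \<in> supp (\<sigma> (basis x'))"
      using less.prems(4) mv[OF less.prems(1) ns] by (simp add: in_keys_iff x'_def)
    from k2[OF this] have "partner (join_at a y) c = b" .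
    then show ?thesis
      using c k1[OF less.prems(4)] by (simp add: partner_join_at split: if_splits)
  qed
qed

lemma same_tail:
  assumes x: "strings x = {..<n}" and y: "y \<in> reach w" "finite (strings w)"
    and tail: "\<And>p. n \<le> p \<Longrightarrow> partner y p = partner x p"
  shows "closed_below n y" "n = num_strings w + 2 * card (lefts y \<inter> {..<n})"
proof -
  have xs: "partner x p = p \<longleftrightarrow> p < n" for p using x by (auto simp: strings_iff[symmetric])
  show c: "closed_below n y"
    unfolding closed_below_def
  proof (intro allI impI, rule ccontr)
    fix p assume p: "p < n" "\<not> partner y p < n"
    then have "partner x (partner y p) = p" using tail[of "partner y p"] by simp
    then have "partner y p = p" using xs p(1) by (metis partner_partner)
    then show False using p by simp
  qed
  have "strings y \<subseteq> {..<n}"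
    using tail xs by (auto simp: strings_iff) (metis not_le)
  then have "strings y \<inter> {..<n} = strings y" by auto
  then show "n = num_strings w + 2 * card (lefts y \<inter> {..<n})"
    using card_lefts[OF c] reach_strings[OF y] by (simp add: num_strings_def)
qed

section \<open>Symmetric weight functions\<close>

context weighting
begin

lemma z_cancel: "z ^ a * x = z ^ a * y \<Longrightarrow> x = y"
proof -
  assume "z ^ a * x = z ^ a * y"
  then have "(- Q) ^ a * z ^ a * x = (- Q) ^ a * z ^ a * y" by (simp only: mult.assoc)
  moreover have "- Q * z = 1" using Qz by simp
  then have "(- Q) ^ a * z ^ a = 1" by (simp only: power_mult_distrib[symmetric] power_one)
  ultimately show "x = y" by (simp only: mult_1)
qed

text \<open>The coefficients of tensors that are killed by all caps.\<close>

definition symmetric :: "nat \<Rightarrow> (nat set \<Rightarrow> 'r) \<Rightarrow> bool" where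
  "symmetric c H \<longleftrightarrow> (\<forall>S k. k + 1 < n \<longrightarrow> S \<subseteq> {..<n} \<longrightarrow> k \<notin> S \<longrightarrow> k + 1 \<notin> S \<longrightarrow> card (insert k S) = c \<longrightarrow>
     H (insert (k + 1) S) = z * H (insert k S))"

lemma symmetric_eq:
  assumes "symmetric c H" "S \<subseteq> {..<n}" "card S = c"
  shows "z ^ \<Sum>{..<c} * H S = z ^ \<Sum>S * H {..<c}"
  using assms(1) by (intro symmetric_value[of n c H z S] assms) (simp add: symmetric_def)

lemma symmetric_zero:
  assumes "symmetric c H" "H {..<c} = 0" "S \<subseteq> {..<n}" "card S = c"
  shows "H S = 0"
  using symmetric_eq[OF assms(1,3,4)] assms(2) z_cancel[of "\<Sum>{..<c}" "H S" 0] by simp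

text \<open>On symmetric tensors, the raising operator acts by a quantum integer.\<close>

lemma symmetric_sum_initial:
  assumes H: "symmetric (Suc \<tau>) H"
  shows "(\<Sum>p = \<tau>..<n. z ^ p * H (insert p {..<\<tau>})) = z ^ \<tau> * ((\<Sum>r<n - \<tau>. (z\<^sup>2) ^ r) * H {..<Suc \<tau>})"
proof -
  have v: "H (insert (\<tau> + r) {..<\<tau>}) = z ^ r * H {..<Suc \<tau>}" if "r < n - \<tau>" for r
  proof -
    let ?S = "insert (\<tau> + r) {..<\<tau>}"
    have "z ^ \<Sum>{..<Suc \<tau>} * H ?S = z ^ \<Sum>?S * H {..<Suc \<tau>}"
      by (rule symmetric_eq[OF H]) (use that in auto)
    moreover have "\<Sum>{..<Suc \<tau>} = \<Sum>{..<\<tau>} + \<tau>" "\<Sum>?S = \<Sum>{..<\<tau>} + \<tau> + r" by simp_all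
    ultimately have "z ^ (\<Sum>{..<\<tau>} + \<tau>) * H ?S = z ^ (\<Sum>{..<\<tau>} + \<tau>) * (z ^ r * H {..<Suc \<tau>})"
      by (simp only: power_add mult.assoc)
    then show ?thesis by (rule z_cancel)
  qed
  have "(\<Sum>p = \<tau>..<n. z ^ p * H (insert p {..<\<tau>})) = (\<Sum>r<n - \<tau>. z ^ (\<tau> + r) * H (insert (\<tau> + r) {..<\<tau>}))"
    by (rule sum.reindex_bij_witness[where i = "\<lambda>r. \<tau> + r" and j = "\<lambda>p. p - \<tau>"]) auto
  also have "\<dots> = (\<Sum>r<n - \<tau>. z ^ \<tau> * ((z\<^sup>2) ^ r * H {..<Suc \<tau>}))"
  proof (rule sum.cong[OF refl])
    fix r assume "r \<in> {..<n - \<tau>}"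
    then show "z ^ (\<tau> + r) * H (insert (\<tau> + r) {..<\<tau>}) = z ^ \<tau> * ((z\<^sup>2) ^ r * H {..<Suc \<tau>})"
      by (simp add: v power_add power2_eq_square power_mult_distrib mult.assoc)
  qed
  also have "\<dots> = z ^ \<tau> * ((\<Sum>r<n - \<tau>. (z\<^sup>2) ^ r) * H {..<Suc \<tau>})"
    by (simp only: sum_distrib_left[symmetric] sum_distrib_right[symmetric])
  finally show ?thesis .
qed

lemma symmetric_sum_all:
  assumes H: "symmetric c H" and zero: "(\<Sum>S | S \<subseteq> {..<n} \<and> card S = c. z ^ \<Sum>S * H S) = 0"
  shows "subset_sum (z\<^sup>2) n c * H {..<c} = 0"
proof -
  let ?A = "{S. S \<subseteq> {..<n} \<and> card S = c}"
  have "0 = z ^ \<Sum>{..<c} * (\<Sum>S\<in>?A. z ^ \<Sum>S * H S)" unfolding zero by simp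
  also have "\<dots> = (\<Sum>S\<in>?A. (z\<^sup>2) ^ \<Sum>S * H {..<c})"
    unfolding sum_distrib_left
  proof (rule sum.cong[OF refl])
    fix S assume "S \<in> ?A"
    then have "z ^ \<Sum>{..<c} * H S = z ^ \<Sum>S * H {..<c}" using symmetric_eq[OF H] by blast
    then have "z ^ \<Sum>S * (z ^ \<Sum>{..<c} * H S) = z ^ \<Sum>S * (z ^ \<Sum>S * H {..<c})" by (simp only:)
    then show "z ^ \<Sum>{..<c} * (z ^ \<Sum>S * H S) = (z\<^sup>2) ^ \<Sum>S * H {..<c}"
      by (simp only: power2_eq_square power_mult_distrib mult.assoc mult.left_commute[of "z ^ \<Sum>{..<c}"])
  qed
  also have "\<dots> = subset_sum (z\<^sup>2) n c * H {..<c}"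
    unfolding subset_sum_def by (rule sum_distrib_right[symmetric])
  finally show ?thesis by simp
qed

lemma F_few_points:
  assumes "\<And>y. y \<in> supp v \<Longrightarrow> closed_below n y \<and> card (lefts y \<inter> {..<n}) = d" "\<tau> < d"
  shows "F v {..<\<tau>} = 0"
  unfolding F_def
proof (rule sum.neutral, rule ballI)
  fix y assume "y \<in> supp v"
  then have "wt Q z n y {..<\<tau>} = 0" using assms by (intro wt_few_points) simp_all
  then show "h (coeff v y) * wt Q z n y {..<\<tau>} = 0" by simp
qed

lemma F_sum_initial':
  assumes c: "\<And>y. y \<in> supp v \<Longrightarrow> closed_below n y \<and> card (lefts y \<inter> {..<n}) = d" and "\<tau> \<le> n"
  shows "(\<Sum>p = \<tau>..<n. z ^ p * F v (insert p {..<\<tau>})) = z ^ \<tau> * (z ^ \<tau> * ((\<Sum>r<n - d - \<tau>. (z\<^sup>2) ^ r) * F v {..<\<tau>}))"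
proof -
  have "z ^ (2 * \<tau>) = z ^ \<tau> * z ^ \<tau>" by (simp only: mult_2 power_add)
  then show ?thesis using F_sum_initial[OF assms] by (simp only: power_mult mult.assoc)
qed

end

section \<open>The roots of unity\<close>

locale root_data =
  fixes q \<delta> :: complex and l n :: nat
  assumes \<delta>: "\<delta> = q + inverse q" and q: "q \<noteq> 0" "q\<^sup>2 \<noteq> 1"
    and l: "0 < l" "q ^ (2 * l) = 1" "\<And>c. 0 < c \<Longrightarrow> c < l \<Longrightarrow> q ^ (2 * c) \<noteq> 1"
begin

text \<open>
  The point \<open>q\<close> is deformed to first order so that the loop parameter becomes \<open>\<delta> + \<epsilon>\<close>.
\<close>

definition "\<theta> = inverse (1 - inverse (q\<^sup>2))"
definition "Qd = Dual q \<theta>"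
definition "zd = Dual (- inverse q) (\<theta> * inverse (q\<^sup>2))"

lemma \<theta>: "\<theta> - \<theta> * inverse (q\<^sup>2) = 1" "\<theta> \<noteq> 0"
proof -
  define i where "i = inverse (q\<^sup>2)"
  have "1 - i \<noteq> 0" using q by (simp add: i_def)
  then have "inverse (1 - i) * (1 - i) = 1" "inverse (1 - i) \<noteq> 0" by simp_all
  then show "\<theta> - \<theta> * inverse (q\<^sup>2) = 1" "\<theta> \<noteq> 0"
    unfolding \<theta>_def i_def[symmetric] by (simp_all add: right_diff_distrib)
qed

sublocale C: weighting "\<lambda>c. c" q "- inverse q" n
proof
  have "q * inverse q = 1" using q(1) by (rule right_inverse)
  then show "q * - inverse q = - 1" by (simp only: mult_minus_right)
qed (rule refl)+

sublocale D: weighting "\<lambda>c. Dual c 0" Qd zd n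
proof unfold_locales
  show "Qd * zd = - 1"
  proof (rule dual_eqI)
    show "std (Qd * zd) = std (- 1)" using q(1) by (simp add: Qd_def zd_def)
    have "q * inverse (q\<^sup>2) = inverse q" using q(1) by (simp add: power2_eq_square)
    then have "q * (\<theta> * inverse (q\<^sup>2)) = \<theta> * inverse q" by (simp only: mult.left_commute[of q])
    then show "eps (Qd * zd) = eps (- 1)" by (simp add: Qd_def zd_def)
  qed
qed (rule dual_eqI; simp)+

lemma std_zd [simp]: "std zd = - inverse q" "std Qd = q"
  by (simp_all add: zd_def Qd_def)

lemma std_F [simp]: "std (D.F v S) = C.F v S"
  by (simp add: D.F_def C.F_def)

lemma loop: "Qd - zd - Dual \<delta> 0 = Dual 0 1"
  using \<theta>(1) by (intro dual_eqI) (simp_all add: Qd_def zd_def \<delta>)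

definition "x = inverse (q\<^sup>2)"

lemma z_square: "(- inverse q)\<^sup>2 = x" "std (zd\<^sup>2) = x"
  by (simp_all add: x_def power_inverse)

lemma x_power: "x ^ c = 1 \<longleftrightarrow> q ^ (2 * c) = 1"
proof -
  have "x ^ c = inverse (q ^ (2 * c))" by (simp only: x_def power_inverse power_mult)
  then show ?thesis by (simp only: inverse_eq_1_iff)
qed

lemma x_root: "x ^ l = 1" "0 < c \<Longrightarrow> c < l \<Longrightarrow> x ^ c \<noteq> 1" "x \<noteq> 1" "x \<noteq> 0"
proof -
  show "x ^ l = 1" unfolding x_power by (rule l(2))
  show "x ^ c \<noteq> 1" if "0 < c" "c < l" unfolding x_power using that by (rule l(3))
  show "x \<noteq> 1" "x \<noteq> 0" using q by (simp_all add: x_def)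
qed

lemma x_power_mult: "x ^ (k * l) = 1"
  by (metis mult.commute power_mult power_one x_root(1))

lemma dual_sum:
  assumes "0 < k"
  shows "std (\<Sum>r<k * l. (zd\<^sup>2) ^ r) = 0" "eps (\<Sum>r<k * l. (zd\<^sup>2) ^ r) \<noteq> 0"
proof -
  have "std (zd\<^sup>2) ^ (k * l) = 1" unfolding z_square by (rule x_power_mult)
  moreover have "std (zd\<^sup>2) \<noteq> 1" unfolding z_square by (rule x_root(3))
  moreover have "eps (zd\<^sup>2) \<noteq> 0"
    using q(1) \<theta>(2) by (simp add: power2_eq_square zd_def)
  moreover have "0 < k * l" using assms l(1) by simp
  ultimately show "std (\<Sum>r<k * l. (zd\<^sup>2) ^ r) = 0" "eps (\<Sum>r<k * l. (zd\<^sup>2) ^ r) \<noteq> 0"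
    by (rule dual_geometric_sum)+
qed

lemma sum_nonzero:
  assumes "0 < e" "e < l"
  shows "(\<Sum>r<k * l + e. x ^ r) \<noteq> 0"
proof
  assume "(\<Sum>r<k * l + e. x ^ r) = 0"
  then have "1 - x ^ (k * l + e) = 0" using one_diff_power_eq[of x "k * l + e"] by simp
  then have "x ^ e = 1" unfolding power_add x_power_mult by simp
  then show False using x_root(2)[OF assms] by simp
qed

text \<open>
  Vectors that differ from \<open>x0\<close> only in the points below \<open>n\<close>, so that they are determined by their
  weights.
\<close>

definition tail_of :: "link_state \<Rightarrow> nat \<Rightarrow> link_space \<Rightarrow> bool" where
  "tail_of x0 d v \<longleftrightarrow> (\<forall>y\<in>supp v. closed_below n y \<and> card (lefts y \<inter> {..<n}) = d \<and>
     (\<forall>p\<ge>n. partner y p = partner x0 p))"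

lemma tail_ofD:
  assumes "tail_of x0 d v" "y \<in> supp v"
  shows "closed_below n y \<and> card (lefts y \<inter> {..<n}) = d" "n \<le> p \<Longrightarrow> partner y p = partner x0 p"
  using assms by (auto simp: tail_of_def)

lemma independent:
  assumes "tail_of x0 d v" "\<And>S. S \<subseteq> {..<n} \<Longrightarrow> card S = d \<Longrightarrow> C.F v S = 0"
  shows "v = 0"
  by (rule C.F_independent[of v d]) (use tail_ofD[OF assms(1)] assms(2) in simp_all)

lemma C_cap:
  assumes "tail_of x0 d v" "k + 1 < n" "k \<notin> S" "k + 1 \<notin> S"
  shows "C.F v (insert (k + 1) S) = - inverse q * C.F v (insert k S) + C.F (e_op \<delta> k v) (insert k S)"
  using C.F_cap[of v k S \<delta>] tail_ofD(1)[OF assms(1)] assms(2-4) by (simp add: \<delta> algebra_simps)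

lemma D_cap:
  assumes "tail_of x0 d v" "k + 1 < n" "k \<notin> S" "k + 1 \<notin> S"
  shows "D.F v (insert (k + 1) S) = zd * D.F v (insert k S) + D.F (e_op \<delta> k v) (insert k S)
    + Dual 0 1 * D.F (simple_cup_part k v) (insert k S)"
  using D.F_cap[of v k S \<delta>] tail_ofD(1)[OF assms(1)] assms(2-4) unfolding loop by (simp add: algebra_simps)

lemma C_symmetric:
  assumes "tail_of x0 d u" "\<And>k. k + 1 < n \<Longrightarrow> e_op \<delta> k u = 0"
  shows "C.symmetric c (C.F u)"
  unfolding C.symmetric_def using C_cap[OF assms(1)] assms(2) by (simp add: C.F_zero)

lemma Dual_mult_eq: "std a = std b \<Longrightarrow> Dual 0 1 * a = Dual 0 1 * b"
  by (rule dual_eqI) simp_all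

text \<open>
  Here \<open>u + \<epsilon> v\<close> is a vector killed by the generators for the loop parameter \<open>\<delta> + \<epsilon>\<close>. The raising
  operator kills it at \<open>d - 1\<close> points, which are too few for \<open>d\<close> cups, and multiplies its
  weight at \<open>d\<close> points by a geometric sum of \<open>k * l\<close> terms, which vanishes to first order only.
\<close>

lemma no_first_order_lift:
  assumes u: "tail_of x0 d u" "\<And>k. k + 1 < n \<Longrightarrow> e_op \<delta> k u = 0"
    and v: "tail_of x0 d v" "\<And>k. k + 1 < n \<Longrightarrow> e_op \<delta> k v = - simple_cup_part k u"
    and n: "n + 1 = k * l + d" "0 < d" "0 < k" "d \<le> n"
  shows "u = 0"
proof -
  obtain \<tau> where \<tau>: "d = Suc \<tau>" using n(2) by (cases d) auto
  define H where "H S = D.F u S + Dual 0 1 * D.F v S" for S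
  have H: "D.symmetric d H"
    unfolding D.symmetric_def
  proof (intro allI impI)
    fix S k assume k: "k + 1 < n" "k \<notin> S" "k + 1 \<notin> S"
    have "D.F (e_op \<delta> k v) (insert k S) = - D.F (simple_cup_part k u) (insert k S)"
      using v(2)[OF k(1)] D.F_minus[of 0 "simple_cup_part k u"] by (simp add: D.F_zero)
    moreover have "Dual 0 1 * (Dual 0 1 * a) = 0" for a by (rule dual_eqI) simp_all
    ultimately show "H (insert (k + 1) S) = zd * H (insert k S)"
      unfolding H_def D_cap[OF u(1) k] D_cap[OF v(1) k] u(2)[OF k(1)]
      by (simp add: D.F_zero distrib_left right_diff_distrib mult.left_commute)
  qed
  have "(\<Sum>p = \<tau>..<n. zd ^ p * H (insert p {..<\<tau>}))
    = (\<Sum>p = \<tau>..<n. zd ^ p * D.F u (insert p {..<\<tau>})) + Dual 0 1 * (\<Sum>p = \<tau>..<n. zd ^ p * D.F v (insert p {..<\<tau>}))"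
    by (simp only: H_def distrib_left sum.distrib sum_distrib_left mult.left_commute[of "Dual 0 1"])
  also have "\<dots> = 0"
    using D.F_sum_initial'[of u d \<tau>] D.F_sum_initial'[of v d \<tau>] D.F_few_points[of u d \<tau>]
      D.F_few_points[of v d \<tau>] tail_ofD(1)[OF u(1)] tail_ofD(1)[OF v(1)] n(4) \<tau> by simp
  finally have "zd ^ \<tau> * ((\<Sum>r<n - \<tau>. (zd\<^sup>2) ^ r) * H {..<Suc \<tau>}) = zd ^ \<tau> * 0"
    using D.symmetric_sum_initial H \<tau> by simp
  then have "(\<Sum>r<n - \<tau>. (zd\<^sup>2) ^ r) * H {..<d} = 0" unfolding \<tau> by (rule D.z_cancel)
  moreover have "n - \<tau> = k * l" using n(1) \<tau> by simp
  ultimately have "std (H {..<d}) = 0"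
    using dual_mult_eps dual_sum[OF n(3)] by metis
  then have "C.F u {..<d} = 0" by (simp add: H_def)
  then show "u = 0"
    using independent[OF u(1)] C.symmetric_zero[OF C_symmetric[OF u]] by blast
qed

lemma subset_sum_nonzero:
  assumes "n + 1 = k * l + d" "0 < d" "d < l" "0 < k"
  shows "subset_sum x n l \<noteq> 0"
proof -
  have "n = k * l + (d - 1)" "d - 1 < l" using assms by simp_all
  then have "subset_sum x n l = of_nat k * x ^ \<Sum>{..<l}"
    using subset_sum_root_of_unity[of l x "d - 1" k, OF l(1) x_root(1,2)] by simp
  then show ?thesis using x_root(4) assms(4) by simp
qed

lemma std_subset_sum: "std (subset_sum w m c) = subset_sum (std w) m c"
  by (simp add: subset_sum_def)

lemma tail_simple_cup:
  assumes "tail_of x0 d v" "0 < d" "y \<in> supp v"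
  shows "\<exists>k. simple_cup k y \<and> k + 1 < n"
proof -
  have "lefts y \<inter> {..<n} \<noteq> {}" using tail_ofD(1)[OF assms(1,3)] assms(2) by auto
  then show ?thesis using ex_simple_cup tail_ofD(1)[OF assms(1,3)] by blast
qed

text \<open>
  The divided power of the raising operator kills \<open>u\<close> because of its cups, but it is nonzero on
  symmetric tensors.
\<close>

lemma symmetric_vanishes:
  assumes n: "n + 1 = k * l + d" "0 < d" "d < l" "0 < k"
    and u: "tail_of x0 d u" "\<And>k. k + 1 < n \<Longrightarrow> e_op \<delta> k u = 0"
    and S: "S \<subseteq> {..<n}" "card S = l"
  shows "C.F u S = 0"
proof -
  have "(\<Sum>S | S \<subseteq> {..<n} \<and> card S = l. (- inverse q) ^ \<Sum>S * C.F u S) = 0"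
    by (rule C.F_sum_all) (rule tail_simple_cup[OF u(1) n(2)])
  then have "subset_sum ((- inverse q)\<^sup>2) n l * C.F u {..<l} = 0"
    using C.symmetric_sum_all C_symmetric[OF u] by blast
  then have "subset_sum x n l * C.F u {..<l} = 0" by (simp only: z_square)
  then show ?thesis
    using C.symmetric_zero[OF C_symmetric[OF u] _ S] subset_sum_nonzero[OF n] by simp
qed

text \<open>
  For a homomorphism \<open>\<phi>'\<close>, the vectors \<open>t k = \<phi>' (simple_cup_part k u)\<close> have the weights required
  here. Then \<open>\<gamma> u - \<epsilon> v\<close> is symmetric on sets of \<open>l\<close> points, and zero by the argument of the
  preceding lemma. Its image under the raising operator at \<open>l - 1\<close> points involves only \<open>u\<close>, as \<open>v\<close> has
  \<open>l\<close> cups. Hence the weight of \<open>u\<close> vanishes at \<open>l - 1\<close> points, and from there the raising operator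
  propagates the vanishing downwards to \<open>d\<close> points.
\<close>

lemma no_second_lift:
  assumes n: "n + 1 = k * l + d" "0 < d" "d < l" "2 \<le> k"
    and u: "tail_of x0 d u" "\<And>k. k + 1 < n \<Longrightarrow> e_op \<delta> k u = 0"
    and v: "tail_of x0 l v" "\<And>k. k + 1 < n \<Longrightarrow> e_op \<delta> k v = t k" and \<gamma>: "\<gamma> \<noteq> 0"
    and t: "\<And>k S. k + 1 < n \<Longrightarrow> S \<subseteq> {..<n} \<Longrightarrow> card S = l \<Longrightarrow> C.F (t k) S = \<gamma> * C.F (simple_cup_part k u) S"
  shows "u = 0"
proof -
  have k: "0 < k" using n(4) by simp
  have kl: "2 * l \<le> k * l" using n(4) by simp
  then have ln: "l \<le> n" using n(1,2) by linarith
  define H where "H S = Dual \<gamma> 0 * D.F u S - Dual 0 1 * D.F v S" for S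
  have H: "D.symmetric l H"
    unfolding D.symmetric_def
  proof (intro allI impI)
    fix S k assume k: "k + 1 < n" "k \<notin> S" "k + 1 \<notin> S" and S: "S \<subseteq> {..<n}" "card (insert k S) = l"
    have "insert k S \<subseteq> {..<n}" using S k by auto
    then have "std (D.F (t k) (insert k S)) = std (Dual \<gamma> 0 * D.F (simple_cup_part k u) (insert k S))"
      using t[OF k(1) _ S(2)] by simp
    then have "Dual 0 1 * D.F (t k) (insert k S) = Dual \<gamma> 0 * (Dual 0 1 * D.F (simple_cup_part k u) (insert k S))"
      using Dual_mult_eq by (metis mult.left_commute)
    moreover have "Dual 0 1 * (Dual 0 1 * a) = 0" for a by (rule dual_eqI) simp_all
    ultimately show "H (insert (k + 1) S) = zd * H (insert k S)"
      unfolding H_def D_cap[OF u(1) k] D_cap[OF v(1) k] u(2)[OF k(1)] v(2)[OF k(1)]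
      by (simp add: D.F_zero distrib_left right_diff_distrib mult.left_commute)
  qed
  have "(\<Sum>S | S \<subseteq> {..<n} \<and> card S = l. zd ^ \<Sum>S * H S)
    = Dual \<gamma> 0 * (\<Sum>S | S \<subseteq> {..<n} \<and> card S = l. zd ^ \<Sum>S * D.F u S)
      - Dual 0 1 * (\<Sum>S | S \<subseteq> {..<n} \<and> card S = l. zd ^ \<Sum>S * D.F v S)"
    by (simp only: H_def right_diff_distrib sum_subtractf sum_distrib_left
        mult.left_commute[of "Dual 0 1"] mult.left_commute[of "Dual \<gamma> 0"])
  also have "\<dots> = 0"
    using D.F_sum_all[of u l] D.F_sum_all[of v l] tail_simple_cup[OF u(1) n(2)] tail_simple_cup[OF v(1) l(1)]
    by simp
  finally have "subset_sum (zd\<^sup>2) n l * H {..<l} = 0" by (rule D.symmetric_sum_all[OF H])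
  moreover have "std (subset_sum (zd\<^sup>2) n l) \<noteq> 0"
    unfolding std_subset_sum z_square by (rule subset_sum_nonzero[OF n(1-3) k])
  ultimately have "H {..<l} = 0" by (rule dual_mult_eq_0)
  then have H0: "H S = 0" if "S \<subseteq> {..<n}" "card S = l" for S
    using D.symmetric_zero[OF H] that by blast
  obtain m where m: "l = Suc m" using l(1) by (cases l) auto
  have "Dual \<gamma> 0 * (\<Sum>p = m..<n. zd ^ p * D.F u (insert p {..<m}))
    - Dual 0 1 * (\<Sum>p = m..<n. zd ^ p * D.F v (insert p {..<m})) = (\<Sum>p = m..<n. zd ^ p * H (insert p {..<m}))"
    by (simp only: H_def right_diff_distrib sum_subtractf sum_distrib_left
        mult.left_commute[of "Dual 0 1"] mult.left_commute[of "Dual \<gamma> 0"])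
  also have "\<dots> = 0"
    by (rule sum.neutral) (use H0 m in auto)
  finally have "Dual \<gamma> 0 * (zd ^ m * (zd ^ m * ((\<Sum>r<n - d - m. (zd\<^sup>2) ^ r) * D.F u {..<m}))) = 0"
    using D.F_sum_initial'[of u d m] D.F_sum_initial'[of v l m] D.F_few_points[of v l m]
      tail_ofD(1)[OF u(1)] tail_ofD(1)[OF v(1)] ln m by simp
  then have "zd ^ m * (zd ^ m * ((\<Sum>r<n - d - m. (zd\<^sup>2) ^ r) * D.F u {..<m})) = 0"
    by (rule dual_mult_eq_0) (simp add: \<gamma>)
  then have prod: "(\<Sum>r<n - d - m. (zd\<^sup>2) ^ r) * D.F u {..<m} = 0"
    using D.z_cancel[of m _ 0] by (metis mult_zero_right)
  \<comment> \<open>a multiple of \<open>l\<close>, hence a zero of first order only; it is positive because \<open>k \<ge> 2\<close>\<close>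
  have e: "n - d - m = (k - 1) * l" using n(1) m kl by (simp only: diff_mult_distrib mult_1)
  have "0 < k - 1" using n(4) by simp
  from dual_mult_eps[OF prod[unfolded e] dual_sum[OF this]] have "std (D.F u {..<m}) = 0" .
  then have top: "C.F u {..<m} = 0" by simp
  \<comment> \<open>below \<open>l - 1\<close> points the quantum integers are nonzero\<close>
  have "C.F u {..<d} = 0"
  proof (rule inc_induct[of d m "\<lambda>\<tau>. C.F u {..<\<tau>} = 0"])
    show "d \<le> m" using n(3) m by simp
    show "C.F u {..<m} = 0" by (rule top)
    fix \<tau> assume \<tau>: "d \<le> \<tau>" "\<tau> < m" "C.F u {..<Suc \<tau>} = 0"
    have "C.F u (insert p {..<\<tau>}) = 0" if "\<tau> \<le> p" "p < n" for p
      using that \<tau>(2) by (intro C.symmetric_zero[OF C_symmetric[OF u] \<tau>(3)]) auto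
    then have "(\<Sum>p = \<tau>..<n. (- inverse q) ^ p * C.F u (insert p {..<\<tau>})) = 0" by simp
    then have "(\<Sum>r<n - d - \<tau>. x ^ r) * C.F u {..<\<tau>} = 0"
      using C.F_sum_initial'[of u d \<tau>, unfolded z_square] tail_ofD(1)[OF u(1)] \<tau>(2) m ln q(1) by simp
    moreover have "n - d - \<tau> = (k - 1) * l + (l - 1 - \<tau>)"
    proof -
      have "(k - 1) * l = k * l - l" by (simp only: diff_mult_distrib mult_1)
      then show ?thesis using n(1) \<tau>(1,2) m kl by linarith
    qed
    moreover have "0 < l - 1 - \<tau>" "l - 1 - \<tau> < l" using \<tau> m by simp_all
    ultimately show "C.F u {..<\<tau>} = 0"
      using sum_nonzero[of "l - 1 - \<tau>" "k - 1"] by simp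
  qed
  then show "u = 0"
    using independent[OF u(1)] C.symmetric_zero[OF C_symmetric[OF u]] by blast
qed

end

section \<open>Homomorphisms in terms of weights\<close>

lemma (in link_hom) expand:
  assumes "v \<in> xspace w"
  shows "\<phi> v = lin_ext (\<lambda>y. \<phi> (basis y)) v"
  by (rule xspace_eqI[OF assms]) (simp_all add: add scale lin_ext_add lin_ext_pscale)

lemma joined_strings_at: "joins_strings m x y \<Longrightarrow> strings_at k y \<Longrightarrow> strings_at k x"
  using joined_partner[of m x y] by (metis strings_at_iff)

context root_data
begin

lemma F_vanishes:
  assumes "\<And>y. y \<in> supp v \<Longrightarrow> partner y p = r" "p < n" "r \<noteq> p" "p \<in> S \<longleftrightarrow> r \<in> S"
  shows "C.F v S = 0"
  unfolding C.F_def
proof (rule sum.neutral, rule ballI)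
  fix y assume y: "y \<in> supp v"
  have "wt q (- inverse q) n y S = 0"
    using assms(2-4) unfolding assms(1)[OF y, symmetric] by (rule wt_zero)
  then show "coeff v y * wt q (- inverse q) n y S = 0" by simp
qed

lemma F_toggle:
  assumes "\<And>y. y \<in> supp v \<Longrightarrow> simple_cup k y" "k + 1 < n" "k \<notin> S" "k + 1 \<notin> S"
  shows "C.F v (insert (k + 1) S) = q * C.F v (insert k S)"
  unfolding C.F_def sum_distrib_left
proof (rule sum.cong[OF refl])
  fix y assume "y \<in> supp v"
  from wt_toggle[OF assms(1)[OF this] assms(2-4), of q "- inverse q"]
  show "coeff v y * wt q (- inverse q) n y (insert (k + 1) S)
      = q * (coeff v y * wt q (- inverse q) n y (insert k S))" by simp
qed

lemma tail_of_image:
  assumes "joining_hom \<delta> w z \<psi> j" and y: "y \<in> reach w" "\<And>p. n \<le> p \<Longrightarrow> partner y p = partner x0 p"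
    and x0: "strings x0 = {..<n}" and z: "finite (strings z)" "n = num_strings z + 2 * e"
  shows "tail_of x0 e (\<psi> (basis y))"
  unfolding tail_of_def
proof
  interpret joining_hom \<delta> w z \<psi> j by fact
  fix u assume u: "u \<in> supp (\<psi> (basis y))"
  have "\<psi> (basis y) \<in> xspace z" using y(1) by (intro maps) simp
  then have uz: "u \<in> reach z" using u by (auto simp: xspace_def)
  have tail: "partner u p = partner x0 p" if "n \<le> p" for p
  proof -
    have "p \<notin> strings x0" using x0 that by simp
    then have "partner y p \<noteq> p" using y(2)[OF that] by (simp add: strings_iff)
    then show ?thesis using joined_partner[OF joins[OF y(1) u]] y(2)[OF that] by simp
  qed
  from same_tail[OF x0 uz z(1) tail] z(2) tail
  show "closed_below n u \<and> card (lefts u \<inter> {..<n}) = e \<and> (\<forall>p\<ge>n. partner u p = partner x0 p)" by simp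
qed

text \<open>
  The proof works by moving the points of \<open>S\<close> to the left. Across a simple cup this costs the factor \<open>q\<close> for
  the state and for its image, which contains the same cup; across two neighbouring strings it
  costs \<open>- inverse q\<close> for both, since they are killed by the cap there. Sets that contain both or no
  endpoint of a cup have weight zero for both, and among the others the process ends at \<open>S0\<close>.
\<close>

lemma scaling_normal:
  assumes hom: "joining_hom \<delta> w z \<psi> j" and y: "y \<in> reach w" "\<And>p. n \<le> p \<Longrightarrow> partner y p = partner x0 p"
    and x0: "strings x0 = {..<n}" and w: "finite (strings w)" "n = num_strings w + 2 * d"
    and z: "finite (strings z)" "n = num_strings z + 2 * e"
    and c: "d \<le> c" "c - d \<le> num_strings w" and nb: "normal_below n y"
  shows "\<exists>\<gamma>. \<forall>S. S \<subseteq> {..<n} \<longrightarrow> card S = c \<longrightarrow> C.F (\<psi> (basis y)) S = \<gamma> * wt q (- inverse q) n y S"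
proof -
  interpret joining_hom \<delta> w z \<psi> j by fact
  let ?w = "wt q (- inverse q) n y" and ?V = "\<psi> (basis y)" and ?L = "lefts y \<inter> {..<n}"
  define m where "m = num_strings w"
  have tail: "tail_of x0 e ?V" by (rule tail_of_image[OF hom y x0 z])
  have cl: "closed_below n y" and cL: "card ?L = d"
    using same_tail[OF x0 y(1) w(1) y(2)] w(2) by simp_all
  have m: "card (strings y \<inter> {..<n}) = m" "m \<le> n"
    using card_lefts[OF cl] cL w(2) by (simp_all add: m_def)
  have str: "strings y \<inter> {..<n} = {..<m}" using normal_below_strings[OF cl nb] m(1) by simp
  have L: "?L = {p. m \<le> p \<and> p < n \<and> even (p - m)}" by (rule normal_below_lefts[OF cl nb m(1)[symmetric]])
  have strp: "partner y p = p \<longleftrightarrow> p < m" if "p < n" for p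
    using str that unfolding set_eq_iff by (auto simp: strings_iff)
  have key: "partner u p = partner y p" if "u \<in> supp ?V" "partner y p \<noteq> p" for u p
    using joined_partner[OF joins[OF y(1) that(1)] that(2)] .
  have keys_simple: "simple_cup k u" if "u \<in> supp ?V" "simple_cup k y" for u k
    using key[OF that(1), of k] that(2) by (simp add: simple_cup_def)
  define S0 where "S0 = {..<c - d} \<union> ?L"
  have cS0: "card S0 = c"
  proof -
    have "{..<c - d} \<inter> ?L = {}" using c(2) unfolding L m_def[symmetric] by auto
    then show ?thesis using c(1) cL unfolding S0_def by (subst card_Un_disjoint) auto
  qed
  have w0: "?w S0 \<noteq> 0"
  proof -
    have "loc q (- inverse q) y S0 p \<noteq> 0" if "p < n" for p
    proof (cases "partner y p = p")
      case True
      then show ?thesis using q(1) by (simp add: loc_def)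
    next
      case False
      then have "\<not> p < m" using strp[OF that] by simp
      moreover have "\<not> partner y p < m" using strp[of "partner y p"] closed_belowD[OF cl that] False by auto
      ultimately have "p \<in> S0 \<longleftrightarrow> p < partner y p" "partner y p \<in> S0 \<longleftrightarrow> partner y p < p"
        using c(2) that closed_belowD[OF cl that] by (auto simp: S0_def m_def lefts_iff)
      then show ?thesis using False q(1) by (cases "p < partner y p") (simp_all add: loc_def)
    qed
    then show ?thesis by (simp add: wt_def)
  qed
  have main: "C.F ?V S * ?w S0 = C.F ?V S0 * ?w S" if "S \<subseteq> {..<n}" "card S = c" for S
    using that
  proof (induction "\<Sum>S" arbitrary: S rule: less_induct)
    case less
    have fS: "finite S" using less.prems(1) finite_subset by blast
    have step: "C.F ?V S * ?w S0 = C.F ?V S0 * ?w S"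
      if k: "k + 1 \<in> S" "k \<notin> S"
        and a: "\<And>R. k \<notin> R \<Longrightarrow> k + 1 \<notin> R \<Longrightarrow> R \<subseteq> {..<n} \<Longrightarrow> C.F ?V (insert (k + 1) R) = a * C.F ?V (insert k R)"
        and b: "\<And>R. k \<notin> R \<Longrightarrow> k + 1 \<notin> R \<Longrightarrow> R \<subseteq> {..<n} \<Longrightarrow> ?w (insert (k + 1) R) = a * ?w (insert k R)" for k a
    proof -
      define R where "R = S - {k + 1}"
      have R: "S = insert (k + 1) R" "k \<notin> R" "k + 1 \<notin> R" "finite R" "R \<subseteq> {..<n}"
        using k fS less.prems(1) by (auto simp: R_def)
      have s: "\<Sum>S = Suc (\<Sum>(insert k R))" unfolding R(1) using R(2-4) by simp
      have "insert k R \<subseteq> {..<n}" using R(5) k less.prems(1) by auto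
      moreover have "card (insert k R) = c" using less.prems(2) R by simp
      ultimately have "C.F ?V (insert k R) * ?w S0 = C.F ?V S0 * ?w (insert k R)"
        using less.hyps[of "insert k R"] s by simp
      then show ?thesis
        unfolding R(1) a[OF R(2,3,5)] b[OF R(2,3,5)] by (simp only: mult.assoc mult.left_commute)
    qed
    consider (bad) p where "p < n" "partner y p \<noteq> p" "p \<in> S \<longleftrightarrow> partner y p \<in> S"
      | (cup) k where "simple_cup k y" "k + 1 < n" "k + 1 \<in> S" "k \<notin> S"
      | (str) k where "k + 1 < m" "k + 1 \<in> S" "k \<notin> S"
      | (final) "\<And>p. p < n \<Longrightarrow> partner y p \<noteq> p \<Longrightarrow> p \<in> S \<longleftrightarrow> partner y p \<notin> S"
        "\<And>k. simple_cup k y \<Longrightarrow> k + 1 < n \<Longrightarrow> k + 1 \<in> S \<Longrightarrow> k \<in> S"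
        "\<And>k. k + 1 < m \<Longrightarrow> k + 1 \<in> S \<Longrightarrow> k \<in> S"
      by blast
    then show ?case
    proof cases
      case bad
      have "C.F ?V S = 0" by (rule F_vanishes[of ?V p "partner y p"]) (use key bad in auto)
      moreover have "?w S = 0" by (rule wt_zero) (use bad in auto)
      ultimately show ?thesis by simp
    next
      case cup
      have "C.F ?V (insert (k + 1) R) = q * C.F ?V (insert k R)" if "k \<notin> R" "k + 1 \<notin> R" for R
        by (rule F_toggle[OF _ cup(2) that]) (rule keys_simple[OF _ cup(1)])
      then show ?thesis using wt_toggle[OF cup(1,2)] cup(3,4) by (intro step[of k q]) simp_all
    next
      case str
      then have kn: "k + 1 < n" "k < n" using m(2) by linarith+
      have sa: "strings_at k y" using strp[OF kn(1)] strp[OF kn(2)] str(1) by (simp add: strings_at_iff)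
      have "e_op \<delta> k ?V = 0" using comm[of "basis y" k] y(1) sa by (simp add: e_op_eqs)
      then show ?thesis
        using str(2,3) C_cap[OF tail kn(1)] wt_cap(1)[OF C.Qz cl kn(1) _ _ sa]
        by (intro step[of k "- inverse q"]) (simp_all add: C.F_zero eq_neg_iff_add_eq_0)
    next
      case final
      have hi: "p \<in> S \<longleftrightarrow> p \<in> ?L" if "m \<le> p" "p < n" for p
      proof (cases "p \<in> ?L")
        case True
        then have s: "simple_cup p y" using normal_below_simple[OF cl nb] by blast
        then have p: "partner y p = p + 1" by (simp add: simple_cup_def)
        then have "p + 1 < n" using closed_belowD[OF cl that(2)] by simp
        then have "p \<in> S" using final(1)[OF that(2)] final(2)[OF s] p by auto
        then show ?thesis using True by blast
      next
        case False
        then have r: "partner y p < p" using strp[OF that(2)] that by (simp add: lefts_iff)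
        note rs = right_simple[OF cl nb that(2) r]
        have "p \<notin> S"
        proof
          assume "p \<in> S"
          then have "partner y p \<in> S" using final(2)[OF rs(1)] rs(2) that(2) by simp
          then show False using final(1)[OF that(2)] r \<open>p \<in> S\<close> by auto
        qed
        then show ?thesis using False by blast
      qed
      have "S \<inter> {..<m} = {..<card (S \<inter> {..<m})}"
      proof (rule downset_eq)
        fix p assume "Suc p \<in> S \<inter> {..<m}"
        then show "p \<in> S \<inter> {..<m}" using final(3)[of p] by auto
      qed simp
      moreover have split: "S = (S \<inter> {..<m}) \<union> ?L"
      proof (rule set_eqI)
        fix p
        have "p \<in> ?L \<Longrightarrow> m \<le> p" unfolding L by blast
        then show "p \<in> S \<longleftrightarrow> p \<in> (S \<inter> {..<m}) \<union> ?L"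
          using hi[of p] less.prems(1) by (cases "p < m") auto
      qed
      moreover have "card S = card (S \<inter> {..<m}) + d"
      proof -
        have "(S \<inter> {..<m}) \<inter> ?L = {}" unfolding L by auto
        then have "card ((S \<inter> {..<m}) \<union> ?L) = card (S \<inter> {..<m}) + card ?L" by (intro card_Un_disjoint) auto
        then show ?thesis unfolding split[symmetric] cL .
      qed
      ultimately have "S = S0" unfolding S0_def using less.prems(2) by (metis add_diff_cancel_right')
      then show ?thesis by simp
    qed
  qed
  show ?thesis
  proof (rule exI[of _ "C.F ?V S0 / ?w S0"], intro allI impI)
    fix S assume "S \<subseteq> {..<n}" "card S = c"
    from main[OF this] show "C.F ?V S = C.F ?V S0 / ?w S0 * ?w S"
      using w0 by (simp add: field_simps)
  qed
qed

text \<open>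
  The constant of the normal form is passed on along the invertible moves. The weights of a state \<open>y\<close>
  are expressed by those of \<open>join_at (k + 1) y\<close> through the cap at \<open>k\<close>, and likewise for the images, since the
  homomorphism commutes with \<open>e k\<close>.
\<close>

lemma scaling:
  assumes hom: "joining_hom \<delta> w z \<psi> j" and y1: "y1 \<in> reach w" "\<And>p. n \<le> p \<Longrightarrow> partner y1 p = partner x0 p"
    and x0: "strings x0 = {..<n}" and w: "finite (strings w)" "n = num_strings w + 2 * d"
    and z: "finite (strings z)" "n = num_strings z + 2 * e"
    and c: "d \<le> c" "c - d \<le> num_strings w"
  shows "\<exists>\<gamma>. \<forall>y S. y \<in> reach w \<longrightarrow> (\<forall>p\<ge>n. partner y p = partner x0 p) \<longrightarrow> S \<subseteq> {..<n} \<longrightarrow> card S = c \<longrightarrow>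
    C.F (\<psi> (basis y)) S = \<gamma> * wt q (- inverse q) n y S"
proof -
  interpret joining_hom \<delta> w z \<psi> j by fact
  have cl: "closed_below n y" "card (strings y \<inter> {..<n}) = num_strings w"
    if "y \<in> reach w" "\<forall>p\<ge>n. partner y p = partner x0 p" for y
  proof -
    have t: "partner y p = partner x0 p" if "n \<le> p" for p using \<open>\<forall>p\<ge>n. _ p\<close> that by blast
    note s = same_tail[OF x0 that(1) w(1) t]
    show "closed_below n y" by (rule s(1))
    show "card (strings y \<inter> {..<n}) = num_strings w" using card_lefts[OF s(1)] s(2) by simp
  qed
  obtain ys where ys: "closed_below n ys" "normal_below n ys" "ys \<in> reach y1" "\<forall>p\<ge>n. partner ys p = partner y1 p"
    using ex_normal_form[OF cl(1)[OF y1(1)]] y1(2) by blast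
  have ysw: "ys \<in> reach w" "\<forall>p\<ge>n. partner ys p = partner x0 p"
    using reach_trans[OF ys(3) y1(1)] ys(4) y1(2) by simp_all
  obtain \<gamma> where \<gamma>: "\<And>S. S \<subseteq> {..<n} \<Longrightarrow> card S = c \<Longrightarrow> C.F (\<psi> (basis ys)) S = \<gamma> * wt q (- inverse q) n ys S"
    using scaling_normal[OF hom ysw(1) _ x0 w z c ys(2)] ysw(2) by blast
  let ?P = "\<lambda>y. y \<in> reach w \<longrightarrow> (\<forall>p\<ge>n. partner y p = partner x0 p) \<longrightarrow>
    (\<forall>S. S \<subseteq> {..<n} \<longrightarrow> card S = c \<longrightarrow> C.F (\<psi> (basis y)) S = \<gamma> * wt q (- inverse q) n y S)"
  have "?P y" if "closed_below n y" for y
    using that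
  proof (induction rule: normalize_induct)
    case (normal y)
    show ?case
    proof (intro impI)
      assume y: "y \<in> reach w" "\<forall>p\<ge>n. partner y p = partner x0 p"
      have "y = ys"
        by (rule normal_below_unique[OF normal ys(1,2)]) (use y ysw cl(2)[OF y] cl(2)[OF ysw] in simp_all)
      then show "\<forall>S. S \<subseteq> {..<n} \<longrightarrow> card S = c \<longrightarrow> C.F (\<psi> (basis y)) S = \<gamma> * wt q (- inverse q) n y S"
        using \<gamma> by blast
    qed
  next
    case (move y k)
    let ?y = "join_at (k + 1) y"
    note nx = join_next[OF move(2) disjI1[OF refl]]
    have kn: "k + 1 < n" using move(3) by simp
    show ?case
    proof (intro impI allI)
      fix S assume y: "y \<in> reach w" "\<forall>p\<ge>n. partner y p = partner x0 p" and S: "S \<subseteq> {..<n}" "card S = c"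
      have y': "?y \<in> reach w" "\<forall>p\<ge>n. partner ?y p = partner x0 p"
        using reach.step[OF y(1) nx(1)] join_at_beyond[OF move(1), of "k + 1"] move(3) y(2) by simp_all
      let ?V = "\<psi> (basis y)" and ?V' = "\<psi> (basis ?y)"
      have IH: "C.F ?V' S = \<gamma> * wt q (- inverse q) n ?y S" if "S \<subseteq> {..<n}" "card S = c" for S
        using move(5) y' that by blast
      have V: "?V = e_op \<delta> k ?V'"
        using comm[of "basis ?y" k] y'(1) nx by (simp add: e_op_eqs)
      have sV: "simple_cup k u" if "u \<in> supp ?V" for u
        using that unfolding V by (rule keys_e_op)
      have tail: "tail_of x0 e ?V'" by (rule tail_of_image[OF hom y'(1) _ x0 z]) (use y'(2) in blast)
      have left: "C.F ?V (insert k R) = \<gamma> * wt q (- inverse q) n y (insert k R)"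
        if R: "R \<subseteq> {..<n}" "k \<notin> R" "k + 1 \<notin> R" "card (insert k R) = c" for R
      proof -
        have f: "finite R" using R(1) finite_subset by blast
        have "C.F ?V (insert k R) = C.F ?V' (insert (k + 1) R) + inverse q * C.F ?V' (insert k R)"
          using C_cap[OF tail kn R(2,3)] unfolding V by simp
        also have "\<dots> = \<gamma> * (wt q (- inverse q) n ?y (insert (k + 1) R) - (- inverse q) * wt q (- inverse q) n ?y (insert k R))"
          using IH[of "insert (k + 1) R"] IH[of "insert k R"] R kn f by (simp add: distrib_left)
        also have "\<dots> = \<gamma> * wt q (- inverse q) n (join_at k ?y) (insert k R)"
          using wt_cap(3)[OF C.Qz closed_below_join_at[OF move(1)] kn R(2,3) nx(3,4)] move(3) by simp
        finally show ?thesis unfolding nx(5) .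
      qed
      consider "k \<in> S \<longleftrightarrow> k + 1 \<in> S" | "k \<in> S" "k + 1 \<notin> S" | "k + 1 \<in> S" "k \<notin> S" by blast
      then show "C.F ?V S = \<gamma> * wt q (- inverse q) n y S"
      proof cases
        case 1
        have "C.F ?V S = 0"
          by (rule F_vanishes[of ?V k "k + 1"]) (use sV 1 kn in \<open>auto simp: simple_cup_def\<close>)
        moreover have "wt q (- inverse q) n y S = 0"
          by (rule wt_zero[of k]) (use move(2) 1 kn in \<open>auto simp: simple_cup_def\<close>)
        ultimately show ?thesis by simp
      next
        case 2
        then have "S = insert k (S - {k})" by blast
        then show ?thesis using left[of "S - {k}"] 2 S by auto
      next
        case 3
        define R where "R = S - {k + 1}"
        have R: "S = insert (k + 1) R" "k \<notin> R" "k + 1 \<notin> R" "R \<subseteq> {..<n}" "finite R"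
          using 3 S(1) finite_subset[OF S(1)] by (auto simp: R_def)
        then have "card (insert k R) = c" using S(2) by simp
        note l = left[OF R(4,2,3) this]
        have "C.F ?V (insert (k + 1) R) = q * C.F ?V (insert k R)"
          by (rule F_toggle[OF _ kn R(2,3)]) (rule sV)
        then show ?thesis
          unfolding R(1) l wt_toggle[OF move(2) kn R(2,3)] by (simp only: mult.left_commute)
      qed
    qed
  qed
  then show ?thesis using cl(1) by blast
qed

lemma scaling_vector:
  assumes "joining_hom \<delta> w z \<psi> j" and v: "v \<in> xspace w"
    and s: "\<And>y. y \<in> supp v \<Longrightarrow> C.F (\<psi> (basis y)) S = \<gamma> * wt q (- inverse q) n y S"
  shows "C.F (\<psi> v) S = \<gamma> * C.F v S"
proof -
  interpret joining_hom \<delta> w z \<psi> j by fact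
  have "C.F (\<psi> v) S = (\<Sum>y\<in>supp v. coeff v y * C.F (\<psi> (basis y)) S)"
    unfolding expand[OF v] lin_ext_def by (simp add: C.F_sum C.F_pscale)
  also have "\<dots> = (\<Sum>y\<in>supp v. \<gamma> * (coeff v y * wt q (- inverse q) n y S))"
    by (rule sum.cong[OF refl]) (simp add: s)
  also have "\<dots> = \<gamma> * C.F v S" unfolding C.F_def by (rule sum_distrib_left[symmetric])
  finally show ?thesis .
qed

end

section \<open>The extensions do not split\<close>

lemma root_order_props:
  assumes "\<exists>m>0. q ^ m = (1 :: complex)"
  shows "0 < root_order q" "q ^ (2 * root_order q) = 1"
    "0 < c \<Longrightarrow> c < root_order q \<Longrightarrow> q ^ (2 * c) \<noteq> 1"
proof -
  obtain m where "0 < m" "q ^ m = 1" using assms by blast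
  then have "0 < m \<and> q ^ (2 * m) = 1" by (simp add: mult.commute[of 2] power_mult)
  from LeastI[of "\<lambda>l. 0 < l \<and> q ^ (2 * l) = 1", OF this]
  show "0 < root_order q" "q ^ (2 * root_order q) = 1" by (simp_all add: root_order_def)
  show "q ^ (2 * c) \<noteq> 1" if "0 < c" "c < root_order q"
    using not_less_Least[of c "\<lambda>l. 0 < l \<and> q ^ (2 * l) = 1"] that by (auto simp: root_order_def)
qed

lemma root_data_root_order:
  assumes "\<exists>m>0. q ^ m = (1 :: complex)" "q \<noteq> 1" "q \<noteq> -1"
  shows "root_data q (q + inverse q) (root_order q)"
proof
  obtain m where "0 < m" "q ^ m = 1" using assms(1) by blast
  then show "q \<noteq> 0" by (metis less_irrefl power_0_left zero_neq_one)
  show "q\<^sup>2 \<noteq> 1" using assms(2,3) by (simp add: power2_eq_1_iff)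
qed (use root_order_props[OF assms(1)] in simp_all)

lemma sum_uniq:
  fixes k d k' d' l :: nat
  assumes "k * l + d = k' * l + d'" "d < l" "d' < l"
  shows "k = k' \<and> d = d'"
proof -
  have "(k * l + d) div l = k" "(k' * l + d') div l = k'" using assms(2,3) by simp_all
  then have "k = k'" using assms(1) by simp
  then show ?thesis using assms(1) by simp
qed

text \<open>
  Splittings are tested at the state \<open>x0\<close>: since its strings are adjacent, all generators acting below
  \<open>n\<close> kill it.
\<close>

locale string_vector = root_data q \<delta> l n for q \<delta> :: complex and l n :: nat +
  fixes w x0 :: link_state
  assumes w: "finite (strings w)" "n = num_strings w"
    and x0: "x0 \<in> reach w" "strings x0 = {..<n}"
begin

lemma x0_strings_at: "k + 1 < n \<Longrightarrow> strings_at k x0"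
  using x0(2) by (simp add: strings_at_def)

lemma x0_beyond: "n \<le> p \<Longrightarrow> partner x0 p \<noteq> p"
  using x0(2) by (auto simp: strings_iff[symmetric])

lemma e_x0: "k + 1 < n \<Longrightarrow> e_op \<delta> k (basis x0) = 0"
  using x0_strings_at by (simp add: e_op_eqs)

lemma tail_of_splitting:
  assumes \<sigma>: "\<And>v. v \<in> xspace w \<Longrightarrow> \<sigma> v \<in> xspace z"
    "\<And>v k. v \<in> xspace w \<Longrightarrow> \<sigma> (e_op \<delta> k v) = e_op \<delta> k (\<sigma> v) + T k v"
    and T: "\<And>x k. x \<in> reach w \<Longrightarrow> \<not> strings_at k x \<Longrightarrow> T k (basis x) = 0"
    and z: "finite (strings z)" "n = num_strings z + 2 * e"
  shows "tail_of x0 e (\<sigma> (basis x0))"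
  unfolding tail_of_def
proof
  fix y assume y: "y \<in> supp (\<sigma> (basis x0))"
  have "\<sigma> (basis x0) \<in> xspace z" using x0(1) by (intro \<sigma>(1)) simp
  then have yz: "y \<in> reach z" using y by (auto simp: xspace_def)
  have cup: "partner y a = partner x0 a" if "a < partner x0 a" for a
    using cups_preserved[of w \<sigma> \<delta> T, OF \<sigma>(2) T x0(1) that refl y] by simp
  have tail: "partner y p = partner x0 p" if "n \<le> p" for p
  proof (cases "p < partner x0 p")
    case False
    then have "partner x0 p < p" using x0_beyond[OF that] by simp
    then have "partner y (partner x0 p) = p" using cup[of "partner x0 p"] by simp
    then show ?thesis by (metis partner_partner)
  qed (rule cup)
  from same_tail[OF x0(2) yz z(1) tail] z(2) tail
  show "closed_below n y \<and> card (lefts y \<inter> {..<n}) = e \<and> (\<forall>p\<ge>n. partner y p = partner x0 p)" by simp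
qed

lemma invariant_image:
  assumes "link_hom \<delta> w z \<phi>" "k + 1 < n"
  shows "e_op \<delta> k (\<phi> (basis x0)) = 0"
proof -
  interpret link_hom \<delta> w z \<phi> by fact
  show ?thesis using comm[of "basis x0" k] x0(1) e_x0[OF assms(2)] by simp
qed

lemma first_extension:
  assumes hom: "joining_hom \<delta> w z \<phi> j" and nz: "v0 \<in> xspace w" "\<phi> v0 \<noteq> 0"
    and z: "finite (strings z)" "n = num_strings z + 2 * d"
    and n: "n + 1 = k * l + d" "0 < d" "0 < k"
  shows "\<not> splits (twisted_sum \<delta> (X_rep \<delta> z) (X_rep \<delta> w) (e_tilde \<phi>)) snd (X_rep \<delta> w)"
proof
  interpret joining_hom \<delta> w z \<phi> j by fact
  interpret t: twisting \<delta> w z "e_tilde \<phi>" by (rule twisting_e_tilde)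
  assume "splits (twisted_sum \<delta> (X_rep \<delta> z) (X_rep \<delta> w) (e_tilde \<phi>)) snd (X_rep \<delta> w)"
  then obtain \<sigma> where \<sigma>: "\<sigma> 0 = 0" "\<And>v. v \<in> xspace w \<Longrightarrow> \<sigma> v \<in> xspace z"
    "\<And>v k. v \<in> xspace w \<Longrightarrow> \<sigma> (e_op \<delta> k v) = e_op \<delta> k (\<sigma> v) + e_tilde \<phi> k v"
    using t.splits_E unfolding t.E_def[symmetric] by blast
  let ?u = "\<phi> (basis x0)" and ?v = "\<sigma> (basis x0)"
  have "?u = 0"
  proof (rule no_first_order_lift)
    show "tail_of x0 d ?u" by (rule tail_of_image[OF hom x0(1) refl x0(2) z])
    show "e_op \<delta> k ?u = 0" if "k + 1 < n" for k by (rule invariant_image[OF link_hom_axioms that])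
    show "tail_of x0 d ?v"
      by (rule tail_of_splitting[OF \<sigma>(2,3) _ z]) (simp_all add: e_tilde_basis)
    show "e_op \<delta> k ?v = - simple_cup_part k ?u" if "k + 1 < n" for k
      using \<sigma>(3)[of "basis x0" k] \<sigma>(1) x0(1) e_x0[OF that] x0_strings_at[OF that]
      by (simp add: e_tilde_basis eq_neg_iff_add_eq_0)
    show "n + 1 = k * l + d" "0 < d" "0 < k" "d \<le> n" using n z(2) by simp_all
  qed
  then show False using nonzero_on_basis[OF nz x0(1)] by simp
qed

lemma second_extension:
  assumes hom: "joining_hom \<delta> w w' \<phi> j" and nz: "v0 \<in> xspace w" "\<phi> v0 \<noteq> 0"
    and hom': "joining_hom \<delta> w' w'' \<phi>' j'" and nz': "v1 \<in> xspace w'" "\<phi>' v1 \<noteq> 0"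
    and w': "finite (strings w')" "n = num_strings w' + 2 * d"
    and w'': "finite (strings w'')" "n = num_strings w'' + 2 * l"
    and n: "n + 1 = k * l + d" "0 < d" "d < l" "2 \<le> k"
  shows "\<not> splits (twisted_sum \<delta> (X_rep \<delta> w'') (X_rep \<delta> w) (\<lambda>k x. e_tilde \<phi>' k (\<phi> x))) snd (X_rep \<delta> w)"
proof
  interpret p: joining_hom \<delta> w w' \<phi> j by fact
  interpret p': joining_hom \<delta> w' w'' \<phi>' j' by fact
  let ?T = "\<lambda>k x. e_tilde \<phi>' k (\<phi> x)"
  interpret t: twisting \<delta> w w'' ?T by (rule p.twisting_comp[OF p'.twisting_e_tilde])
  assume "splits (twisted_sum \<delta> (X_rep \<delta> w'') (X_rep \<delta> w) ?T) snd (X_rep \<delta> w)"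
  then obtain \<sigma> where \<sigma>: "\<sigma> 0 = 0" "\<And>v. v \<in> xspace w \<Longrightarrow> \<sigma> v \<in> xspace w''"
    "\<And>v k. v \<in> xspace w \<Longrightarrow> \<sigma> (e_op \<delta> k v) = e_op \<delta> k (\<sigma> v) + ?T k v"
    using t.splits_E unfolding t.E_def[symmetric] by blast
  let ?u = "\<phi> (basis x0)" and ?v = "\<sigma> (basis x0)"
  have tu: "tail_of x0 d ?u" by (rule tail_of_image[OF hom x0(1) refl x0(2) w'])
  have eu: "e_op \<delta> k ?u = 0" if "k + 1 < n" for k by (rule invariant_image[OF p.link_hom_axioms that])
  have u: "?u \<in> xspace w'" using x0(1) by (intro p.maps) simp
  have u0: "?u \<noteq> 0" by (rule p.nonzero_on_basis[OF nz x0(1)])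
  then obtain y1 where y1: "y1 \<in> supp ?u" by fastforce
  have uk: "y \<in> reach w'" "\<forall>p\<ge>n. partner y p = partner x0 p" if "y \<in> supp ?u" for y
    using u that tail_ofD(2)[OF tu that] by (auto simp: xspace_def)
  \<comment> \<open>\<open>\<phi>\<close> creates no strings, so a state without strings at \<open>k, k + 1\<close> has no image term with them\<close>
  have T0: "?T k (basis x) = 0" if x: "x \<in> reach w" "\<not> strings_at k x" for x k
    unfolding e_tilde_def lin_ext_def
  proof (rule sum.neutral, rule ballI)
    fix y assume "y \<in> supp (\<phi> (basis x))"
    then have "\<not> strings_at k y" using joined_strings_at[OF p.joins[OF x(1)]] x(2) by blast
    then show "pscale (coeff (\<phi> (basis x)) y)
      (if strings_at k y then simple_cup_part k (\<phi>' (basis y)) else 0) = 0" by simp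
  qed
  have kl: "2 * l \<le> k * l" using n(4) by simp
  have c: "d \<le> l" "l - d \<le> num_strings w'"
    using n(3) w'(2) n(1) kl by linarith+
  obtain \<gamma> where \<gamma>: "\<And>y S. y \<in> reach w' \<Longrightarrow> \<forall>p\<ge>n. partner y p = partner x0 p \<Longrightarrow> S \<subseteq> {..<n} \<Longrightarrow> card S = l \<Longrightarrow>
      C.F (\<phi>' (basis y)) S = \<gamma> * wt q (- inverse q) n y S"
    using scaling[OF hom' uk(1)[OF y1] _ x0(2) w' w'' c] uk(2)[OF y1] by blast
  have image: "tail_of x0 l (\<phi>' (basis y))" if "y \<in> supp ?u" for y
    by (rule tail_of_image[OF hom' uk(1)[OF that] _ x0(2) w'']) (use uk(2)[OF that] in blast)
  \<comment> \<open>otherwise independence makes \<open>\<phi>'\<close> vanish on a state and hence everywhere\<close>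
  have "\<gamma> \<noteq> 0"
  proof
    assume "\<gamma> = 0"
    then have "\<phi>' (basis y1) = 0"
      using independent[OF image[OF y1]] \<gamma>[OF uk[OF y1]] by simp
    then show False using p'.nonzero_on_basis[OF nz' uk(1)[OF y1]] by simp
  qed
  have s: "C.F (\<phi>' v) S = \<gamma> * C.F v S"
    if "supp v \<subseteq> supp ?u" "S \<subseteq> {..<n}" "card S = l" for v S
    by (rule scaling_vector[OF hom']) (use that uk \<gamma> in \<open>auto simp: xspace_def\<close>)
  \<comment> \<open>this leaves only the second term of the commutator in \<open>?T k (basis x0)\<close>\<close>
  have "\<phi>' ?u = 0"
  proof (rule independent)
    have "supp (\<phi>' ?u) \<subseteq> (\<Union>y\<in>supp ?u. supp (\<phi>' (basis y)))"
      unfolding p'.expand[OF u] by (rule keys_lin_ext)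
    then show "tail_of x0 l (\<phi>' ?u)" using image by (fastforce simp: tail_of_def)
    fix S assume S: "S \<subseteq> {..<n}" "card S = l"
    have "0 < k" using n(4) by simp
    from symmetric_vanishes[OF n(1-3) this tu eu S] s[OF subset_refl S] show "C.F (\<phi>' ?u) S = 0" by simp
  qed
  have "?u = 0"
  proof (rule no_second_lift[OF n tu eu])
    show "tail_of x0 l ?v" by (rule tail_of_splitting[OF \<sigma>(2,3) T0 w''])
    show "e_op \<delta> k ?v = \<phi>' (simple_cup_part k ?u)" if "k + 1 < n" for k
      using \<sigma>(3)[of "basis x0" k] \<sigma>(1) x0(1) e_x0[OF that] p'.e_tilde_commutator[OF u, of k] \<open>\<phi>' ?u = 0\<close>
      by simp
    show "C.F (\<phi>' (simple_cup_part k ?u)) S = \<gamma> * C.F (simple_cup_part k ?u) S"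
      if "S \<subseteq> {..<n}" "card S = l" for k S
      using that by (intro s) (auto simp: keys_simple_cup_part)
  qed (use \<open>\<gamma> \<noteq> 0\<close> in simp_all)
  then show False using u0 by simp
qed

end

theorem mainTheorem5:
  fixes q \<delta> :: complex
    and w w' w'' :: link_state
    and \<phi> \<phi>' :: "link_space \<Rightarrow> link_space"
  assumes "\<exists>n>0. q ^ n = 1" and "q \<noteq> 1" and "q \<noteq> -1"
    and "\<delta> = q + inverse q"
    and "finitely_differ w w'" and "finitely_differ w' w''" and "finitely_differ w w''"
    and "finite (strings w)" and "finite (strings w')" and "finite (strings w'')"
    and "num_strings w > num_strings w'" and "num_strings w' > num_strings w''"
    and "symmetric_pair q w w'" and "symmetric_pair q w' w''"
    and "pair_hom \<delta> w w' \<phi>" and "pair_hom \<delta> w' w'' \<phi>'"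
  shows "nonsplit_extension \<delta> (X_rep \<delta> w') (\<lambda>v. (v, 0)) (P_rep \<delta> w w' \<phi>) snd (X_rep \<delta> w) \<and>
         nonsplit_extension \<delta> (X_rep \<delta> w'') (\<lambda>v. (v, 0)) (Q_rep \<delta> w w'' \<phi> \<phi>') snd (X_rep \<delta> w)"
proof -
  define l where "l = root_order q"
  define n where "n = num_strings w"
  obtain k d where kd: "1 \<le> k" "0 < d" "d < l" "n + 1 = k * l + d" "num_strings w' + 1 = k * l - d"
    using assms(13) unfolding symmetric_pair_def l_def n_def by blast
  obtain k' d' where kd': "1 \<le> k'" "0 < d'" "d' < l" "num_strings w' + 1 = k' * l + d'"
    "num_strings w'' + 1 = k' * l - d'"
    using assms(14) unfolding symmetric_pair_def l_def by blast
  \<comment> \<open>division of \<open>num_strings w' + 1\<close> by \<open>l\<close> links the two pairs\<close>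
  have kl: "k * l = (k - 1) * l + l" using kd(1) by (cases k) simp_all
  have "(k - 1) * l + (l - d) = k' * l + d'" using kd(3,5) kd'(4) kl by linarith
  then have k': "k - 1 = k'" "l - d = d'" using sum_uniq[of "k - 1" l "l - d" k' d'] kd(2,3) kd'(3) by auto
  have k2: "2 \<le> k" using k'(1) kd'(1) by simp
  have n': "n = num_strings w' + 2 * d" using kd by linarith
  have n'': "n = num_strings w'' + 2 * l"
  proof -
    have "k * l = k' * l + l" using kl unfolding k'(1) .
    moreover have "l \<le> k' * l" using kd'(1) by simp
    ultimately show ?thesis using kd(2-4) kd'(5) k'(2) by linarith
  qed
  obtain x0 where x0: "x0 \<in> reach w" "strings x0 = {..<n}"
    using ex_strings_left[OF assms(8)] unfolding n_def by blast
  interpret root_data q \<delta> l n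
    unfolding assms(4) l_def by (rule root_data_root_order[OF assms(1-3)])
  interpret string_vector q \<delta> l n w x0
    by unfold_locales (use assms(8) x0 n_def in simp_all)
  note h = pair_hom_joining[OF assms(15)] and h' = pair_hom_joining[OF assms(16)]
  interpret p: joining_hom \<delta> w w' \<phi> "num_strings w - num_strings w'" by (rule h)
  interpret p': joining_hom \<delta> w' w'' \<phi>' "num_strings w' - num_strings w''" by (rule h')
  obtain v0 where v0: "v0 \<in> xspace w" "\<phi> v0 \<noteq> 0"
    using assms(15) by (auto simp: pair_hom_def X_rep_eq)
  obtain v1 where v1: "v1 \<in> xspace w'" "\<phi>' v1 \<noteq> 0"
    using assms(16) by (auto simp: pair_hom_def X_rep_eq)
  have k0: "0 < k" using kd(1) by simp
  show ?thesis
    unfolding nonsplit_extension_def P_rep_def Q_rep_def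
    using first_extension[OF h v0 assms(9) n' kd(4,2) k0]
      second_extension[OF h v0 h' v1 assms(9) n' assms(10) n'' kd(4,2,3) k2]
      twisting.short_exact_E[OF p.twisting_e_tilde]
      twisting.short_exact_E[OF p.twisting_comp[OF p'.twisting_e_tilde]]
      twisting.E_def[OF p.twisting_e_tilde] twisting.E_def[OF p.twisting_comp[OF p'.twisting_e_tilde]]
    by simp
qed

end
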